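(* Let $(\mathfrak A,\theta)$ be a unital $\mathbb Z_2$-graded $C^*$-algebra. The $C^*$-dynamical system $(\hat\otimes_{\min}^{\mathbb N}\mathfrak A,\mathbb{P}_{\mathbb N},\{\alpha_\sigma:\sigma\in\mathbb{P}_{\mathbb N}\})$ is weakly ergodic, i.e. if $x\in\hat\otimes_{\min}^{\mathbb N}\mathfrak A$ satisfies $\alpha_\sigma(x)=x$ for every $\sigma\in\mathbb{P}_{\mathbb N}$, then $x=\lambda1$ for some $\lambda\in\mathbb C$.
   Context: A $\mathbb Z_2$-graded $C^*$-algebra is a pair $(\mathfrak A,\theta)$ with $\theta$ a $*$-automorphism, $\theta^2=\mathrm{id}$; $a$ is even if $\theta(a)=a$, odd if $\theta(a)=-a$, homogeneous if even or odd. A state $\rho$ is even if $\rho\circ\theta=\rho$. For homogeneous $a,b$ put $\varepsilon(a,b)=-1$ if both are odd and $1$ otherwise. The algebraic Fermi tensor product $\mathfrak A_1\hat\otimes\cdots\hat\otimes\mathfrak A_n$ of graded algebras is the algebraic tensor product with, for homogeneous $a_i,b_i\in\mathfrak A_i$, $(a_1\hat\otimes\cdots\hat\otimes a_n)(b_1\hat\otimes\cdots\hat\otimes b_n)=\prod_{i>j}\varepsilon(a_i,b_j)\,a_1b_1\hat\otimes\cdots\hat\otimes a_nb_n$ and $(a_1\hat\otimes\cdots\hat\otimes a_n)^*=\prod_{i<j}\varepsilon(a_i,a_j)\,a_1^*\hat\otimes\cdots\hat\otimes a_n^*$. Its minimal completion is with respect to $\|x\|_{\min}=\sup\|\pi_\varphi(x)\|$,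 the supremum over product states $\varphi=\omega_1\times\cdots\times\omega_n$, $\varphi(a_1\hat\otimes\cdots\hat\otimes a_n)=\prod_i\omega_i(a_i)$, with all $\omega_i$ even states on $\mathfrak A_i$, and $\pi_\varphi$ the GNS representation. $\hat\otimes^{\mathbb N}_{\min}\mathfrak A$ is the inductive limit of the $n$-fold minimal Fermi products of $\mathfrak A$ with itself under $x\mapsto x\hat\otimes1$. For $j\in\mathbb N=\{1,2,\dots\}$, $i_j:\mathfrak A\to\hat\otimes^{\mathbb N}_{\min}\mathfrak A$ is the embedding in the $j$-th place, so $a_1\hat\otimes\cdots\hat\otimes a_n\hat\otimes1\hat\otimes\cdots=i_1(a_1)\cdots i_n(a_n)$. $\mathbb{P}_{\mathbb N}$ is the group of permutations of $\mathbb N$ moving finitely many points; it acts on $\hat\otimes^{\mathbb N}_{\min}\mathfrak A$ by the $*$-automorphisms $\alpha_\sigma$ determined by $\alpha_\sigma(i_j(a))=i_{\sigma(j)}(a)$, $a\in\mathfrak A$, $j\in\mathbb N$. *)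

theory Defs
  imports "HOL-Analysis.Analysis" "HOL-Library.Poly_Mapping" "HOL-Combinatorics.Perm"
begin

section \<open>Unital C*-algebras\<close>

class scaleC =
  fixes scaleC :: "complex \<Rightarrow> 'a \<Rightarrow> 'a"  (infixr \<open>*\<^sub>C\<close> 75)

class complex_vector = scaleC + ab_group_add +
  assumes scaleC_add_right: "c *\<^sub>C (x + y) = c *\<^sub>C x + c *\<^sub>C y"
    and scaleC_add_left: "(c + d) *\<^sub>C x = c *\<^sub>C x + d *\<^sub>C x"
    and scaleC_scaleC: "c *\<^sub>C d *\<^sub>C x = (c * d) *\<^sub>C x"
    and scaleC_one: "1 *\<^sub>C x = x"

interpretation complex_vector:
  vector_space "scaleC :: complex \<Rightarrow> 'a \<Rightarrow> 'a::complex_vector"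
  by unfold_locales (simp_all add: scaleC_add_right scaleC_add_left scaleC_scaleC scaleC_one)

abbreviation clinear :: "('a::complex_vector \<Rightarrow> 'b::complex_vector) \<Rightarrow> bool"
  where "clinear \<equiv> Vector_Spaces.linear (*\<^sub>C) (*\<^sub>C)"

abbreviation cfunctional :: "('a::complex_vector \<Rightarrow> complex) \<Rightarrow> bool"
  where "cfunctional \<equiv> Vector_Spaces.linear (*\<^sub>C) (*)"

class unital_cstar_algebra = complex_vector + real_normed_algebra_1 + banach +
  fixes star :: "'a \<Rightarrow> 'a"
  assumes scaleR_scaleC: "r *\<^sub>R x = complex_of_real r *\<^sub>C x"
    and norm_scaleC: "norm (c *\<^sub>C x) = cmod c * norm x"
    and mult_scaleC_left: "(c *\<^sub>C x) * y = c *\<^sub>C (x * y)"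
    and mult_scaleC_right: "x * (c *\<^sub>C y) = c *\<^sub>C (x * y)"
    and star_star: "star (star x) = x"
    and star_add: "star (x + y) = star x + star y"
    and star_scaleC: "star (c *\<^sub>C x) = cnj c *\<^sub>C star x"
    and star_mult: "star (x * y) = star y * star x"
    and cstar_identity: "norm (star x * x) = (norm x)\<^sup>2"


section \<open>Gradings and even states\<close>

definition grading :: "('a::unital_cstar_algebra \<Rightarrow> 'a) \<Rightarrow> bool" where
  "grading \<theta> \<longleftrightarrow> clinear \<theta> \<and> bij \<theta> \<and> (\<forall>a b. \<theta> (a * b) = \<theta> a * \<theta> b) \<and>
     (\<forall>a. \<theta> (star a) = star (\<theta> a)) \<and> (\<forall>a. \<theta> (\<theta> a) = a)"

definition even_elem :: "('a::unital_cstar_algebra \<Rightarrow> 'a) \<Rightarrow> 'a \<Rightarrow> bool" where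
  "even_elem \<theta> a \<longleftrightarrow> \<theta> a = a"

definition odd_elem :: "('a::unital_cstar_algebra \<Rightarrow> 'a) \<Rightarrow> 'a \<Rightarrow> bool" where
  "odd_elem \<theta> a \<longleftrightarrow> \<theta> a = - a"

definition homogeneous :: "('a::unital_cstar_algebra \<Rightarrow> 'a) \<Rightarrow> 'a \<Rightarrow> bool" where
  "homogeneous \<theta> a \<longleftrightarrow> even_elem \<theta> a \<or> odd_elem \<theta> a"

definition eps :: "('a::unital_cstar_algebra \<Rightarrow> 'a) \<Rightarrow> 'a \<Rightarrow> 'a \<Rightarrow> complex" where
  "eps \<theta> a b = (if odd_elem \<theta> a \<and> odd_elem \<theta> b then - 1 else 1)"

definition state :: "('a::unital_cstar_algebra \<Rightarrow> complex) \<Rightarrow> bool" where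
  "state \<omega> \<longleftrightarrow> cfunctional \<omega> \<and> \<omega> 1 = 1 \<and>
     (\<forall>a. Im (\<omega> (star a * a)) = 0 \<and> 0 \<le> Re (\<omega> (star a * a)))"

definition even_state ::
    "('a::unital_cstar_algebra \<Rightarrow> 'a) \<Rightarrow> ('a \<Rightarrow> complex) \<Rightarrow> bool" where
  "even_state \<theta> \<omega> \<longleftrightarrow> state \<omega> \<and> \<omega> \<circ> \<theta> = \<omega>"


section \<open>The algebraic infinite tensor product\<close>

text \<open>The inductive limit of the vector spaces \<open>A \<otimes> \<dots> \<otimes> A\<close> under \<open>x \<mapsto> x \<otimes> 1\<close>: the free complex
  vector space on lists over \<open>A\<close> (the list \<open>[a\<^sub>1, \<dots>, a\<^sub>n]\<close> standing for \<open>a\<^sub>1 \<otimes> \<dots> \<otimes> a\<^sub>n\<close>) modulo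
  multilinearity and modulo the identification of \<open>xs\<close> with \<open>xs @ [1]\<close>. As the connecting maps are
  injective, the \<open>n\<close>-fold tensor product is the span of the tensors of lists of length \<open>n\<close>.\<close>

definition fscale :: "complex \<Rightarrow> ('b \<Rightarrow>\<^sub>0 complex) \<Rightarrow> ('b \<Rightarrow>\<^sub>0 complex)" where
  "fscale c = Poly_Mapping.map ((*) c)"

lemma lookup_fscale [simp]: "Poly_Mapping.lookup (fscale c x) k = c * Poly_Mapping.lookup x k"
  unfolding fscale_def by transfer (simp add: when_def)

inductive_set tensor_null :: "('a::unital_cstar_algebra list \<Rightarrow>\<^sub>0 complex) set" where
  zero: "0 \<in> tensor_null"
| add: "x \<in> tensor_null \<Longrightarrow> y \<in> tensor_null \<Longrightarrow> x + y \<in> tensor_null"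
| scale: "x \<in> tensor_null \<Longrightarrow> fscale c x \<in> tensor_null"
| slot_add: "i < length xs \<Longrightarrow>
    Poly_Mapping.single (xs[i := a + b]) 1 - Poly_Mapping.single (xs[i := a]) 1
      - Poly_Mapping.single (xs[i := b]) 1 \<in> tensor_null"
| slot_scale: "i < length xs \<Longrightarrow>
    Poly_Mapping.single (xs[i := c *\<^sub>C a]) 1 - fscale c (Poly_Mapping.single (xs[i := a]) 1)
      \<in> tensor_null"
| unit: "Poly_Mapping.single (xs @ [1]) 1 - Poly_Mapping.single xs 1 \<in> tensor_null"

lemma tensor_null_uminus: "x \<in> tensor_null \<Longrightarrow> - x \<in> tensor_null"
proof -
  assume "x \<in> tensor_null"
  then have "fscale (- 1) x \<in> tensor_null" by (rule tensor_null.scale)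
  moreover have "fscale (- 1) x = - x" by (rule poly_mapping_eqI) simp
  ultimately show ?thesis by simp
qed

lemma fscale_add: "fscale c (x + y) = fscale c x + fscale c y"
  by (rule poly_mapping_eqI) (simp add: lookup_add algebra_simps)

lemma fscale_diff: "fscale c (x - y) = fscale c x - fscale c y"
  by (rule poly_mapping_eqI) (simp add: lookup_minus algebra_simps)

quotient_type (overloaded) 'a tensor =
  "'a::unital_cstar_algebra list \<Rightarrow>\<^sub>0 complex" / "\<lambda>x y. x - y \<in> tensor_null"
proof (rule equivpI)
  show "reflp (\<lambda>x y. x - y \<in> (tensor_null :: ('a list \<Rightarrow>\<^sub>0 complex) set))"
    by (simp add: reflp_def tensor_null.zero)
  show "symp (\<lambda>x y. x - y \<in> (tensor_null :: ('a list \<Rightarrow>\<^sub>0 complex) set))"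
  proof (rule sympI)
    fix x y :: "'a list \<Rightarrow>\<^sub>0 complex"
    assume "x - y \<in> tensor_null"
    then have "- (x - y) \<in> tensor_null" by (rule tensor_null_uminus)
    then show "y - x \<in> tensor_null" by simp
  qed
  show "transp (\<lambda>x y. x - y \<in> (tensor_null :: ('a list \<Rightarrow>\<^sub>0 complex) set))"
  proof (rule transpI)
    fix x y z :: "'a list \<Rightarrow>\<^sub>0 complex"
    assume "x - y \<in> tensor_null" "y - z \<in> tensor_null"
    then have "(x - y) + (y - z) \<in> tensor_null" by (rule tensor_null.add)
    then show "x - z \<in> tensor_null" by simp
  qed
qed

instantiation tensor :: (unital_cstar_algebra) complex_vector
begin

lift_definition zero_tensor :: "'a tensor" is 0 .

lift_definition plus_tensor :: "'a tensor \<Rightarrow> 'a tensor \<Rightarrow> 'a tensor" is "(+)"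
proof -
  fix x x' y y' :: "'a list \<Rightarrow>\<^sub>0 complex"
  assume "x - x' \<in> tensor_null" "y - y' \<in> tensor_null"
  then have "(x - x') + (y - y') \<in> tensor_null" by (rule tensor_null.add)
  then show "x + y - (x' + y') \<in> tensor_null" by (simp add: algebra_simps)
qed

lift_definition uminus_tensor :: "'a tensor \<Rightarrow> 'a tensor" is uminus
proof -
  fix x x' :: "'a list \<Rightarrow>\<^sub>0 complex"
  assume "x - x' \<in> tensor_null"
  then have "- (x - x') \<in> tensor_null" by (rule tensor_null_uminus)
  then show "- x - - x' \<in> tensor_null" by simp
qed

lift_definition minus_tensor :: "'a tensor \<Rightarrow> 'a tensor \<Rightarrow> 'a tensor" is "(-)"
proof -
  fix x x' y y' :: "'a list \<Rightarrow>\<^sub>0 complex"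
  assume "x - x' \<in> tensor_null" "y - y' \<in> tensor_null"
  then have "(x - x') + - (y - y') \<in> tensor_null"
    by (intro tensor_null.add tensor_null_uminus)
  then show "x - y - (x' - y') \<in> tensor_null" by (simp add: algebra_simps)
qed

lift_definition scaleC_tensor :: "complex \<Rightarrow> 'a tensor \<Rightarrow> 'a tensor" is fscale
  by (simp add: fscale_diff [symmetric] tensor_null.scale)

instance
proof
  fix x y z :: "'a tensor" and c d :: complex
  show "x + y + z = x + (y + z)" by transfer (simp add: add.assoc tensor_null.zero)
  show "x + y = y + x" by transfer (simp add: add.commute tensor_null.zero)
  show "0 + x = x" by transfer (simp add: tensor_null.zero)
  show "- x + x = 0" by transfer (simp add: tensor_null.zero)
  show "x - y = x + - y" by transfer (simp add: tensor_null.zero)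
  show "c *\<^sub>C (x + y) = c *\<^sub>C x + c *\<^sub>C y"
    by transfer (simp add: fscale_add tensor_null.zero)
  show "(c + d) *\<^sub>C x = c *\<^sub>C x + d *\<^sub>C x"
  proof transfer
    fix c d and x :: "'a list \<Rightarrow>\<^sub>0 complex"
    have "fscale (c + d) x = fscale c x + fscale d x"
      by (rule poly_mapping_eqI) (simp add: lookup_add algebra_simps)
    then show "fscale (c + d) x - (fscale c x + fscale d x) \<in> tensor_null"
      by (simp add: tensor_null.zero)
  qed
  show "c *\<^sub>C d *\<^sub>C x = (c * d) *\<^sub>C x"
  proof transfer
    fix c d and x :: "'a list \<Rightarrow>\<^sub>0 complex"
    have "fscale c (fscale d x) = fscale (c * d) x"
      by (rule poly_mapping_eqI) (simp add: algebra_simps)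
    then show "fscale c (fscale d x) - fscale (c * d) x \<in> tensor_null"
      by (simp add: tensor_null.zero)
  qed
  show "1 *\<^sub>C x = x"
  proof transfer
    fix x :: "'a list \<Rightarrow>\<^sub>0 complex"
    have "fscale 1 x = x" by (rule poly_mapping_eqI) simp
    then show "fscale 1 x - x \<in> tensor_null" by (simp add: tensor_null.zero)
  qed
qed

end

lift_definition tens :: "'a::unital_cstar_algebra list \<Rightarrow> 'a tensor"
  is "\<lambda>xs. Poly_Mapping.single xs 1" .

definition tunit :: "'a::unital_cstar_algebra tensor" where
  "tunit = tens [1]"

definition nfold :: "nat \<Rightarrow> 'a::unital_cstar_algebra tensor set" where
  "nfold n = complex_vector.span (tens ` {xs. length xs = n})"

text \<open>Positions are numbered from \<open>0\<close>: \<open>emb j a = 1 \<otimes> \<dots> \<otimes> 1 \<otimes> a\<close> with \<open>j\<close> factors \<open>1\<close>.\<close>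

definition emb :: "nat \<Rightarrow> 'a::unital_cstar_algebra \<Rightarrow> 'a tensor" where
  "emb j a = tens (replicate j 1 @ [a])"


section \<open>The Fermi *-algebra structure\<close>

text \<open>Homogeneous elementary tensors span, and any two of them may be padded by units to a common
  length (which changes no sign, since \<open>1\<close> is even and not odd), so the formulas below determine
  the product and the involution.\<close>

definition fermi_mult ::
    "('a::unital_cstar_algebra \<Rightarrow> 'a) \<Rightarrow> 'a tensor \<Rightarrow> 'a tensor \<Rightarrow> 'a tensor" where
  "fermi_mult \<theta> = (THE m. (\<forall>x. clinear (m x)) \<and> (\<forall>y. clinear (\<lambda>x. m x y)) \<and>
     (\<forall>as bs. length as = length bs \<longrightarrow> list_all (homogeneous \<theta>) as \<longrightarrow>
        list_all (homogeneous \<theta>) bs \<longrightarrow>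
        m (tens as) (tens bs) =
          (\<Prod>i<length as. \<Prod>j<i. eps \<theta> (as ! i) (bs ! j)) *\<^sub>C tens (map2 (*) as bs)))"

definition fermi_star :: "('a::unital_cstar_algebra \<Rightarrow> 'a) \<Rightarrow> 'a tensor \<Rightarrow> 'a tensor" where
  "fermi_star \<theta> = (THE s. (\<forall>x y. s (x + y) = s x + s y) \<and> (\<forall>c x. s (c *\<^sub>C x) = cnj c *\<^sub>C s x) \<and>
     (\<forall>as. list_all (homogeneous \<theta>) as \<longrightarrow>
        s (tens as) =
          (\<Prod>j<length as. \<Prod>i<j. eps \<theta> (as ! i) (as ! j)) *\<^sub>C tens (map star as)))"

definition fermi_automorphism ::
    "('a::unital_cstar_algebra \<Rightarrow> 'a) \<Rightarrow> ('a tensor \<Rightarrow> 'a tensor) \<Rightarrow> bool" where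
  "fermi_automorphism \<theta> f \<longleftrightarrow> clinear f \<and> bij f \<and>
     (\<forall>x y. f (fermi_mult \<theta> x y) = fermi_mult \<theta> (f x) (f y)) \<and>
     (\<forall>x. f (fermi_star \<theta> x) = fermi_star \<theta> (f x))"

definition perm_alg ::
    "('a::unital_cstar_algebra \<Rightarrow> 'a) \<Rightarrow> nat perm \<Rightarrow> 'a tensor \<Rightarrow> 'a tensor" where
  "perm_alg \<theta> \<sigma> = (THE f. fermi_automorphism \<theta> f \<and>
     (\<forall>j a. f (emb j a) = emb (Perm.apply \<sigma> j) a))"


section \<open>Completion of a seminormed space\<close>

text \<open>A point of the separated completion of the subspace \<open>V\<close> with respect to the seminorm \<open>p\<close> is
  a class of \<open>p\<close>-Cauchy sequences modulo \<open>p\<close>-null sequences.\<close>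

definition cauchy_seq :: "'v::ab_group_add set \<Rightarrow> ('v \<Rightarrow> real) \<Rightarrow> (nat \<Rightarrow> 'v) \<Rightarrow> bool" where
  "cauchy_seq V p s \<longleftrightarrow>
     range s \<subseteq> V \<and> (\<forall>e>0. \<exists>N. \<forall>k\<ge>N. \<forall>l\<ge>N. p (s k - s l) < e)"

definition completion_class ::
    "'v::ab_group_add set \<Rightarrow> ('v \<Rightarrow> real) \<Rightarrow> (nat \<Rightarrow> 'v) \<Rightarrow> (nat \<Rightarrow> 'v) set" where
  "completion_class V p s = {t. cauchy_seq V p t \<and> (\<lambda>k. p (t k - s k)) \<longlonglongrightarrow> 0}"

definition completion :: "'v::ab_group_add set \<Rightarrow> ('v \<Rightarrow> real) \<Rightarrow> (nat \<Rightarrow> 'v) set set" where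
  "completion V p = completion_class V p ` {s. cauchy_seq V p s}"

definition completion_norm :: "('v::ab_group_add \<Rightarrow> real) \<Rightarrow> (nat \<Rightarrow> 'v) set \<Rightarrow> real" where
  "completion_norm p X = (THE r. \<forall>s\<in>X. (\<lambda>k. p (s k)) \<longlonglongrightarrow> r)"

text \<open>The continuous extension to the completion of a \<open>p\<close>-bounded linear map \<open>f\<close> on \<open>V\<close>.\<close>

definition completion_map ::
    "'v::ab_group_add set \<Rightarrow> ('v \<Rightarrow> real) \<Rightarrow> ('v \<Rightarrow> 'v) \<Rightarrow> (nat \<Rightarrow> 'v) set \<Rightarrow> (nat \<Rightarrow> 'v) set" where
  "completion_map V p f X = (\<Union>s\<in>X. completion_class V p (f \<circ> s))"


section \<open>GNS representations of product states and the minimal norm\<close>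

text \<open>A product functional is only relevant on the \<open>n\<close>-fold product; its values elsewhere are
  left unspecified.\<close>

definition product_state ::
    "('a::unital_cstar_algebra \<Rightarrow> 'a) \<Rightarrow> nat \<Rightarrow> ('a tensor \<Rightarrow> complex) \<Rightarrow> bool" where
  "product_state \<theta> n \<phi> \<longleftrightarrow> cfunctional \<phi> \<and>
     (\<exists>\<omega>. (\<forall>i<n. even_state \<theta> (\<omega> i)) \<and>
        (\<forall>as. length as = n \<longrightarrow> \<phi> (tens as) = (\<Prod>i<n. \<omega> i (as ! i))))"

definition gns_seminorm ::
    "('a::unital_cstar_algebra \<Rightarrow> 'a) \<Rightarrow> ('a tensor \<Rightarrow> complex) \<Rightarrow> 'a tensor \<Rightarrow> real" where
  "gns_seminorm \<theta> \<phi> y = sqrt (Re (\<phi> (fermi_mult \<theta> (fermi_star \<theta> y) y)))"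

definition gns_space ::
    "('a::unital_cstar_algebra \<Rightarrow> 'a) \<Rightarrow> nat \<Rightarrow> ('a tensor \<Rightarrow> complex) \<Rightarrow> (nat \<Rightarrow> 'a tensor) set set"
  where "gns_space \<theta> n \<phi> = completion (nfold n) (gns_seminorm \<theta> \<phi>)"

definition gns_rep ::
    "('a::unital_cstar_algebra \<Rightarrow> 'a) \<Rightarrow> nat \<Rightarrow> ('a tensor \<Rightarrow> complex) \<Rightarrow> 'a tensor \<Rightarrow>
     (nat \<Rightarrow> 'a tensor) set \<Rightarrow> (nat \<Rightarrow> 'a tensor) set" where
  "gns_rep \<theta> n \<phi> x = completion_map (nfold n) (gns_seminorm \<theta> \<phi>) (fermi_mult \<theta> x)"

definition gns_opnorm ::
    "('a::unital_cstar_algebra \<Rightarrow> 'a) \<Rightarrow> nat \<Rightarrow> ('a tensor \<Rightarrow> complex) \<Rightarrow> 'a tensor \<Rightarrow> ennreal" where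
  "gns_opnorm \<theta> n \<phi> x =
     (SUP h\<in>{h \<in> gns_space \<theta> n \<phi>. completion_norm (gns_seminorm \<theta> \<phi>) h \<le> 1}.
        ennreal (completion_norm (gns_seminorm \<theta> \<phi>) (gns_rep \<theta> n \<phi> x h)))"

text \<open>The minimal norm on \<open>nfold n\<close>, and the norm of the inductive limit: for \<open>x\<close> in
  some \<open>nfold m\<close> the sequence \<open>min_norm \<theta> n x\<close> with \<open>n \<ge> m\<close> is the sequence of norms of the
  images of \<open>x\<close> under the connecting maps (for \<open>n < m\<close> the value is meaningless and does not
  matter).\<close>

definition min_norm ::
    "('a::unital_cstar_algebra \<Rightarrow> 'a) \<Rightarrow> nat \<Rightarrow> 'a tensor \<Rightarrow> real" where
  "min_norm \<theta> n x = enn2real (SUP \<phi>\<in>{\<phi>. product_state \<theta> n \<phi>}. gns_opnorm \<theta> n \<phi> x)"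

definition fermi_norm :: "('a::unital_cstar_algebra \<Rightarrow> 'a) \<Rightarrow> 'a tensor \<Rightarrow> real" where
  "fermi_norm \<theta> x = lim (\<lambda>n. min_norm \<theta> n x)"


section \<open>The infinite minimal Fermi tensor product and the action of the permutations\<close>

definition fermi_product ::
    "('a::unital_cstar_algebra \<Rightarrow> 'a) \<Rightarrow> (nat \<Rightarrow> 'a tensor) set set" where
  "fermi_product \<theta> = completion UNIV (fermi_norm \<theta>)"

definition fermi_embed ::
    "('a::unital_cstar_algebra \<Rightarrow> 'a) \<Rightarrow> 'a tensor \<Rightarrow> (nat \<Rightarrow> 'a tensor) set" where
  "fermi_embed \<theta> x = completion_class UNIV (fermi_norm \<theta>) (\<lambda>_. x)"

definition perm_action ::
    "('a::unital_cstar_algebra \<Rightarrow> 'a) \<Rightarrow> nat perm \<Rightarrow>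
     (nat \<Rightarrow> 'a tensor) set \<Rightarrow> (nat \<Rightarrow> 'a tensor) set" where
  "perm_action \<theta> \<sigma> = completion_map UNIV (fermi_norm \<theta>) (perm_alg \<theta> \<sigma>)"

end

theory Submission
  imports Defs "HOL-Analysis.Generalised_Binomial_Theorem"
begin

text \<open>
  Let \<open>y\<close> lie in the \<open>n\<close>-fold product and be close to the fixed point \<open>x\<close>. Exchanging the slots
  \<open>0, \<dots>, M - 1\<close> with \<open>M, \<dots>, 2 M - 1\<close> for \<open>M \<ge> n\<close> fixes \<open>x\<close>, so \<open>y\<close> is close to its image \<open>y'\<close>,
  which lives in the second block. In a product state with the same even state \<open>\<omega>\<close> in all slots of
  the second block, \<open>y'\<close> acts on the first block as the scalar \<open>c = (\<omega> \<times> \<omega> \<times> \<dots>)(y)\<close>. As the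
  minimal norm is a supremum over product states, the distance from \<open>y\<close> to \<open>c 1\<close> is at most that
  from \<open>y\<close> to \<open>y'\<close>. Hence \<open>x\<close> is a limit of scalars. If there is no even state, all seminorms vanish
  and the completion is a point.

  For even product states the signs of the Fermi product cancel in the GNS form: on elementary
  tensors it is \<open>\<Prod>\<^sub>i \<omega>\<^sub>i(a\<^sub>i\<^sup>* b\<^sub>i)\<close>, positive by Schur's product theorem.
\<close>

text \<open>Two points shape the estimate. The index \<open>M\<close> has to be chosen after the
  vector on which \<open>y\<close> acts: that vector may reach arbitrarily far, and the second block
  is free to carry \<open>\<omega>\<close> only if the vector lies in the first. So one bound on the
  distance from \<open>y\<close> to its image must serve all large \<open>M\<close> at once.
  Moreover \<open>y'\<close> acts as \<open>c\<close> only after projection to the first block, so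
  \<open>y - c 1\<close> is compared with \<open>y - y'\<close> through inner products against
  vectors of that block. Any product state may be altered to \<open>\<omega>\<close> beyond the
  first block, since vectors of the first block do not see the change.

  Product, involution and permutation action are definite descriptions, and the norm is a limit of
  suprema over completions. The former are realised by explicit operators, with left multiplication
  in a single slot as building block. The latter is reduced to inequalities between finite tensors,
  which requires left multiplication to be bounded uniformly in the states. That bound comes from
  writing \<open>r^2 - a^* a\<close> as \<open>s^* s\<close> by means of the binomial
  series.\<close>

instantiation complex :: complex_vector
begin
definition scaleC_complex :: "complex \<Rightarrow> complex \<Rightarrow> complex" where
  "scaleC_complex = (*)"
instance by standard (auto simp: scaleC_complex_def algebra_simps)
end

section \<open>Linear maps and functionals over the complex numbers\<close>

lemma vector_space_scaleC: "vector_space (scaleC :: complex \<Rightarrow> 'a \<Rightarrow> 'a::complex_vector)"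
  by (fact complex_vector.vector_space_axioms)

lemma vector_space_cnj_scaleC:
  "vector_space (\<lambda>c x. cnj c *\<^sub>C (x :: 'a::complex_vector))"
  by unfold_locales (simp_all add: scaleC_add_right scaleC_add_left scaleC_scaleC scaleC_one)

lemma linear_scaleC_iff:
  assumes "vector_space s"
  shows "Vector_Spaces.linear (scaleC :: complex \<Rightarrow> 'a \<Rightarrow> 'a::complex_vector) s f \<longleftrightarrow>
    (\<forall>x y. f (x + y) = f x + f y) \<and> (\<forall>c x. f (c *\<^sub>C x) = s c (f x))"
  using assms vector_space_scaleC[where 'a = 'a]
  unfolding Vector_Spaces.linear_def module_hom_def module_hom_axioms_def
      vector_space_def module_def by (intro iffI conjI) (elim conjE, assumption)+

lemma clinear_iff:
  "clinear f \<longleftrightarrow> (\<forall>x y. f (x + y) = f x + f y) \<and> (\<forall>c x. f (c *\<^sub>C x) = c *\<^sub>C f x)"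
  by (rule linear_scaleC_iff[OF vector_space_scaleC])

lemma cfunctional_iff:
  "cfunctional f \<longleftrightarrow> (\<forall>x y. f (x + y) = f x + f y) \<and> (\<forall>c x. f (c *\<^sub>C x) = c * f x)"
  using clinear_iff[of f] by (simp add: scaleC_complex_def)

lemma clinear_add: "clinear f \<Longrightarrow> f (x + y) = f x + f y"
  and clinear_scale: "clinear f \<Longrightarrow> f (c *\<^sub>C x) = c *\<^sub>C f x"
  by (simp_all add: clinear_iff)

lemma scaleC_zero_left [simp]: "0 *\<^sub>C (x::'a::complex_vector) = 0"
  and scaleC_zero_right [simp]: "c *\<^sub>C (0::'a::complex_vector) = 0"
  and scaleC_one_left [simp]: "1 *\<^sub>C (x::'a::complex_vector) = x"
  and scaleC_minus_left: "(- c) *\<^sub>C (x::'a::complex_vector) = - (c *\<^sub>C x)"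
  and scaleC_minus_right: "c *\<^sub>C (- (x::'a::complex_vector)) = - (c *\<^sub>C x)"
  by (auto simp: scaleC_one)

lemma clinear_zero: "clinear f \<Longrightarrow> f 0 = 0"
  using clinear_scale[of f 0 0] by simp

lemma clinear_minus: "clinear f \<Longrightarrow> f (- x) = - f x"
  using clinear_scale[of f "-1" x] by (simp add: scaleC_minus_left)

lemma clinear_diff: "clinear f \<Longrightarrow> f (x - y) = f x - f y"
  by (metis clinear_add clinear_minus add_uminus_conv_diff)

lemma clinear_compose: "clinear f \<Longrightarrow> clinear g \<Longrightarrow> clinear (\<lambda>x. f (g x))"
  by (simp add: clinear_iff)

lemma clinear_id: "clinear (\<lambda>x. x)"
  by (simp add: clinear_iff)

lemma clinear_sum: "clinear f \<Longrightarrow> f (sum g I) = (\<Sum>i\<in>I. f (g i))"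
  by (induction I rule: infinite_finite_induct) (auto simp: clinear_zero clinear_add)

section \<open>Elementary tensors and linear extension\<close>

text \<open>Sequences that are eventually \<open>1\<close> replace lists: padding by units leaves
  them unchanged, so tensors of different lengths can be compared slot by slot.\<close>

definition fin :: "(nat \<Rightarrow> 'a::one) \<Rightarrow> bool" where
  "fin g \<longleftrightarrow> (\<exists>n. \<forall>i\<ge>n. g i = 1)"

text \<open>\<open>tf g\<close> stands for \<open>g 0 \<otimes> g 1 \<otimes> \<dots>\<close>; without \<open>fin g\<close> its value is arbitrary.\<close>

definition tf :: "(nat \<Rightarrow> 'a::unital_cstar_algebra) \<Rightarrow> 'a tensor" where
  "tf g = tens (map g [0..<(LEAST n. \<forall>i\<ge>n. g i = 1)])"

lemma fin_const [simp]: "fin (\<lambda>_. 1)"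
  by (simp add: fin_def)

lemma fin_upd [simp]: "fin (g(i := a)) \<longleftrightarrow> fin g"
proof -
  have "fin (h(i := a))" if h: "fin h" for h :: "nat \<Rightarrow> 'a" and i a
  proof -
    obtain n where "\<forall>i\<ge>n. h i = 1" using h by (auto simp: fin_def)
    then have "\<forall>j\<ge>max n (Suc i). (h(i := a)) j = 1" by auto
    then show ?thesis unfolding fin_def by blast
  qed
  from this[of g] this[of "g(i := a)" i "g i"] show ?thesis by auto
qed

lemma fin_map:
  assumes "fin g" "\<exists>n. \<forall>i\<ge>n. u i 1 = 1"
  shows "fin (\<lambda>i. u i (g i))"
proof -
  obtain n m where "\<forall>i\<ge>n. g i = 1" "\<forall>i\<ge>m. u i 1 = 1" using assms by (auto simp: fin_def)
  then have "\<forall>i\<ge>max n m. u i (g i) = 1" by auto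
  then show ?thesis unfolding fin_def by blast
qed

lemma fin_comp:
  assumes "fin g" "\<exists>n. \<forall>i\<ge>n. \<sigma> i = i"
  shows "fin (\<lambda>i. g (\<sigma> i))"
proof -
  obtain n m where "\<forall>i\<ge>n. g i = 1" "\<forall>i\<ge>m. \<sigma> i = i" using assms by (auto simp: fin_def)
  then have "\<forall>i\<ge>max n m. g (\<sigma> i) = 1" by auto
  then show ?thesis unfolding fin_def by blast
qed

lemma fin_mult:
  fixes g h :: "nat \<Rightarrow> 'a::monoid_mult"
  assumes "fin g" "fin h"
  shows "fin (\<lambda>i. g i * h i)"
proof -
  obtain n m where "\<forall>i\<ge>n. g i = 1" "\<forall>i\<ge>m. h i = 1" using assms by (auto simp: fin_def)
  then have "\<forall>i\<ge>max n m. g i * h i = 1" by auto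
  then show ?thesis unfolding fin_def by blast
qed

lemma fin_common:
  assumes "fin g" "fin h"
  obtains n where "\<And>i. i \<ge> n \<Longrightarrow> g i = 1" "\<And>i. i \<ge> n \<Longrightarrow> h i = 1"
proof -
  obtain n m where "\<forall>i\<ge>n. g i = 1" "\<forall>i\<ge>m. h i = 1" using assms by (auto simp: fin_def)
  then show ?thesis by (intro that[of "max n m"]) auto
qed

lemma tens_snoc_one: "tens (xs @ [1]) = tens xs"
  by transfer (rule tensor_null.unit)

lemma tens_pad: "tens (xs @ replicate k 1) = tens xs"
proof (induction k)
  case (Suc k)
  have "tens (xs @ replicate (Suc k) 1) = tens ((xs @ replicate k 1) @ [1])"
    by (simp add: replicate_append_same)
  then show ?case using Suc by (simp only: tens_snoc_one)
qed simp

lemma tf_eq_tens: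
  assumes "\<And>i. i \<ge> n \<Longrightarrow> g i = 1"
  shows "tf g = tens (map g [0..<n])"
proof -
  define m where "m = (LEAST n. \<forall>i\<ge>n. g i = 1)"
  have m: "\<forall>i\<ge>m. g i = 1" unfolding m_def by (rule LeastI[of _ n]) (use assms in auto)
  have mn: "m \<le> n" unfolding m_def by (rule Least_le) (use assms in auto)
  have "map g [m..<n] = replicate (n - m) 1"
    by (intro nth_equalityI) (use m in auto)
  moreover have "[0..<n] = [0..<m] @ [m..<n]"
    using mn upt_add_eq_append[of 0 m "n - m"] by simp
  ultimately have "tens (map g [0..<n]) = tens (map g [0..<m])"
    by (simp add: tens_pad)
  then show ?thesis by (simp add: tf_def m_def)
qed

lemma fin_nth_default [simp]: "fin (nth_default 1 xs)"
  unfolding fin_def by (intro exI[of _ "length xs"]) (simp add: nth_default_def)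

lemma tens_eq_tf: "tens xs = tf (nth_default 1 xs)"
proof -
  have "map (nth_default 1 xs) [0..<length xs] = xs"
    by (intro nth_equalityI) (auto simp: nth_default_def)
  then show ?thesis
    by (subst tf_eq_tens[of "length xs"]) (auto simp: nth_default_def)
qed

lemma tunit_eq_tf: "tunit = tf (\<lambda>_. 1)"
  unfolding tunit_def tens_eq_tf by (rule arg_cong[of _ _ tf]) (auto simp: nth_default_def nth_Cons')

lemma emb_eq_tf: "emb j a = tf ((\<lambda>_. 1)(j := a))"
  unfolding emb_def tens_eq_tf
  by (rule arg_cong[of _ _ tf]) (auto simp: nth_default_def nth_append fun_eq_iff)

definition multilin ::
    "(complex \<Rightarrow> 'v \<Rightarrow> 'v) \<Rightarrow> ((nat \<Rightarrow> 'a::unital_cstar_algebra) \<Rightarrow> 'v::ab_group_add) \<Rightarrow> bool" where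
  "multilin s G \<longleftrightarrow>
     (\<forall>g i a b. fin g \<longrightarrow> G (g(i := a + b)) = G (g(i := a)) + G (g(i := b))) \<and>
     (\<forall>g i c a. fin g \<longrightarrow> G (g(i := c *\<^sub>C a)) = s c (G (g(i := a))))"

lemma multilinI:
  assumes "\<And>g i a b. fin g \<Longrightarrow> G (g(i := a + b)) = G (g(i := a)) + G (g(i := b))"
    and "\<And>g i c a. fin g \<Longrightarrow> G (g(i := c *\<^sub>C a)) = s c (G (g(i := a)))"
  shows "multilin s G"
  using assms by (auto simp: multilin_def)

lemma multilin_add:
  "multilin s G \<Longrightarrow> fin g \<Longrightarrow> G (g(i := a + b)) = G (g(i := a)) + G (g(i := b))"
  by (auto simp: multilin_def)

lemma multilin_scale:
  "multilin s G \<Longrightarrow> fin g \<Longrightarrow> G (g(i := c *\<^sub>C a)) = s c (G (g(i := a)))"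
  by (auto simp: multilin_def)

text \<open>The extension of \<open>F\<close> from the basis to the free vector space, before any
  relation is divided out.\<close>

definition fext :: "(complex \<Rightarrow> 'v \<Rightarrow> 'v) \<Rightarrow> ('b \<Rightarrow> 'v::ab_group_add) \<Rightarrow> ('b \<Rightarrow>\<^sub>0 complex) \<Rightarrow> 'v" where
  "fext s F p = (\<Sum>k\<in>Poly_Mapping.keys p. s (Poly_Mapping.lookup p k) (F k))"

context
  fixes s :: "complex \<Rightarrow> 'v \<Rightarrow> 'v::ab_group_add"
  assumes s: "vector_space s"
begin

interpretation vector_space s by (fact s)

lemma fext_superset:
  assumes "finite I" "Poly_Mapping.keys p \<subseteq> I"
  shows "fext s F p = (\<Sum>k\<in>I. s (Poly_Mapping.lookup p k) (F k))"
  unfolding fext_def by (rule sum.mono_neutral_left) (use assms in \<open>auto simp: in_keys_iff\<close>)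

lemma fext_add: "fext s F (p + q) = fext s F p + fext s F q"
proof -
  let ?I = "Poly_Mapping.keys p \<union> Poly_Mapping.keys q"
  have "finite ?I" by simp
  moreover have "Poly_Mapping.keys (p + q) \<subseteq> ?I" by (rule Poly_Mapping.keys_add)
  ultimately show ?thesis
    by (simp add: fext_superset[of ?I] lookup_add scale_left_distrib sum.distrib)
qed

lemma fext_fscale: "fext s F (fscale c p) = s c (fext s F p)"
proof -
  have "Poly_Mapping.keys (fscale c p) \<subseteq> Poly_Mapping.keys p"
    by (auto simp: in_keys_iff)
  then show ?thesis
    by (simp add: fext_superset[of "Poly_Mapping.keys p"] scale_sum_right)
qed

lemma fext_zero: "fext s F 0 = 0"
  by (simp add: fext_def)

lemma fext_diff: "fext s F (p - q) = fext s F p - fext s F q"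
  using fext_add[of F "p - q" q] by simp

lemma fext_single: "fext s F (Poly_Mapping.single k 1) = F k"
  by (simp add: fext_def)

text \<open>Multilinearity of \<open>G\<close> handles the slot relations. The unit relation holds
  by construction, since \<open>xs\<close> and \<open>xs @ [1]\<close> give the same sequence
  \<open>nth_default 1\<close>. Hence the extension descends to the quotient.\<close>

lemma fext_tensor_null:
  assumes G: "multilin s G" and "p \<in> tensor_null"
  shows "fext s (\<lambda>xs. G (nth_default 1 xs)) p = 0"
  using assms(2)
proof induction
  case (slot_add i xs a b)
  have "nth_default 1 (xs[i := c]) = (nth_default 1 xs)(i := c)" for c
    using slot_add by (auto simp: nth_default_def fun_eq_iff)
  then show ?case
    by (simp add: fext_diff fext_single multilin_add[OF G])
next
  case (slot_scale i xs c a)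
  have "nth_default 1 (xs[i := c]) = (nth_default 1 xs)(i := c)" for c
    using slot_scale by (auto simp: nth_default_def fun_eq_iff)
  then show ?case
    by (simp add: fext_diff fext_single fext_fscale multilin_scale[OF G])
next
  case (unit xs)
  have "nth_default 1 (xs @ [1]) = nth_default 1 xs"
    by (auto simp: nth_default_def nth_append fun_eq_iff)
  then show ?case by (simp add: fext_diff fext_single)
qed (simp_all add: fext_zero fext_add fext_fscale)

end

lemma tensor_exhaust: obtains p where "x = abs_tensor p"
  using Quotient_abs_rep[OF Quotient_tensor] by metis

text \<open>The scalar multiplication \<open>s\<close> of the target is \<open>scaleC\<close> for linear extensions and
  \<open>\<lambda>c x. cnj c *\<^sub>C x\<close> for antilinear ones.\<close>

definition tlift ::
    "(complex \<Rightarrow> 'v \<Rightarrow> 'v) \<Rightarrow> ((nat \<Rightarrow> 'a::unital_cstar_algebra) \<Rightarrow> 'v::ab_group_add) \<Rightarrow>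
     'a tensor \<Rightarrow> 'v" where
  "tlift s G x = fext s (\<lambda>xs. G (nth_default 1 xs)) (rep_tensor x)"

lemma tlift_abs:
  assumes s: "vector_space s" and G: "multilin s G"
  shows "tlift s G (abs_tensor p) = fext s (\<lambda>xs. G (nth_default 1 xs)) p"
proof -
  have "rep_tensor (abs_tensor p) - p \<in> tensor_null"
    using Quotient_rep_abs[OF Quotient_tensor] tensor_null.zero by fastforce
  then have "fext s (\<lambda>xs. G (nth_default 1 xs)) (rep_tensor (abs_tensor p) - p) = 0"
    by (rule fext_tensor_null[OF s G])
  then show ?thesis by (simp add: tlift_def fext_diff[OF s])
qed

lemma tlift_tf:
  assumes s: "vector_space s" and G: "multilin s G" and "fin g"
  shows "tlift s G (tf g) = G g"
proof -
  obtain n where n: "\<forall>i\<ge>n. g i = 1" using assms by (auto simp: fin_def)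
  have "tf g = abs_tensor (Poly_Mapping.single (map g [0..<n]) 1)"
    using n by (simp add: tf_eq_tens[of n] tens.abs_eq)
  moreover have "nth_default 1 (map g [0..<n]) = g"
    using n by (auto simp: nth_default_def fun_eq_iff)
  ultimately show ?thesis
    by (simp add: tlift_abs[OF s G] fext_single[OF s])
qed

lemma tlift_linear:
  assumes s: "vector_space s" and G: "multilin s G"
  shows "Vector_Spaces.linear (*\<^sub>C) s (tlift s G)"
proof -
  have "tlift s G (x + y) = tlift s G x + tlift s G y" for x y
  proof -
    obtain p q where "x = abs_tensor p" "y = abs_tensor q"
      using tensor_exhaust by metis
    then show ?thesis
      by (simp add: plus_tensor.abs_eq tlift_abs[OF s G] fext_add[OF s])
  qed
  moreover have "tlift s G (c *\<^sub>C x) = s c (tlift s G x)" for c x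
  proof -
    obtain p where "x = abs_tensor p" by (rule tensor_exhaust)
    then show ?thesis
      by (simp add: scaleC_tensor.abs_eq tlift_abs[OF s G] fext_fscale[OF s])
  qed
  ultimately show ?thesis by (simp add: linear_scaleC_iff[OF s])
qed

lemma multilin_tf: "multilin (*\<^sub>C) tf"
proof (rule multilinI)
  fix g :: "nat \<Rightarrow> 'a" and i a b c assume "fin g"
  then obtain n where n: "\<forall>i\<ge>n. g i = 1" by (auto simp: fin_def)
  \<comment> \<open>\<open>N\<close> must exceed \<open>i\<close> as well as \<open>n\<close>: the
    slot relations only concern positions inside the list.\<close>
  define N where "N = max n (Suc i)"
  have *: "tf (g(i := a)) = tens ((map g [0..<N])[i := a])" for a
  proof -
    have "tf (g(i := a)) = tens (map (g(i := a)) [0..<N])"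
      by (rule tf_eq_tens) (use n N_def in auto)
    also have "map (g(i := a)) [0..<N] = (map g [0..<N])[i := a]"
      by (intro nth_equalityI) (auto simp: nth_list_update)
    finally show ?thesis .
  qed
  have len: "i < length (map g [0..<N])" by (simp add: N_def)
  let ?S = "\<lambda>a. Poly_Mapping.single ((map g [0..<N])[i := a]) (1::complex)"
  have "?S (a + b) - (?S a + ?S b) \<in> tensor_null"
    using tensor_null.slot_add[OF len, of a b] by (simp only: diff_diff_eq)
  then show "tf (g(i := a + b)) = tf (g(i := a)) + tf (g(i := b))"
    unfolding * by (simp add: tens.abs_eq plus_tensor.abs_eq tensor.abs_eq_iff)
  show "tf (g(i := c *\<^sub>C a)) = c *\<^sub>C tf (g(i := a))"
    unfolding * using tensor_null.slot_scale[OF len, of c a]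
    by (simp add: tens.abs_eq scaleC_tensor.abs_eq tensor.abs_eq_iff)
qed

lemma tensor_induct [consumes 0, case_names tf add scale]:
  assumes tf: "\<And>g. fin g \<Longrightarrow> P (tf g)"
    and add: "\<And>x y. P x \<Longrightarrow> P y \<Longrightarrow> P (x + y)"
    and scale: "\<And>c x. P x \<Longrightarrow> P (c *\<^sub>C x)"
  shows "P x"
proof -
  have P0: "P 0" using scale[OF tf[OF fin_const], of 0] by simp
  obtain p where x: "x = abs_tensor p" by (rule tensor_exhaust)
  have "P (abs_tensor p)"
  proof (induction p rule: Poly_Mapping.update_induct)
    case const
    then show ?case using P0 by (simp add: zero_tensor.abs_eq)
  next
    case (update p k v)
    have "Poly_Mapping.update k v p = p + fscale v (Poly_Mapping.single k 1)"
      by (rule poly_mapping_eqI)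
        (use update in \<open>auto simp: lookup_single when_def lookup_add Poly_Mapping.lookup_update in_keys_iff\<close>)
    then have "abs_tensor (Poly_Mapping.update k v p) = abs_tensor p + v *\<^sub>C tens k"
      by (simp add: plus_tensor.abs_eq scaleC_tensor.abs_eq tens.abs_eq)
    then show ?case using add[OF update(3) scale[OF tf]] by (simp add: tens_eq_tf)
  qed
  then show ?thesis by (simp add: x)
qed

section \<open>C*-algebraic preliminaries\<close>

lemma star_zero [simp]: "star (0 :: 'a::unital_cstar_algebra) = 0"
  using star_add[of 0 "0::'a"] by simp

lemma star_one [simp]: "star (1 :: 'a::unital_cstar_algebra) = 1"
  by (metis star_star star_mult mult_1_right mult_1_left)

lemma star_minus: "star (- a) = - star (a :: 'a::unital_cstar_algebra)"
  using star_add[of a "- a"] by (simp add: eq_neg_iff_add_eq_0 add.commute)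

lemma norm_star [simp]: "norm (star a) = norm (a :: 'a::unital_cstar_algebra)"
proof -
  have *: "norm b \<le> norm (star b)" for b :: 'a
  proof (cases "b = 0")
    case False
    have "norm b * norm b = norm (star b * b)"
      by (simp add: cstar_identity power2_eq_square)
    also have "\<dots> \<le> norm (star b) * norm b" by (rule norm_mult_ineq)
    finally show ?thesis using False by simp
  qed simp
  from *[of a] *[of "star a"] show ?thesis by (simp add: star_star)
qed

lemma star_scaleR: "star (r *\<^sub>R a) = r *\<^sub>R star (a :: 'a::unital_cstar_algebra)"
  by (simp add: scaleR_scaleC star_scaleC)

lemma bounded_linear_star: "bounded_linear (star :: 'a::unital_cstar_algebra \<Rightarrow> 'a)"
  by (rule bounded_linear_intro[where K = 1]) (simp_all add: star_add star_scaleR)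

lemma star_power: "star (a ^ n) = star (a :: 'a::unital_cstar_algebra) ^ n"
  by (induction n) (simp_all add: star_mult power_commutes)

text \<open>The binomial series of the square root converges absolutely below radius 1. By
  Vandermonde, the coefficients of its Cauchy square are \<open>(1 gchoose k) * (- 1) ^ k\<close>,
  which vanish for \<open>k \<ge> 2\<close>. This takes the place of functional calculus.\<close>

lemma cstar_sqrt_one_minus:
  fixes h :: "'a::unital_cstar_algebra"
  assumes "norm h < 1" "star h = h"
  obtains s where "star s = s" "s * s = 1 - h"
proof -
  define c :: "nat \<Rightarrow> real" where "c n = ((1/2) gchoose n) * (- 1) ^ n" for n
  define t where "t n = c n *\<^sub>R h ^ n" for n
  \<comment> \<open>Convergence at a radius strictly beyond \<open>norm h\<close> gives absolute
    convergence at \<open>norm h\<close>.\<close>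
  obtain r where r: "norm h < r" "r < 1" using dense[OF assms(1)] by blast
  have "0 \<le> norm h" by simp
  then have "0 < r" using r by linarith
  have "summable (\<lambda>n. ((1/2) gchoose n) * r ^ n)"
    using gen_binomial_real[of r "1/2"] \<open>0 < r\<close> r by (auto simp: sums_iff)
  then have "summable (\<lambda>n. norm (((1/2) gchoose n) * norm h ^ n))"
    by (rule powser_insidea) (use r in auto)
  then have sum_t: "summable (\<lambda>n. norm (t n))"
  proof (rule summable_comparison_test'[where N = 0])
    fix n show "norm (norm (t n)) \<le> norm (((1/2) gchoose n) * norm h ^ n)"
      by (auto simp: t_def c_def abs_mult power_abs intro!: mult_left_mono norm_power_ineq)
  qed
  have conv: "(\<Sum>i\<le>k. t i * t (k - i)) = (if k = 0 then 1 else if k = 1 then - h else 0)" for k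
  proof -
    have "(\<Sum>i\<le>k. t i * t (k - i)) = (\<Sum>i\<le>k. (c i * c (k - i)) *\<^sub>R h ^ k)"
      by (rule sum.cong) (auto simp: t_def power_add[symmetric])
    also have "\<dots> = (\<Sum>i\<le>k. c i * c (k - i)) *\<^sub>R h ^ k"
      by (simp add: scaleR_sum_left)
    also have "(\<Sum>i\<le>k. c i * c (k - i)) = (\<Sum>i\<le>k. ((1/2) gchoose i) * ((1/2) gchoose (k - i)) * (- 1) ^ k)"
      by (rule sum.cong) (auto simp: c_def power_add[symmetric] simp flip: power_add)
    also have "\<dots> = (1 gchoose k) * (- 1) ^ k"
      using gbinomial_Vandermonde[of "1/2 :: real" "1/2" k]
      by (simp add: sum_distrib_right[symmetric] atLeast0AtMost)
    also have "(1 gchoose k :: real) = real (1 choose k)"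
      by (simp add: binomial_gbinomial)
    finally show ?thesis by (cases k rule: nat.exhaust) (auto simp: numeral_2_eq_2 binomial_eq_0)
  qed
  have "(\<lambda>k. \<Sum>i\<le>k. t i * t (k - i)) sums (suminf t * suminf t)"
    by (rule Cauchy_product_sums[OF sum_t sum_t])
  moreover have "(\<lambda>k. \<Sum>i\<le>k. t i * t (k - i)) sums (\<Sum>k\<in>{0,1}. \<Sum>i\<le>k. t i * t (k - i))"
    by (rule sums_finite) (auto simp: conv)
  ultimately have "suminf t * suminf t = (\<Sum>k\<in>{0,1}. \<Sum>i\<le>k. t i * t (k - i))"
    by (rule sums_unique2)
  then have "suminf t * suminf t = 1 - h" unfolding conv by simp
  moreover have "star (suminf t) = suminf t"
  proof -
    have "star (suminf t) = suminf (\<lambda>n. star (t n))"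
      by (rule bounded_linear.suminf[OF bounded_linear_star])
        (use sum_t summable_norm_cancel in blast)
    also have "(\<lambda>n. star (t n)) = t"
      by (auto simp: t_def star_scaleR star_power assms(2))
    finally show ?thesis by simp
  qed
  ultimately show ?thesis using that by blast
qed

text \<open>Rescaling \<open>a\<close> by \<open>1 / r\<close> brings \<open>star a * a\<close> into
  the range of the square root. Applied inside a positive functional, the identity bounds left
  multiplication by \<open>a\<close> with constant \<open>r\<close>, whatever the
  functional.\<close>

lemma cstar_complement:
  fixes a :: "'a::unital_cstar_algebra"
  assumes "norm a < r"
  obtains s where "star a * a + star s * s = complex_of_real (r\<^sup>2) *\<^sub>C 1"
proof -
  have "0 \<le> norm a" by simp
  then have r: "0 < r" using assms by linarith
  define h where "h = (1 / r\<^sup>2) *\<^sub>R (star a * a)"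
  have "(norm a)\<^sup>2 < r\<^sup>2" using assms by (simp add: power_strict_mono)
  then have "norm h < 1" using r by (simp add: h_def cstar_identity)
  moreover have "star h = h" by (simp add: h_def star_scaleR star_mult star_star)
  ultimately obtain s where s: "star s = s" "s * s = 1 - h" by (rule cstar_sqrt_one_minus)
  have "star (r *\<^sub>R s) * (r *\<^sub>R s) = r\<^sup>2 *\<^sub>R (1 - h)"
    by (simp add: star_scaleR s power2_eq_square)
  also have "\<dots> = r\<^sup>2 *\<^sub>R 1 - star a * a"
    using r by (simp add: h_def scaleR_diff_right)
  finally have "star a * a + star (r *\<^sub>R s) * (r *\<^sub>R s) = complex_of_real (r\<^sup>2) *\<^sub>C 1"
    by (simp add: scaleR_scaleC)
  then show ?thesis by (rule that)
qed

section \<open>Positive sesquilinear forms\<close>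

locale semi_inner =
  fixes B :: "'v::complex_vector \<Rightarrow> 'v \<Rightarrow> complex"
  assumes add_right: "B x (y + z) = B x y + B x z"
    and scale_right: "B x (c *\<^sub>C y) = c * B x y"
    and add_left: "B (x + y) z = B x z + B y z"
    and scale_left: "B (c *\<^sub>C x) y = cnj c * B x y"
    and nonneg: "B x x \<in> \<real>\<^sub>\<ge>\<^sub>0"
begin

lemma zero_right [simp]: "B x 0 = 0" using scale_right[of x 0 0] by simp
lemma zero_left [simp]: "B 0 x = 0" using scale_left[of 0 0 x] by simp
lemma minus_right: "B x (- y) = - B x y"
  using scale_right[of x "-1" y] by (simp add: scaleC_minus_left)
lemma minus_left: "B (- x) y = - B x y"
  using scale_left[of "-1" x y] by (simp add: scaleC_minus_left)
lemma diff_right: "B x (y - z) = B x y - B x z"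
  using add_right[of x y "- z"] by (simp add: minus_right)
lemma diff_left: "B (x - y) z = B x z - B y z"
  using add_left[of x "- y" z] by (simp add: minus_left)

lemma Im_self [simp]: "Im (B x x) = 0" and Re_self: "0 \<le> Re (B x x)"
  using nonneg[of x] by (auto simp: complex_nonneg_Reals_iff)

text \<open>Polarization: reality of the form at \<open>x + y\<close> yields the imaginary parts, at
  \<open>x + \<i> *\<^sub>C y\<close> the real parts.\<close>

lemma hermitian: "B y x = cnj (B x y)"
proof (rule complex_eqI)
  have "Im (B (x + y) (x + y)) = 0" by simp
  then show "Im (B y x) = Im (cnj (B x y))" by (simp add: add_left add_right del: Im_self) simp
  have "Im (B (x + \<i> *\<^sub>C y) (x + \<i> *\<^sub>C y)) = 0" by simp
  then show "Re (B y x) = Re (cnj (B x y))"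
    by (simp add: add_left add_right scale_left scale_right del: Im_self) simp
qed

definition nrm :: "'v \<Rightarrow> real" where "nrm x = sqrt (Re (B x x))"

lemma nrm_nonneg [simp]: "0 \<le> nrm x" by (simp add: nrm_def Re_self)

lemma nrm_square: "(nrm x)\<^sup>2 = Re (B x x)" by (simp add: nrm_def Re_self)

lemma B_self: "B x x = complex_of_real ((nrm x)\<^sup>2)"
  by (rule complex_eqI) (simp_all add: nrm_square del: of_real_power)

lemma cauchy_schwarz: "cmod (B x y) \<le> nrm x * nrm y"
proof -
  define m where "m = (cmod (B y x))\<^sup>2"
  define a where "a = Re (B x x)"
  define b where "b = Re (B y y)"
  have ab: "0 \<le> a" "0 \<le> b" by (auto simp: a_def b_def Re_self)
  have nn: "B y x * B x y = complex_of_real m" "cnj (B y x) * B y x = complex_of_real m"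
    unfolding m_def complex_norm_square by (simp_all add: hermitian[of x y] mult.commute)
  \<comment> \<open>With the coefficient \<open>s * B y x\<close> the cross terms become real, which
    leaves a quadratic polynomial in the real variable \<open>s\<close>.\<close>
  have quad: "0 \<le> a - 2 * s * m + s\<^sup>2 * m * b" for s :: real
  proof -
    define t where "t = complex_of_real s * B y x"
    have "B (x - t *\<^sub>C y) (x - t *\<^sub>C y) = B x x - t * B x y - cnj t * B y x + cnj t * t * B y y"
      by (simp add: diff_left diff_right scale_left scale_right algebra_simps)
    also have "t * B x y = of_real (s * m)"
      by (simp add: t_def nn mult.assoc)
    also have "cnj t * B y x = of_real (s * m)"
      by (simp add: t_def nn mult.assoc)
    also have "cnj t * t = of_real (s\<^sup>2 * m)"
    proof -
      have "cnj t * t = complex_of_real s * complex_of_real s * (cnj (B y x) * B y x)"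
        by (simp add: t_def mult_ac)
      then show ?thesis by (simp only: nn) (simp add: power2_eq_square)
    qed
    finally have "Re (B (x - t *\<^sub>C y) (x - t *\<^sub>C y)) = a - 2 * s * m + s\<^sup>2 * m * b"
      by (simp add: a_def b_def del: of_real_mult)
    then show ?thesis using Re_self by metis
  qed
  have "m \<le> a * b"
  proof (cases "m = 0")
    case True
    then show ?thesis using ab by simp
  next
    case False
    then have m: "0 < m" by (simp add: m_def)
    show ?thesis
    proof (cases "b = 0")
      case True
      \<comment> \<open>Without a quadratic term a large \<open>s\<close> makes the right side
        negative; this value gives exactly \<open>- a - 2\<close>. For \<open>b > 0\<close> the
        minimiser \<open>1 / b\<close> is used instead.\<close>
      have "0 \<le> a - 2 * ((a + 1) / m) * m" using quad[of "(a + 1) / m"] True by simp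
      also have "\<dots> = - a - 2" using m by simp
      finally show ?thesis using ab by simp
    next
      case False
      then have b: "0 < b" using ab by simp
      have "0 \<le> a - 2 * (1 / b) * m + (1 / b)\<^sup>2 * m * b" by (rule quad)
      also have "\<dots> = a - m / b" using b by (simp add: field_simps power2_eq_square)
      finally show ?thesis using b by (simp add: field_simps)
    qed
  qed
  then have "(cmod (B x y))\<^sup>2 \<le> (nrm x * nrm y)\<^sup>2"
    unfolding m_def a_def b_def power_mult_distrib nrm_square by (subst hermitian) simp
  then show ?thesis by (rule power2_le_imp_le) simp
qed

lemma nrm_triangle: "nrm (x + y) \<le> nrm x + nrm y"
proof -
  have "Re (B x y) \<le> nrm x * nrm y"
    using cauchy_schwarz[of x y] complex_Re_le_cmod[of "B x y"] by linarith
  moreover have "Re (B y x) = Re (B x y)" by (subst hermitian) simp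
  ultimately have "(nrm (x + y))\<^sup>2 \<le> (nrm x + nrm y)\<^sup>2"
    unfolding nrm_square by (simp add: add_left add_right power2_sum nrm_square)
  then show ?thesis by (rule power2_le_imp_le) simp
qed

lemma nrm_scale: "nrm (c *\<^sub>C x) = cmod c * nrm x"
proof -
  have "(nrm (c *\<^sub>C x))\<^sup>2 = (cmod c * nrm x)\<^sup>2"
    unfolding power_mult_distrib nrm_square
    by (simp add: scale_left scale_right cmod_power2) (simp add: power2_eq_square algebra_simps)
  then show ?thesis by (simp add: power2_eq_iff_nonneg)
qed

lemma nrm_zero [simp]: "nrm 0 = 0" by (simp add: nrm_def)
lemma nrm_minus: "nrm (- x) = nrm x" by (simp add: nrm_def minus_left minus_right)

text \<open>Take \<open>w = v\<close>. Testing only against \<open>W\<close> matters later, where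
  the inner products are known for vectors of one block only.\<close>

lemma nrm_le_if_dual:
  assumes "\<And>w. w \<in> W \<Longrightarrow> cmod (B w v) \<le> C * nrm w" "v \<in> W" "0 \<le> C"
  shows "nrm v \<le> C"
proof (cases "nrm v = 0")
  case False
  have "nrm v * nrm v \<le> C * nrm v"
    using assms(1)[OF assms(2)] by (simp add: B_self power2_eq_square norm_mult)
  then show ?thesis using False by (simp add: mult_le_cancel_right less_le)
qed (use assms in auto)

text \<open>Subtracting from all \<open>v k\<close> their projections to \<open>v m\<close> removes \<open>m\<close> from the index set.\<close>

lemma schur_gram:
  assumes "finite I" and "\<And>c. (\<Sum>k\<in>I. \<Sum>l\<in>I. cnj (c k) * c l * K k l) \<in> \<real>\<^sub>\<ge>\<^sub>0"
  shows "(\<Sum>k\<in>I. \<Sum>l\<in>I. K k l * B (v k) (v l)) \<in> \<real>\<^sub>\<ge>\<^sub>0"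
  using assms
proof (induction I arbitrary: v rule: finite_induct)
  case empty
  then show ?case by simp
next
  case (insert m I)
  have sub: "(\<Sum>k\<in>I. \<Sum>l\<in>I. cnj (c k) * c l * K k l) \<in> \<real>\<^sub>\<ge>\<^sub>0" for c
  proof -
    let ?c = "c(m := 0)"
    have "(\<Sum>k\<in>insert m I. \<Sum>l\<in>insert m I. cnj (?c k) * ?c l * K k l) \<in> \<real>\<^sub>\<ge>\<^sub>0"
      by (rule insert.prems)
    also have "(\<Sum>k\<in>insert m I. \<Sum>l\<in>insert m I. cnj (?c k) * ?c l * K k l) =
        (\<Sum>k\<in>I. \<Sum>l\<in>I. cnj (?c k) * ?c l * K k l)"
      using insert.hyps by simp
    also have "\<dots> = (\<Sum>k\<in>I. \<Sum>l\<in>I. cnj (c k) * c l * K k l)"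
      using insert.hyps by (intro sum.cong refl) (auto split: if_splits)
    finally show ?thesis .
  qed
  have IH: "(\<Sum>k\<in>I. \<Sum>l\<in>I. K k l * B (w k) (w l)) \<in> \<real>\<^sub>\<ge>\<^sub>0" for w
    by (rule insert.IH) (rule sub)
  show ?case
  proof (cases "B (v m) (v m) = 0")
    case True
    then have "nrm (v m) = 0" by (simp add: nrm_def)
    then have z: "B (v m) y = 0" "B y (v m) = 0" for y
      using cauchy_schwarz[of "v m" y] cauchy_schwarz[of y "v m"] by auto
    show ?thesis using insert.hyps IH[of v] by (simp add: z)
  next
    case False
    define d where "d = B (v m) (v m)"
    define t where "t k = B (v m) (v k) / d" for k
    define w where "w k = v k - t k *\<^sub>C v m" for k
    have d: "d \<noteq> 0" "d \<in> \<real>\<^sub>\<ge>\<^sub>0" "cnj d = d"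
      using False nonneg[of "v m"] B_self[of "v m"] by (auto simp: d_def)
    have split: "B (v k) (v l) = B (w k) (w l) + cnj (t k) * t l * d" for k l
    proof -
      have 1: "B (v k) (v m) = cnj (t k) * d" for k
        using d hermitian[of "v m" "v k"] hermitian[of "v k" "v m"] by (simp add: t_def)
      have 2: "B (v m) (v l) = t l * d" for l using d by (simp add: t_def)
      have 3: "t m = 1" using d by (simp add: t_def d_def[symmetric])
      show ?thesis
        by (simp add: w_def diff_left diff_right scale_left scale_right 1 2 3)
    qed
    have "w m = 0" using d by (simp add: w_def t_def d_def[symmetric])
    then have "(\<Sum>k\<in>insert m I. \<Sum>l\<in>insert m I. K k l * B (w k) (w l)) =
        (\<Sum>k\<in>I. \<Sum>l\<in>I. K k l * B (w k) (w l))"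
      using insert.hyps by simp
    then have "(\<Sum>k\<in>insert m I. \<Sum>l\<in>insert m I. K k l * B (w k) (w l)) \<in> \<real>\<^sub>\<ge>\<^sub>0"
      using IH by simp
    moreover have "(\<Sum>k\<in>insert m I. \<Sum>l\<in>insert m I. cnj (t k) * t l * K k l) * d \<in> \<real>\<^sub>\<ge>\<^sub>0"
      using insert.prems d by (intro nonneg_Reals_mult_I)
    moreover have "(\<Sum>k\<in>insert m I. \<Sum>l\<in>insert m I. K k l * B (v k) (v l)) =
       (\<Sum>k\<in>insert m I. \<Sum>l\<in>insert m I. K k l * B (w k) (w l)) +
       (\<Sum>k\<in>insert m I. \<Sum>l\<in>insert m I. cnj (t k) * t l * K k l) * d"
      unfolding split sum_distrib_right sum.distrib[symmetric]
      by (intro sum.cong refl) (simp add: algebra_simps)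
    ultimately show ?thesis by (simp add: nonneg_Reals_add_I)
  qed
qed

text \<open>The coefficients are absorbed into the vectors. The conclusion has the shape of the
  hypothesis on \<open>K\<close>, so the statement can be iterated over the slots of a
  tensor.\<close>

lemma schur_product:
  assumes "finite I" and K: "\<And>c. (\<Sum>k\<in>I. \<Sum>l\<in>I. cnj (c k) * c l * K k l) \<in> \<real>\<^sub>\<ge>\<^sub>0"
  shows "(\<Sum>k\<in>I. \<Sum>l\<in>I. cnj (c k) * c l * (K k l * B (v k) (v l))) \<in> \<real>\<^sub>\<ge>\<^sub>0"
  using schur_gram[OF assms, of "\<lambda>k. c k *\<^sub>C v k"]
  by (simp add: scale_left scale_right mult_ac)

end

section \<open>Completions of seminormed spaces\<close>

lemma squeeze_zero:
  fixes f g :: "nat \<Rightarrow> real"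
  assumes "g \<longlonglongrightarrow> 0" "\<And>k. 0 \<le> f k" "\<And>k. f k \<le> g k"
  shows "f \<longlonglongrightarrow> 0"
  using assms(1) by (rule Lim_null_comparison[rotated]) (simp add: assms)

locale seminormed =
  fixes V :: "'v::ab_group_add set" and p :: "'v \<Rightarrow> real"
  assumes zero_mem: "0 \<in> V" and diff_mem: "x \<in> V \<Longrightarrow> y \<in> V \<Longrightarrow> x - y \<in> V"
    and p_zero: "p 0 = 0"
    and p_diff: "x \<in> V \<Longrightarrow> y \<in> V \<Longrightarrow> p (x - y) \<le> p x + p y"
begin

lemma p_minus: "x \<in> V \<Longrightarrow> p (- x) = p x"
proof -
  assume x: "x \<in> V"
  then have "- x \<in> V" using diff_mem[OF zero_mem x] by simp
  from p_diff[OF zero_mem x] p_diff[OF zero_mem this] show ?thesis by (simp add: p_zero)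
qed

lemma p_nonneg: "x \<in> V \<Longrightarrow> 0 \<le> p x"
  using p_diff[of x x] by (simp add: p_zero)

lemma p_swap: "x \<in> V \<Longrightarrow> y \<in> V \<Longrightarrow> p (x - y) = p (y - x)"
  using p_minus[OF diff_mem[of x y]] by simp

lemma p_tri: "x \<in> V \<Longrightarrow> y \<in> V \<Longrightarrow> z \<in> V \<Longrightarrow> p (x - z) \<le> p (x - y) + p (y - z)"
  using p_diff[OF diff_mem[of x y] diff_mem[of z y]] p_swap[of y z] by simp

lemma p_rev: "x \<in> V \<Longrightarrow> y \<in> V \<Longrightarrow> \<bar>p x - p y\<bar> \<le> p (x - y)"
  using p_tri[of x y 0] p_tri[of y x 0] p_swap[of x y] zero_mem by simp

lemma cauchy_seq_mem: "cauchy_seq V p s \<Longrightarrow> s k \<in> V"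
  by (auto simp: cauchy_seq_def)

lemma cauchy_seqD:
  "cauchy_seq V p s \<Longrightarrow> 0 < e \<Longrightarrow> \<exists>N. \<forall>k\<ge>N. \<forall>l\<ge>N. p (s k - s l) < e"
  by (simp add: cauchy_seq_def)

lemma cauchy_seq_const: "x \<in> V \<Longrightarrow> cauchy_seq V p (\<lambda>_. x)"
  by (auto simp: cauchy_seq_def p_zero)

lemma class_refl: "cauchy_seq V p s \<Longrightarrow> s \<in> completion_class V p s"
  by (auto simp: completion_class_def p_zero)

lemma class_subset:
  assumes s: "cauchy_seq V p s" and t: "t \<in> completion_class V p s"
  shows "completion_class V p t \<subseteq> completion_class V p s"
proof
  fix u assume u: "u \<in> completion_class V p t"
  have c: "cauchy_seq V p u" "cauchy_seq V p t" using u t by (auto simp: completion_class_def)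
  have "(\<lambda>k. p (u k - t k)) \<longlonglongrightarrow> 0" "(\<lambda>k. p (t k - s k)) \<longlonglongrightarrow> 0"
    using u t by (auto simp: completion_class_def)
  from tendsto_add_zero[OF this] have "(\<lambda>k. p (u k - s k)) \<longlonglongrightarrow> 0"
    by (rule squeeze_zero) (simp_all add: p_nonneg p_tri diff_mem cauchy_seq_mem c s)
  then show "u \<in> completion_class V p s" using c by (simp add: completion_class_def)
qed

lemma class_sym:
  assumes "cauchy_seq V p s" "t \<in> completion_class V p s"
  shows "s \<in> completion_class V p t"
  using assms by (auto simp: completion_class_def p_swap cauchy_seq_mem)

lemma class_eq:
  assumes "cauchy_seq V p s" "t \<in> completion_class V p s"
  shows "completion_class V p t = completion_class V p s"
  using class_subset[OF assms] class_subset[OF _ class_sym[OF assms]] assms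
  by (auto simp: completion_class_def)

lemma class_eqI:
  assumes "cauchy_seq V p s" "cauchy_seq V p t" "(\<lambda>k. p (t k - s k)) \<longlonglongrightarrow> 0"
  shows "completion_class V p t = completion_class V p s"
  using assms by (intro class_eq) (auto simp: completion_class_def)

lemma cauchy_norm_convergent:
  assumes s: "cauchy_seq V p s"
  shows "convergent (\<lambda>k. p (s k))"
proof (rule Cauchy_convergent, rule CauchyI)
  fix e :: real assume "0 < e"
  then obtain N where N: "\<And>k l. k \<ge> N \<Longrightarrow> l \<ge> N \<Longrightarrow> p (s k - s l) < e"
    using cauchy_seqD[OF s] by blast
  have "norm (p (s k) - p (s l)) < e" if "k \<ge> N" "l \<ge> N" for k l
    using p_rev[of "s k" "s l"] N[OF that] cauchy_seq_mem[OF s] by simp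
  then show "\<exists>M. \<forall>m\<ge>M. \<forall>n\<ge>M. norm (p (s m) - p (s n)) < e" by blast
qed

lemma completion_norm_class:
  assumes s: "cauchy_seq V p s" and lim: "(\<lambda>k. p (s k)) \<longlonglongrightarrow> r"
  shows "completion_norm p (completion_class V p s) = r"
proof -
  have *: "(\<lambda>k. p (t k)) \<longlonglongrightarrow> r" if t: "t \<in> completion_class V p s" for t
  proof -
    have ct: "cauchy_seq V p t" and "(\<lambda>k. p (t k - s k)) \<longlonglongrightarrow> 0"
      using t by (auto simp: completion_class_def)
    then have "(\<lambda>k. p (t k) - p (s k)) \<longlonglongrightarrow> 0"
      by (rule_tac Lim_null_comparison[of _ "\<lambda>k. p (t k - s k)"])
        (auto intro!: always_eventually p_rev simp: cauchy_seq_mem s)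
    from tendsto_add[OF this lim] show ?thesis by simp
  qed
  show ?thesis unfolding completion_norm_def
  proof (rule the_equality)
    show "\<forall>t\<in>completion_class V p s. (\<lambda>k. p (t k)) \<longlonglongrightarrow> r" using * by blast
    fix r' assume "\<forall>t\<in>completion_class V p s. (\<lambda>k. p (t k)) \<longlonglongrightarrow> r'"
    then show "r' = r" using class_refl[OF s] lim LIMSEQ_unique by blast
  qed
qed

context
  fixes f :: "'v \<Rightarrow> 'v" and C :: real
  assumes f_mem: "\<And>x. x \<in> V \<Longrightarrow> f x \<in> V"
    and f_diff: "\<And>x y. x \<in> V \<Longrightarrow> y \<in> V \<Longrightarrow> f (x - y) = f x - f y"
    and f_bound: "\<And>x. x \<in> V \<Longrightarrow> p (f x) \<le> C * p x"
begin

text \<open>The constant \<open>\<bar>C\<bar> + 1\<close> is positive for every \<open>C\<close>, so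
  that an error bound can be divided by it.\<close>

lemma f_bound_pos: "x \<in> V \<Longrightarrow> p (f x) \<le> (\<bar>C\<bar> + 1) * p x"
  using f_bound[of x] mult_right_mono[of C "\<bar>C\<bar> + 1" "p x"] p_nonneg[of x] by fastforce

lemma cauchy_seq_map:
  assumes s: "cauchy_seq V p s"
  shows "cauchy_seq V p (f \<circ> s)"
  unfolding cauchy_seq_def
proof (intro conjI allI impI)
  show "range (f \<circ> s) \<subseteq> V" using s f_mem by (auto simp: cauchy_seq_def)
  fix e :: real assume "0 < e"
  then have "0 < e / (\<bar>C\<bar> + 1)" by simp
  then obtain N where N: "\<And>k l. k \<ge> N \<Longrightarrow> l \<ge> N \<Longrightarrow> p (s k - s l) < e / (\<bar>C\<bar> + 1)"
    using cauchy_seqD[OF s] by blast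
  have "p ((f \<circ> s) k - (f \<circ> s) l) < e" if "k \<ge> N" "l \<ge> N" for k l
  proof -
    have "p ((f \<circ> s) k - (f \<circ> s) l) \<le> (\<bar>C\<bar> + 1) * p (s k - s l)"
      using f_bound_pos[OF diff_mem, of "s k" "s l"] f_diff cauchy_seq_mem[OF s] by simp
    also have "\<dots> < e" using N[OF that] by (simp add: field_simps)
    finally show ?thesis .
  qed
  then show "\<exists>N. \<forall>k\<ge>N. \<forall>l\<ge>N. p ((f \<circ> s) k - (f \<circ> s) l) < e" by blast
qed

text \<open>The union defining \<open>completion_map\<close> runs over equal sets: \<open>f\<close>
  is Lipschitz for \<open>p\<close>, hence sends equivalent representatives to equivalent
  sequences.\<close>

lemma completion_map_class:
  assumes s: "cauchy_seq V p s"
  shows "completion_map V p f (completion_class V p s) = completion_class V p (f \<circ> s)"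
proof -
  have "completion_class V p (f \<circ> t) = completion_class V p (f \<circ> s)"
    if t: "t \<in> completion_class V p s" for t
  proof (rule class_eqI)
    have ct: "cauchy_seq V p t" and lim: "(\<lambda>k. p (t k - s k)) \<longlonglongrightarrow> 0"
      using t by (auto simp: completion_class_def)
    show "cauchy_seq V p (f \<circ> s)" "cauchy_seq V p (f \<circ> t)"
      using cauchy_seq_map s ct by blast+
    have bd: "p ((f \<circ> t) k - (f \<circ> s) k) \<le> (\<bar>C\<bar> + 1) * p (t k - s k)" for k
      using f_bound_pos[OF diff_mem, of "t k" "s k"] by (simp add: f_diff cauchy_seq_mem s ct)
    show "(\<lambda>k. p ((f \<circ> t) k - (f \<circ> s) k)) \<longlonglongrightarrow> 0"
      using tendsto_mult_right_zero[OF lim, of "\<bar>C\<bar> + 1"]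
      by (rule squeeze_zero[OF _ _ bd]) (simp add: p_nonneg f_mem diff_mem cauchy_seq_mem s ct)
  qed
  then show ?thesis unfolding completion_map_def using class_refl[OF s] by blast
qed

end

end

section \<open>The Fermi *-algebra\<close>

lemma fin_if_upd [simp]: "fin (\<lambda>j. if j = i then a else g j) \<longleftrightarrow> fin g"
  by (rule fin_upd[unfolded fun_upd_def])

lemma tf_upd_add: "fin g \<Longrightarrow> tf (g(i := a + b)) = tf (g(i := a)) + tf (g(i := b))"
  by (rule multilin_add[OF multilin_tf])

lemma tf_upd_scale: "fin g \<Longrightarrow> tf (g(i := c *\<^sub>C a)) = c *\<^sub>C tf (g(i := a))"
  by (rule multilin_scale[OF multilin_tf])

lemma tf_upd_zero [simp]: "fin g \<Longrightarrow> tf (g(i := 0)) = 0"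
  using tf_upd_scale[of g i 0 0] by simp

lemma tf_eq_zero:
  assumes "fin g" "g i = 0"
  shows "tf g = 0"
  using tf_upd_zero[OF assms(1), of i] assms(2) by (simp add: fun_upd_idem)

lemma tf_scale_many:
  assumes "fin h"
  shows "tf (\<lambda>i. if i < n then c i *\<^sub>C h i else h i) = (\<Prod>i<n. c i) *\<^sub>C tf h"
proof (induction n)
  case (Suc n)
  let ?f = "\<lambda>i. if i < n then c i *\<^sub>C h i else h i"
  obtain m where m: "\<forall>i\<ge>m. h i = 1" using assms by (auto simp: fin_def)
  have fin: "fin ?f" unfolding fin_def by (intro exI[of _ "max m n"]) (use m in auto)
  have "(\<lambda>i. if i < Suc n then c i *\<^sub>C h i else h i) = ?f(n := c n *\<^sub>C h n)"
    by (auto simp: fun_eq_iff)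
  then have "tf (\<lambda>i. if i < Suc n then c i *\<^sub>C h i else h i) = tf (?f(n := c n *\<^sub>C h n))"
    by (rule arg_cong)
  also have "\<dots> = c n *\<^sub>C tf (?f(n := h n))" by (rule tf_upd_scale[OF fin])
  also have "?f(n := h n) = ?f" by (auto simp: fun_eq_iff)
  finally show ?case using Suc by (simp add: scaleC_scaleC mult.commute)
qed simp

lemma clinear_tensor_eqI:
  assumes "clinear f" "clinear h" "\<And>g. fin g \<Longrightarrow> f (tf g) = h (tf g)"
  shows "f x = h x"
  by (induction x rule: tensor_induct) (use assms in \<open>auto simp: clinear_iff\<close>)

section \<open>Slotwise operators\<close>

text \<open>Almost all maps have to fix \<open>1\<close>; otherwise the image of an eventually
  trivial sequence would not be eventually trivial.\<close>

definition slot_ok :: "(nat \<Rightarrow> 'a \<Rightarrow> 'a::unital_cstar_algebra) \<Rightarrow> bool" where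
  "slot_ok u \<longleftrightarrow> (\<forall>i. clinear (u i)) \<and> (\<exists>n. \<forall>i\<ge>n. u i 1 = 1)"

lemma slot_okI: "(\<And>i. clinear (u i)) \<Longrightarrow> (\<And>i. i \<ge> n \<Longrightarrow> u i 1 = 1) \<Longrightarrow> slot_ok u"
  by (auto simp: slot_ok_def)

definition slotop :: "(nat \<Rightarrow> 'a \<Rightarrow> 'a::unital_cstar_algebra) \<Rightarrow> 'a tensor \<Rightarrow> 'a tensor" where
  "slotop u = tlift (*\<^sub>C) (\<lambda>g. tf (\<lambda>i. u i (g i)))"

lemma multilin_slotop:
  assumes "slot_ok u"
  shows "multilin (*\<^sub>C) (\<lambda>g. tf (\<lambda>i. u i (g i)))"
proof (rule multilinI)
  fix g :: "nat \<Rightarrow> 'a" and i a b c assume "fin g"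
  then have fin: "fin (\<lambda>i. u i (g i))" by (rule fin_map) (use assms in \<open>simp add: slot_ok_def\<close>)
  have upd: "(\<lambda>j. u j ((g(i := a)) j)) = (\<lambda>j. u j (g j))(i := u i a)" for a by auto
  have lin: "clinear (u i)" using assms by (simp add: slot_ok_def)
  show "tf (\<lambda>j. u j ((g(i := a + b)) j)) =
      tf (\<lambda>j. u j ((g(i := a)) j)) + tf (\<lambda>j. u j ((g(i := b)) j))"
    unfolding upd clinear_add[OF lin] by (rule tf_upd_add[OF fin])
  show "tf (\<lambda>j. u j ((g(i := c *\<^sub>C a)) j)) = c *\<^sub>C tf (\<lambda>j. u j ((g(i := a)) j))"
    unfolding upd clinear_scale[OF lin] by (rule tf_upd_scale[OF fin])
qed

lemma clinear_slotop: "slot_ok u \<Longrightarrow> clinear (slotop u)"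
  unfolding slotop_def by (rule tlift_linear[OF vector_space_scaleC multilin_slotop])

lemma slotop_tf: "slot_ok u \<Longrightarrow> fin g \<Longrightarrow> slotop u (tf g) = tf (\<lambda>i. u i (g i))"
  unfolding slotop_def by (rule tlift_tf[OF vector_space_scaleC multilin_slotop])

lemma clinear_mult_left: "clinear (\<lambda>b. a * (b::'a::unital_cstar_algebra))"
  by (simp add: clinear_iff distrib_left mult_scaleC_right)

section \<open>Even and odd parts\<close>

locale graded =
  fixes \<theta> :: "'a::unital_cstar_algebra \<Rightarrow> 'a"
  assumes grading: "grading \<theta>"
begin

lemma th_linear: "clinear \<theta>" and th_mult: "\<theta> (a * b) = \<theta> a * \<theta> b"
  and th_star: "\<theta> (star a) = star (\<theta> a)" and th_th [simp]: "\<theta> (\<theta> a) = a"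
  using grading by (auto simp: grading_def)

lemmas th_add = clinear_add[OF th_linear]
lemmas th_scale = clinear_scale[OF th_linear]
lemmas th_diff = clinear_diff[OF th_linear]
lemmas th_zero [simp] = clinear_zero[OF th_linear]

lemma th_one [simp]: "\<theta> 1 = 1"
proof -
  have "\<theta> 1 = \<theta> 1 * \<theta> (\<theta> 1)" by simp
  also have "\<dots> = \<theta> (1 * \<theta> 1)" by (simp only: th_mult)
  also have "\<dots> = 1" by simp
  finally show ?thesis .
qed

abbreviation odd where "odd a \<equiv> odd_elem \<theta> a"
abbreviation hom where "hom a \<equiv> homogeneous \<theta> a"

definition ev where "ev a = (1/2) *\<^sub>C (a + \<theta> a)"
definition od where "od a = (1/2) *\<^sub>C (a - \<theta> a)"

lemma scaleC_half: "(1/2) *\<^sub>C (a + a) = (a::'v::complex_vector)"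
  by (simp add: scaleC_add_right scaleC_add_left[symmetric])

lemma ev_od: "ev a + od a = a"
  by (simp add: ev_def od_def scaleC_add_right[symmetric] scaleC_half)

lemma clinear_ev: "clinear ev" and clinear_od: "clinear od"
  by (auto simp: clinear_iff ev_def od_def th_add th_scale scaleC_add_right
      complex_vector.scale_right_diff_distrib scaleC_scaleC mult.commute)

lemma th_ev: "\<theta> (ev a) = ev a" and th_od: "\<theta> (od a) = - od a"
  by (simp_all add: ev_def od_def th_scale th_add th_diff add.commute
      scaleC_minus_right[symmetric])

lemma ev_even: "\<theta> a = a \<Longrightarrow> ev a = a" and od_even: "\<theta> a = a \<Longrightarrow> od a = 0"
  and ev_odd: "\<theta> a = - a \<Longrightarrow> ev a = 0" and od_odd: "\<theta> a = - a \<Longrightarrow> od a = a"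
  by (simp_all add: ev_def od_def scaleC_half)

lemma ev_one [simp]: "ev 1 = 1" and od_one [simp]: "od 1 = 0"
  by (simp_all add: ev_even od_even)

lemma hom_ev: "hom (ev a)" and hom_od: "hom (od a)"
  by (simp_all add: homogeneous_def even_elem_def odd_elem_def th_ev th_od)

lemma homD: "hom a \<Longrightarrow> \<theta> a = (if odd a then - a else a)"
  by (auto simp: homogeneous_def even_elem_def odd_elem_def)

lemma hom_one [simp]: "hom 1" by (simp add: homogeneous_def even_elem_def)

lemma eq_neg_self_imp_zero: "a = - a \<Longrightarrow> a = (0::'a)"
proof -
  assume "a = - a"
  then have "a + a = 0" by (simp add: eq_neg_iff_add_eq_0)
  then show ?thesis using scaleC_half[of a] by simp
qed

lemma not_odd_one [simp]: "\<not> odd 1"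
  using eq_neg_self_imp_zero[of 1] by (auto simp: odd_elem_def)

lemma hom_mult: "hom a \<Longrightarrow> hom b \<Longrightarrow> hom (a * b)"
  by (auto simp: homogeneous_def even_elem_def odd_elem_def th_mult)

lemma hom_star: "hom a \<Longrightarrow> hom (star a)"
  by (auto simp: homogeneous_def even_elem_def odd_elem_def th_star star_minus)

lemma odd_star: "odd (star a) \<longleftrightarrow> odd a"
proof
  show "odd (star a)" if "odd a" for a using that by (simp add: odd_elem_def th_star star_minus)
  from this[of "star a"] show "odd (star a) \<Longrightarrow> odd a" by (simp add: star_star)
qed

text \<open>The element \<open>0\<close> is both even and odd, so \<open>odd 0\<close> holds and
  parity is additive only for nonzero products. The sign computations below therefore treat
  vanishing products separately.\<close>

lemma odd_mult:
  assumes "hom a" "hom b" "a * b \<noteq> 0"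
  shows "odd (a * b) \<longleftrightarrow> odd a \<noteq> odd b"
  using homD[OF assms(1)] homD[OF assms(2)] eq_neg_self_imp_zero[of "a * b"] assms(3)
  by (auto simp: odd_elem_def th_mult split: if_splits)

lemma eps_mult_left:
  assumes "hom a" "hom b" "a * b \<noteq> 0"
  shows "eps \<theta> (a * b) c = eps \<theta> a c * eps \<theta> b c"
  using odd_mult[OF assms] by (auto simp: eps_def)

lemma eps_mult_right:
  assumes "hom a" "hom b" "a * b \<noteq> 0"
  shows "eps \<theta> c (a * b) = eps \<theta> c a * eps \<theta> c b"
  using odd_mult[OF assms] by (auto simp: eps_def)

text \<open>Slots are split into even and odd part one at a time, from the highest downwards;
  \<open>n\<close> bounds the slots that may still be inhomogeneous.\<close>

lemma hom_tensor_induct [consumes 0, case_names tf add scale]: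
  assumes tf: "\<And>g. fin g \<Longrightarrow> (\<And>i. hom (g i)) \<Longrightarrow> P (tf g)"
    and add: "\<And>x y. P x \<Longrightarrow> P y \<Longrightarrow> P (x + y)"
    and scale: "\<And>c x. P x \<Longrightarrow> P (c *\<^sub>C x)"
  shows "P x"
proof (induction x rule: tensor_induct)
  case (tf g)
  have "P (tf g)" if "fin g" "\<And>i. i \<ge> n \<Longrightarrow> hom (g i)" for n and g :: "nat \<Rightarrow> 'a"
    using that
  proof (induction n arbitrary: g)
    case 0
    then show ?case using assms(1) by simp
  next
    case (Suc n)
    have "P (tf (g(n := c)))" if c: "hom c" for c
    proof (rule Suc.IH[of "g(n := c)"])
      show "hom ((g(n := c)) i)" if "i \<ge> n" for i
        using Suc.prems(2)[of i] that c by (cases "i = n") auto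
    qed (use Suc.prems(1) in simp)
    then have "P (tf (g(n := ev (g n))))" "P (tf (g(n := od (g n))))"
      by (simp_all add: hom_ev hom_od)
    then have "P (tf (g(n := ev (g n) + od (g n))))"
      using Suc.prems by (simp add: tf_upd_add add)
    then show ?case by (simp add: ev_od)
  qed
  moreover obtain n where "\<forall>i\<ge>n. g i = 1" using tf by (auto simp: fin_def)
  ultimately show ?case using tf by (metis hom_one)
qed (use add scale in auto)

subsection \<open>Multiplication\<close>

text \<open>\<open>lmul j a\<close> is left multiplication by \<open>emb j a\<close>: the odd part of \<open>a\<close> is moved past the
  slots \<open>i < j\<close>, on which it acts by \<open>\<theta>\<close>.\<close>

definition lmul :: "nat \<Rightarrow> 'a \<Rightarrow> 'a tensor \<Rightarrow> 'a tensor" where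
  "lmul j a x = slotop (\<lambda>i. if i = j then (\<lambda>b. ev a * b) else (\<lambda>b. b)) x +
     slotop (\<lambda>i. if i < j then \<theta> else if i = j then (\<lambda>b. od a * b) else (\<lambda>b. b)) x"

lemma slot_ok_upd: "slot_ok (\<lambda>i. if i = j then (\<lambda>b. a * b) else (\<lambda>b. b))"
  by (rule slot_okI[of _ "Suc j"]) (simp_all add: clinear_mult_left clinear_id)

lemma slot_ok_theta_upd:
  "slot_ok (\<lambda>i. if i < j then \<theta> else if i = j then (\<lambda>b. a * b) else (\<lambda>b. b))"
  by (rule slot_okI[of _ "Suc j"]) (simp_all add: clinear_mult_left clinear_id th_linear)

lemma clinear_lmul: "clinear (lmul j a)"
  using clinear_slotop[OF slot_ok_upd[of j "ev a"]] clinear_slotop[OF slot_ok_theta_upd[of j "od a"]]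
  by (simp add: clinear_iff lmul_def algebra_simps scaleC_add_right)

lemma lmul_tf:
  assumes "fin h"
  shows "lmul j a (tf h) = tf (h(j := ev a * h j)) +
    tf ((\<lambda>i. if i < j then \<theta> (h i) else h i)(j := od a * h j))"
  unfolding lmul_def slotop_tf[OF slot_ok_upd assms] slotop_tf[OF slot_ok_theta_upd assms]
  by (intro arg_cong2[of _ _ _ _ "(+)"] arg_cong[of _ _ tf]) auto

lemma fin_theta: "fin h \<Longrightarrow> fin (\<lambda>i. if i < j then \<theta> (h i) else h i)"
  using fin_map[of h "\<lambda>i. if i < j then \<theta> else (\<lambda>b. b)"] by (simp add: if_distribR cong: if_cong)

lemma lmul_add: "lmul j (a + b) x = lmul j a x + lmul j b x"
proof (induction x rule: tensor_induct)
  case (tf h)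
  then show ?case
    by (simp add: lmul_tf clinear_add[OF clinear_ev] clinear_add[OF clinear_od] distrib_right
        tf_upd_add fin_theta)
qed (simp_all add: clinear_add[OF clinear_lmul] clinear_scale[OF clinear_lmul] scaleC_add_right)

lemma lmul_scale: "lmul j (c *\<^sub>C a) x = c *\<^sub>C lmul j a x"
proof (induction x rule: tensor_induct)
  case (tf h)
  then show ?case
    by (simp add: lmul_tf clinear_scale[OF clinear_ev] clinear_scale[OF clinear_od]
        mult_scaleC_left tf_upd_scale fin_theta scaleC_add_right)
qed (simp_all add: clinear_add[OF clinear_lmul] clinear_scale[OF clinear_lmul] scaleC_add_right
    scaleC_scaleC mult.commute)

lemma lmul_one [simp]: "lmul j 1 x = x"
  by (induction x rule: tensor_induct)
    (simp_all add: lmul_tf fin_theta clinear_add[OF clinear_lmul] clinear_scale[OF clinear_lmul])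

lemma lmul_hom:
  assumes h: "fin h" "\<And>i. i < n \<Longrightarrow> hom (h i)" and a: "hom a"
  shows "lmul n a (tf h) = (\<Prod>j<n. eps \<theta> a (h j)) *\<^sub>C tf (h(n := a * h n))"
proof (cases "odd a")
  case True
  then have *: "ev a = 0" "od a = a" by (auto simp: odd_elem_def ev_odd od_odd)
  have e: "(\<lambda>i. if i < n then \<theta> (h i) else h i)(n := a * h n) =
      (\<lambda>i. if i < n then eps \<theta> a (h i) *\<^sub>C (h(n := a * h n)) i else (h(n := a * h n)) i)"
    using True h(2) homD by (auto simp: fun_eq_iff eps_def scaleC_minus_left)
  have "tf (\<lambda>i. if i < n then eps \<theta> a (h i) *\<^sub>C (h(n := a * h n)) i else (h(n := a * h n)) i) =
      (\<Prod>j<n. eps \<theta> a (h j)) *\<^sub>C tf (h(n := a * h n))"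
    by (rule tf_scale_many) (simp add: h)
  then show ?thesis
    by (simp only: lmul_tf[OF h(1)] * e mult_zero_left tf_upd_zero[OF h(1)] add_0)
next
  case False
  then have "ev a = a" "od a = 0" "\<And>b. eps \<theta> a b = 1"
    using a by (auto simp: homogeneous_def even_elem_def odd_elem_def ev_even od_even eps_def)
  then show ?thesis by (simp add: lmul_tf h fin_theta)
qed

text \<open>Left multiplication by \<open>g 0 \<otimes> ... \<otimes> g (n - 1)\<close>, read as the
  ordered product of its one-slot factors. The highest slot acts first, so each \<open>g n\<close>
  passes the slots below it while they are still untouched by the other factors.\<close>

primrec gop :: "(nat \<Rightarrow> 'a) \<Rightarrow> nat \<Rightarrow> 'a tensor \<Rightarrow> 'a tensor" where
  "gop g 0 x = x"
| "gop g (Suc n) x = gop g n (lmul n (g n) x)"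

lemma clinear_gop: "clinear (gop g n)"
  by (induction n) (auto simp: clinear_iff clinear_add[OF clinear_lmul] clinear_scale[OF clinear_lmul])

lemma gop_cong: "(\<And>i. i < n \<Longrightarrow> g i = h i) \<Longrightarrow> gop g n x = gop h n x"
  by (induction n arbitrary: x) auto

lemma gop_add: "i < n \<Longrightarrow> gop (g(i := a + b)) n x = gop (g(i := a)) n x + gop (g(i := b)) n x"
proof (induction n arbitrary: x)
  case (Suc n)
  show ?case
  proof (cases "i = n")
    case True
    have "gop (g(i := c)) n y = gop g n y" for c y by (rule gop_cong) (use True in auto)
    then show ?thesis unfolding True gop.simps fun_upd_same lmul_add
      by (simp only: clinear_add[OF clinear_gop])
  next
    case False
    then show ?thesis using Suc by simp
  qed
qed simp

lemma gop_scale: "i < n \<Longrightarrow> gop (g(i := c *\<^sub>C a)) n x = c *\<^sub>C gop (g(i := a)) n x"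
proof (induction n arbitrary: x)
  case (Suc n)
  show ?case
  proof (cases "i = n")
    case True
    have "gop (g(i := c)) n y = gop g n y" for c y by (rule gop_cong) (use True in auto)
    then show ?thesis unfolding True gop.simps fun_upd_same lmul_scale
      by (simp only: clinear_scale[OF clinear_gop])
  next
    case False
    then show ?thesis using Suc by simp
  qed
qed simp

lemma gop_extend:
  assumes "\<And>i. i \<ge> n \<Longrightarrow> g i = 1" "n \<le> m"
  shows "gop g m x = gop g n x"
  using assms(2) by (induction m rule: dec_induct) (simp_all add: assms(1))

definition lop :: "(nat \<Rightarrow> 'a) \<Rightarrow> 'a tensor \<Rightarrow> 'a tensor" where
  "lop g = gop g (LEAST n. \<forall>i\<ge>n. g i = 1)"

lemma lop_eq:
  assumes "\<And>i. i \<ge> n \<Longrightarrow> g i = 1"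
  shows "lop g x = gop g n x"
proof -
  define m where "m = (LEAST n. \<forall>i\<ge>n. g i = 1)"
  have "\<forall>i\<ge>m. g i = 1" unfolding m_def by (rule LeastI[of _ n]) (use assms in auto)
  moreover have "m \<le> n" unfolding m_def by (rule Least_le) (use assms in auto)
  ultimately have "gop g n x = gop g m x" by (intro gop_extend) auto
  then show ?thesis by (simp add: lop_def m_def)
qed

lemma multilin_lop: "multilin (*\<^sub>C) (\<lambda>g. lop g x)"
proof (rule multilinI)
  fix g :: "nat \<Rightarrow> 'a" and i a b c assume "fin g"
  then obtain n where n: "\<forall>i\<ge>n. g i = 1" by (auto simp: fin_def)
  define N where "N = max n (Suc i)"
  have *: "lop (g(i := a)) x = gop (g(i := a)) N x" for a
    by (rule lop_eq) (use n N_def in auto)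
  have "i < N" by (simp add: N_def)
  then show "lop (g(i := a + b)) x = lop (g(i := a)) x + lop (g(i := b)) x"
    and "lop (g(i := c *\<^sub>C a)) x = c *\<^sub>C lop (g(i := a)) x"
    unfolding * by (rule gop_add, rule gop_scale)
qed

text \<open>Extension in the left factor is enough, each \<open>lop g\<close> being defined and
  linear on all tensors already.\<close>

definition fmul :: "'a tensor \<Rightarrow> 'a tensor \<Rightarrow> 'a tensor" where
  "fmul x y = tlift (*\<^sub>C) (\<lambda>g. lop g y) x"

lemma clinear_fmul_left: "clinear (\<lambda>x. fmul x y)"
  unfolding fmul_def by (rule tlift_linear[OF vector_space_scaleC multilin_lop])

lemma fmul_tf: "fin g \<Longrightarrow> fmul (tf g) y = lop g y"
  unfolding fmul_def by (rule tlift_tf[OF vector_space_scaleC multilin_lop])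

lemma fmul_add_left: "fmul (x + y) z = fmul x z + fmul y z"
  and fmul_scale_left: "fmul (c *\<^sub>C x) z = c *\<^sub>C fmul x z"
  using clinear_add[OF clinear_fmul_left] clinear_scale[OF clinear_fmul_left] by auto

lemma clinear_fmul: "clinear (fmul x)"
proof (induction x rule: tensor_induct)
  case (tf g)
  have "fmul (tf g) = lop g" using tf by (auto simp: fmul_tf)
  then show ?case by (simp add: lop_def clinear_gop)
qed (auto simp: clinear_iff fmul_add_left fmul_scale_left scaleC_add_right scaleC_scaleC
    mult.commute)

lemma fmul_add_right: "fmul x (y + z) = fmul x y + fmul x z"
  and fmul_scale_right: "fmul x (c *\<^sub>C y) = c *\<^sub>C fmul x y"
  using clinear_add[OF clinear_fmul] clinear_scale[OF clinear_fmul] by auto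

lemma gop_hom:
  assumes "\<And>i. i < n \<Longrightarrow> hom (g i)" "\<And>i. i < n \<Longrightarrow> hom (h i)" "fin h"
  shows "gop g n (tf h) =
    (\<Prod>i<n. \<Prod>j<i. eps \<theta> (g i) (h j)) *\<^sub>C tf (\<lambda>i. if i < n then g i * h i else h i)"
  using assms
proof (induction n arbitrary: h)
  case (Suc n)
  let ?h = "h(n := g n * h n)"
  have "gop g (Suc n) (tf h) = (\<Prod>j<n. eps \<theta> (g n) (h j)) *\<^sub>C gop g n (tf ?h)"
    using Suc.prems by (simp add: lmul_hom clinear_scale[OF clinear_gop])
  also have "gop g n (tf ?h) =
      (\<Prod>i<n. \<Prod>j<i. eps \<theta> (g i) (?h j)) *\<^sub>C tf (\<lambda>i. if i < n then g i * ?h i else ?h i)"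
    by (rule Suc.IH) (use Suc.prems in auto)
  also have "(\<lambda>i. if i < n then g i * ?h i else ?h i) =
      (\<lambda>i. if i < Suc n then g i * h i else h i)"
    by (auto simp: fun_eq_iff less_Suc_eq)
  also have "(\<Prod>i<n. \<Prod>j<i. eps \<theta> (g i) (?h j)) = (\<Prod>i<n. \<Prod>j<i. eps \<theta> (g i) (h j))"
    by (intro prod.cong refl) auto
  finally show ?case by (simp add: scaleC_scaleC mult.commute)
qed simp

text \<open>Only \<open>g\<close> has to be trivial from \<open>n\<close> on: a unit is not odd and
  contributes no sign, so \<open>h\<close> may reach beyond \<open>n\<close>.\<close>

lemma fmul_hom:
  assumes "fin h" "\<And>i. hom (g i)" "\<And>i. hom (h i)" "\<And>i. i \<ge> n \<Longrightarrow> g i = 1"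
  shows "fmul (tf g) (tf h) =
    (\<Prod>i<n. \<Prod>j<i. eps \<theta> (g i) (h j)) *\<^sub>C tf (\<lambda>i. g i * h i)"
proof -
  have "fin g" using assms(4) by (auto simp: fin_def)
  then have "fmul (tf g) (tf h) = gop g n (tf h)"
    by (simp add: fmul_tf lop_eq[OF assms(4)])
  also have "\<dots> = (\<Prod>i<n. \<Prod>j<i. eps \<theta> (g i) (h j)) *\<^sub>C
      tf (\<lambda>i. if i < n then g i * h i else h i)"
    by (rule gop_hom) (use assms in auto)
  also have "(\<lambda>i. if i < n then g i * h i else h i) = (\<lambda>i. g i * h i)"
    using assms(4) by (auto simp: fun_eq_iff)
  finally show ?thesis .
qed

lemma map2_upt: "map2 f (map g [0..<n]) (map h [0..<n]) = map (\<lambda>i. f (g i) (h i)) [0..<n]"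
  by (intro nth_equalityI) auto

lemma nth_default_ge: "length as \<le> i \<Longrightarrow> nth_default 1 as i = 1"
  by (simp add: nth_default_def)

lemma hom_nth_default: "list_all hom as \<Longrightarrow> hom (nth_default 1 as i)"
  by (auto simp: nth_default_def list_all_length)

text \<open>Uniqueness holds because homogeneous elementary tensors span. Both factors are first cut
  at a common length, as the specification concerns lists of equal length.\<close>

lemma fermi_mult_eq: "fermi_mult \<theta> = fmul"
  unfolding fermi_mult_def
proof (rule the_equality, intro conjI allI impI)
  fix as bs assume len: "length as = length bs" and hom: "list_all hom as" "list_all hom bs"
  let ?g = "nth_default 1 as" and ?h = "nth_default 1 bs"
  have "fmul (tens as) (tens bs) =
      (\<Prod>i<length as. \<Prod>j<i. eps \<theta> (?g i) (?h j)) *\<^sub>C tf (\<lambda>i. ?g i * ?h i)"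
    unfolding tens_eq_tf
    by (rule fmul_hom) (use hom in \<open>auto simp: hom_nth_default nth_default_ge\<close>)
  also have "(\<Prod>i<length as. \<Prod>j<i. eps \<theta> (?g i) (?h j)) =
      (\<Prod>i<length as. \<Prod>j<i. eps \<theta> (as ! i) (bs ! j))"
    by (intro prod.cong refl) (use len in \<open>auto simp: nth_default_def\<close>)
  also have "(\<lambda>i. ?g i * ?h i) = nth_default 1 (map2 (*) as bs)"
    using len by (auto simp: nth_default_def fun_eq_iff)
  finally show "fmul (tens as) (tens bs) =
      (\<Prod>i<length as. \<Prod>j<i. eps \<theta> (as ! i) (bs ! j)) *\<^sub>C tens (map2 (*) as bs)"
    by (simp add: tens_eq_tf)
next
  fix m :: "'a tensor \<Rightarrow> 'a tensor \<Rightarrow> 'a tensor"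
  assume m: "(\<forall>x. clinear (m x)) \<and> (\<forall>y. clinear (\<lambda>x. m x y)) \<and>
     (\<forall>as bs. length as = length bs \<longrightarrow> list_all hom as \<longrightarrow> list_all hom bs \<longrightarrow>
        m (tens as) (tens bs) =
          (\<Prod>i<length as. \<Prod>j<i. eps \<theta> (as ! i) (bs ! j)) *\<^sub>C tens (map2 (*) as bs))"
  then have m1: "\<And>x. clinear (m x)" and m2: "\<And>y. clinear (\<lambda>x. m x y)" by auto
  have "m (tf g) (tf h) = fmul (tf g) (tf h)"
    if gh: "fin g" "\<And>i. hom (g i)" "fin h" "\<And>i. hom (h i)" for g h
  proof -
    obtain n where n: "\<And>i. i \<ge> n \<Longrightarrow> g i = 1" "\<And>i. i \<ge> n \<Longrightarrow> h i = 1"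
      using fin_common gh(1,3) by blast
    let ?as = "map g [0..<n]" and ?bs = "map h [0..<n]"
    have "m (tens ?as) (tens ?bs) =
        (\<Prod>i<length ?as. \<Prod>j<i. eps \<theta> (?as ! i) (?bs ! j)) *\<^sub>C tens (map2 (*) ?as ?bs)"
      using m gh by (simp add: list_all_length)
    also have "(\<Prod>i<length ?as. \<Prod>j<i. eps \<theta> (?as ! i) (?bs ! j)) =
        (\<Prod>i<n. \<Prod>j<i. eps \<theta> (g i) (h j))"
      by (intro prod.cong) auto
    also have "tens (map2 (*) ?as ?bs) = tf (\<lambda>i. g i * h i)"
      unfolding map2_upt by (rule tf_eq_tens[symmetric]) (use n in auto)
    also have "(\<Prod>i<n. \<Prod>j<i. eps \<theta> (g i) (h j)) *\<^sub>C tf (\<lambda>i. g i * h i) = fmul (tf g) (tf h)"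
      by (rule fmul_hom[symmetric]) (use n gh in auto)
    finally show ?thesis
      by (simp only: tf_eq_tens[OF n(1), symmetric] tf_eq_tens[OF n(2), symmetric])
  qed
  then have "m (tf g) y = fmul (tf g) y" if "fin g" "\<And>i. hom (g i)" for g y
    by (induction y rule: hom_tensor_induct)
      (use that in \<open>auto simp: clinear_add[OF m1] clinear_scale[OF m1] fmul_add_right fmul_scale_right\<close>)
  then have "m x y = fmul x y" for x y
    by (induction x rule: hom_tensor_induct)
      (auto simp: clinear_add[OF m2] clinear_scale[OF m2] fmul_add_left fmul_scale_left)
  then show "m = fmul" by blast
qed (simp_all add: clinear_fmul clinear_fmul_left)

text \<open>Both bracketings give the same elementary tensor, with signs that agree because
  \<open>eps\<close> is multiplicative in each argument. Multiplicativity can fail when some slot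
  product vanishes, but then the elementary tensor is zero.\<close>

lemma fmul_assoc: "fmul (fmul x y) z = fmul x (fmul y z)"
proof (induction x rule: hom_tensor_induct)
  case (tf f)
  note f = tf
  show ?case
  proof (induction y rule: hom_tensor_induct)
    case (tf g)
    note g = tf
    show ?case
    proof (induction z rule: hom_tensor_induct)
      case (tf h)
      obtain n where n: "\<And>i. i \<ge> n \<Longrightarrow> f i = 1" "\<And>i. i \<ge> n \<Longrightarrow> g i = 1"
        using fin_common f(1) g(1) by blast
      let ?s = "\<lambda>f g. \<Prod>i<n. \<Prod>j<i. eps \<theta> (f i) (g j :: 'a)"
      let ?F = "\<lambda>i. f i * (g i * h i)"
      have l: "fmul (fmul (tf f) (tf g)) (tf h) = (?s f g * ?s (\<lambda>i. f i * g i) h) *\<^sub>C tf ?F"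
        using f g tf n by (simp add: fmul_hom[of _ _ n] hom_mult fin_mult fmul_scale_left
            scaleC_scaleC mult.assoc)
      have r: "fmul (tf f) (fmul (tf g) (tf h)) = (?s g h * ?s f (\<lambda>i. g i * h i)) *\<^sub>C tf ?F"
        using f g tf n by (simp add: fmul_hom[of _ _ n] hom_mult fin_mult fmul_scale_right
            scaleC_scaleC)
      show ?case
      proof (cases "\<exists>i. ?F i = 0")
        case True
        then have "tf ?F = 0" using f g tf by (auto intro!: tf_eq_zero fin_mult)
        then show ?thesis by (simp only: l r scaleC_zero_right)
      next
        case False
        then have "f i * g i \<noteq> 0" "g i * h i \<noteq> 0" for i
          by (metis mult.assoc mult_zero_left, metis mult_zero_right)
        then have "?s (\<lambda>i. f i * g i) h = ?s f h * ?s g h"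
          "?s f (\<lambda>i. g i * h i) = ?s f g * ?s f h"
          using f g tf by (simp_all add: eps_mult_left eps_mult_right prod.distrib)
        then show ?thesis unfolding l r by (simp only: mult_ac)
      qed
    qed (simp_all add: fmul_add_right fmul_scale_right)
  qed (simp_all add: fmul_add_right fmul_scale_right fmul_add_left fmul_scale_left)
qed (simp_all add: fmul_add_left fmul_scale_left)

text \<open>Passing units produces no sign, so the even and odd parts of each \<open>g n\<close>
  recombine and no homogeneity is required.\<close>

lemma gop_disjoint:
  assumes "fin h" "\<And>i. i < n \<Longrightarrow> h i = 1"
  shows "gop g n (tf h) = tf (\<lambda>i. if i < n then g i else h i)"
  using assms
proof (induction n arbitrary: h)
  case (Suc n)
  have "(\<lambda>i. if i < n then \<theta> (h i) else h i) = h" using Suc.prems by (auto simp: fun_eq_iff)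
  then have "lmul n (g n) (tf h) = tf (h(n := g n))"
    using Suc.prems by (simp add: lmul_tf tf_upd_add[symmetric] ev_od)
  then have "gop g (Suc n) (tf h) = gop g n (tf (h(n := g n)))" by (simp only: gop.simps)
  also have "\<dots> = tf (\<lambda>i. if i < n then g i else (h(n := g n)) i)"
    by (rule Suc.IH) (use Suc.prems in auto)
  also have "(\<lambda>i. if i < n then g i else (h(n := g n)) i) = (\<lambda>i. if i < Suc n then g i else h i)"
    by (auto simp: fun_eq_iff less_Suc_eq)
  finally show ?case .
qed simp

lemma fmul_one_right [simp]: "fmul x tunit = x"
proof (induction x rule: tensor_induct)
  case (tf g)
  then obtain n where n: "\<And>i. i \<ge> n \<Longrightarrow> g i = 1" by (auto simp: fin_def)
  have "fmul (tf g) tunit = gop g n (tf (\<lambda>_. 1))"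
    using tf lop_eq[OF n] by (simp add: tunit_eq_tf fmul_tf)
  also have "\<dots> = tf (\<lambda>i. if i < n then g i else 1)" by (rule gop_disjoint) auto
  also have "(\<lambda>i. if i < n then g i else 1) = g" using n by (auto simp: fun_eq_iff not_less)
  finally show ?case .
qed (simp_all add: fmul_add_left fmul_scale_left)

lemma fmul_emb: "fmul (emb j a) x = lmul j a x"
proof -
  have "fmul (emb j a) x = gop ((\<lambda>_. 1)(j := a)) (Suc j) x"
    unfolding emb_eq_tf by (subst fmul_tf, simp, rule lop_eq) auto
  also have "\<dots> = gop (\<lambda>_. 1) j (lmul j a x)" by (simp, rule gop_cong) auto
  also have "\<dots> = lmul j a x" by (subst gop_extend[of 0 "\<lambda>_. 1"]) auto
  finally show ?thesis .
qed

lemma emb_one: "emb j 1 = tunit"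
  by (simp add: emb_eq_tf tunit_eq_tf fun_upd_idem)

lemma fmul_one_left [simp]: "fmul tunit x = x"
  unfolding emb_one[of 0, symmetric] fmul_emb by simp

text \<open>An elementary tensor is the product of its one-slot factors in increasing order.
  Boundedness of left multiplication and compatibility with automorphisms pass to products, so they
  need checking only on \<open>emb j a\<close>.\<close>

lemma emb_induct [consumes 0, case_names emb add scale mult]:
  assumes emb: "\<And>j a. P (emb j a)"
    and add: "\<And>x y. P x \<Longrightarrow> P y \<Longrightarrow> P (x + y)"
    and scale: "\<And>c x. P x \<Longrightarrow> P (c *\<^sub>C x)"
    and mult: "\<And>x y. P x \<Longrightarrow> P y \<Longrightarrow> P (fmul x y)"
  shows "P x"
proof (induction x rule: tensor_induct)
  case (tf g)
  have "P (tf (\<lambda>i. if i < n then g i else 1))" for n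
  proof (induction n)
    case 0
    then show ?case using emb[of 0 1] by (simp add: emb_one tunit_eq_tf)
  next
    case (Suc n)
    let ?g = "\<lambda>i. if i < n then g i else 1"
    have "fin ?g" unfolding fin_def by (intro exI[of _ n]) auto
    then have "fmul (tf ?g) (emb n (g n)) = gop ?g n (emb n (g n))"
      by (simp add: fmul_tf lop_eq[of n])
    also have "\<dots> = tf (\<lambda>i. if i < n then ?g i else ((\<lambda>_. 1)(n := g n)) i)"
      unfolding emb_eq_tf by (rule gop_disjoint) auto
    also have "(\<lambda>i. if i < n then ?g i else ((\<lambda>_. 1)(n := g n)) i) =
        (\<lambda>i. if i < Suc n then g i else 1)"
      by (auto simp: fun_eq_iff less_Suc_eq)
    finally show ?case using mult[OF Suc emb[of n "g n"]] by simp
  qed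
  moreover obtain n where "\<And>i. i \<ge> n \<Longrightarrow> g i = 1" using tf by (auto simp: fin_def)
  then have "(\<lambda>i. if i < n then g i else 1) = g" by (auto simp: fun_eq_iff not_less)
  ultimately show ?case by metis
qed (use add scale in auto)

subsection \<open>Involution\<close>

text \<open>The sign \<open>(-1)\<^bsup>k(k-1)/2\<^esup>\<close> of the involution on a product of homogeneous factors, \<open>k\<close> of
  them odd, equals \<open>((1 + \<i>) (-\<i>)\<^bsup>k\<^esup> + (1 - \<i>) \<i>\<^bsup>k\<^esup>) / 2\<close>, and \<open>\<plusminus>\<i>\<^bsup>k\<^esup>\<close> is produced by slotwise
  application of \<open>ev \<plusminus> \<i> od\<close>.\<close>

definition rot :: "complex \<Rightarrow> 'a \<Rightarrow> 'a" where "rot c a = ev a + c *\<^sub>C od a"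

lemma rot_add: "rot c (a + b) = rot c a + rot c b"
  and rot_scale: "rot c (d *\<^sub>C a) = d *\<^sub>C rot c a"
  by (simp_all add: rot_def clinear_add[OF clinear_ev] clinear_add[OF clinear_od]
      clinear_scale[OF clinear_ev] clinear_scale[OF clinear_od] scaleC_add_right scaleC_scaleC
      mult.commute)

lemma rot_one [simp]: "rot c 1 = 1" by (simp add: rot_def)

lemma rot_hom: "hom a \<Longrightarrow> rot c a = (if odd a then c else 1) *\<^sub>C a"
  using homD[of a]
  by (auto simp: rot_def ev_even od_even ev_odd od_odd)

lemma fin_star_rot: "fin g \<Longrightarrow> fin (\<lambda>i. star (rot c (g i)))"
  by (rule fin_map[where u = "\<lambda>_ a. star (rot c a)"]) auto

definition star_form :: "(nat \<Rightarrow> 'a) \<Rightarrow> 'a tensor" where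
  "star_form g = ((1 + \<i>) / 2) *\<^sub>C tf (\<lambda>i. star (rot \<i> (g i))) +
     ((1 - \<i>) / 2) *\<^sub>C tf (\<lambda>i. star (rot (- \<i>) (g i)))"

lemma multilin_star_form: "multilin (\<lambda>c x. cnj c *\<^sub>C x) star_form"
proof (rule multilinI)
  fix g :: "nat \<Rightarrow> 'a" and i a b d assume g: "fin g"
  have upd: "(\<lambda>j. star (rot c ((g(i := a)) j))) = (\<lambda>j. star (rot c (g j)))(i := star (rot c a))"
    for a c by auto
  show "star_form (g(i := a + b)) = star_form (g(i := a)) + star_form (g(i := b))"
    unfolding star_form_def upd
    by (simp add: rot_add star_add tf_upd_add fin_star_rot g scaleC_add_right)
  show "star_form (g(i := d *\<^sub>C a)) = cnj d *\<^sub>C star_form (g(i := a))"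
    unfolding star_form_def upd
    by (simp add: rot_scale star_scaleC tf_upd_scale fin_star_rot g scaleC_add_right scaleC_scaleC
        mult.commute)
qed

definition fstar :: "'a tensor \<Rightarrow> 'a tensor" where
  "fstar = tlift (\<lambda>c x. cnj c *\<^sub>C x) star_form"

lemma fstar_tf: "fin g \<Longrightarrow> fstar (tf g) = star_form g"
  unfolding fstar_def by (rule tlift_tf[OF vector_space_cnj_scaleC multilin_star_form])

lemma fstar_add: "fstar (x + y) = fstar x + fstar y"
  and fstar_scale: "fstar (c *\<^sub>C x) = cnj c *\<^sub>C fstar x"
  using tlift_linear[OF vector_space_cnj_scaleC multilin_star_form]
  by (auto simp: fstar_def linear_scaleC_iff[OF vector_space_cnj_scaleC])

text \<open>Here \<open>z n\<close> is the power \<open>(-\<i>)^k\<close> for \<open>k\<close> odd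
  factors. Its square \<open>(-1)^k\<close> is the sign that a further odd factor contributes, and
  its four possible values turn the induction step into a finite check.\<close>

lemma star_sign:
  fixes q :: "nat \<Rightarrow> bool"
  defines "z \<equiv> \<lambda>n. \<Prod>i<n. if q i then - \<i> else 1"
  shows "z n \<in> {1, -1, \<i>, -\<i>} \<and> (\<Prod>i<n. if q i then - 1 else (1::complex)) = (z n)\<^sup>2 \<and>
    (\<Prod>j<n. \<Prod>i<j. if q i \<and> q j then - 1 else 1) =
      ((1 + \<i>) / 2) * z n + ((1 - \<i>) / 2) * cnj (z n)"
proof (induction n)
  case 0
  then show ?case by (simp add: z_def field_simps)
next
  case (Suc n)
  have z: "z (Suc n) = z n * (if q n then - \<i> else 1)" by (simp add: z_def)
  have "(\<Prod>i<n. if q i \<and> q n then - 1 else (1::complex)) = (if q n then (z n)\<^sup>2 else 1)"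
    using Suc by simp
  then show ?case using Suc unfolding z
    by (auto simp: field_simps power2_eq_square complex_eq_iff)
qed

lemma fstar_hom:
  assumes "\<And>i. hom (g i)" "\<And>i. i \<ge> n \<Longrightarrow> g i = 1"
  shows "fstar (tf g) = (\<Prod>j<n. \<Prod>i<j. eps \<theta> (g i) (g j)) *\<^sub>C tf (\<lambda>i. star (g i))"
proof -
  have g: "fin g" using assms(2) by (auto simp: fin_def)
  then have psign: "fin (\<lambda>i. star (g i))" by (rule fin_map[where u = "\<lambda>_. star"]) auto
  have rot: "tf (\<lambda>i. star (rot c (g i))) = (\<Prod>i<n. if odd (g i) then cnj c else 1) *\<^sub>C tf (\<lambda>i. star (g i))"
    for c
  proof -
    have "(\<lambda>i. star (rot c (g i))) =
      (\<lambda>i. if i < n then (if odd (g i) then cnj c else 1) *\<^sub>C star (g i) else star (g i))"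
      using assms by (auto simp: fun_eq_iff rot_hom star_scaleC not_less)
    then show ?thesis by (simp only: tf_scale_many[OF psign])
  qed
  define z :: complex where "z = (\<Prod>i<n. if odd (g i) then - \<i> else 1)"
  have cz: "(\<Prod>i<n. if odd (g i) then \<i> else 1) = cnj z"
    unfolding z_def cnj_prod by (intro prod.cong refl) auto
  have "(\<Prod>j<n. \<Prod>i<j. eps \<theta> (g i) (g j)) = ((1 + \<i>) / 2) * z + ((1 - \<i>) / 2) * cnj z"
    using star_sign[where n = n and q = "\<lambda>i. odd (g i)"] by (simp add: eps_def z_def)
  then show ?thesis
    unfolding fstar_tf[OF g] star_form_def rot complex_cnj_i complex_cnj_minus minus_minus cz
      z_def[symmetric]
    by (simp only: scaleC_scaleC scaleC_add_left)
qed

lemma fermi_star_eq: "fermi_star \<theta> = fstar"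
  unfolding fermi_star_def
proof (rule the_equality, intro conjI allI impI)
  fix as assume hom: "list_all hom as"
  let ?g = "nth_default 1 as"
  have "fstar (tens as) =
      (\<Prod>j<length as. \<Prod>i<j. eps \<theta> (?g i) (?g j)) *\<^sub>C tf (\<lambda>i. star (?g i))"
    unfolding tens_eq_tf
    by (rule fstar_hom) (use hom in \<open>auto simp: hom_nth_default nth_default_ge\<close>)
  also have "(\<Prod>j<length as. \<Prod>i<j. eps \<theta> (?g i) (?g j)) =
      (\<Prod>j<length as. \<Prod>i<j. eps \<theta> (as ! i) (as ! j))"
    by (intro prod.cong refl) (auto simp: nth_default_def)
  also have "(\<lambda>i. star (?g i)) = nth_default 1 (map star as)"
    by (auto simp: nth_default_def fun_eq_iff)
  finally show "fstar (tens as) =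
      (\<Prod>j<length as. \<Prod>i<j. eps \<theta> (as ! i) (as ! j)) *\<^sub>C tens (map star as)"
    by (simp add: tens_eq_tf)
next
  fix s :: "'a tensor \<Rightarrow> 'a tensor"
  assume s: "(\<forall>x y. s (x + y) = s x + s y) \<and> (\<forall>c x. s (c *\<^sub>C x) = cnj c *\<^sub>C s x) \<and>
     (\<forall>as. list_all hom as \<longrightarrow>
        s (tens as) = (\<Prod>j<length as. \<Prod>i<j. eps \<theta> (as ! i) (as ! j)) *\<^sub>C tens (map star as))"
  have "s x = fstar x" for x
  proof (induction x rule: hom_tensor_induct)
    case (tf g)
    then obtain n where n: "\<And>i. i \<ge> n \<Longrightarrow> g i = 1" by (auto simp: fin_def)
    let ?as = "map g [0..<n]"
    have "s (tens ?as) =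
        (\<Prod>j<length ?as. \<Prod>i<j. eps \<theta> (?as ! i) (?as ! j)) *\<^sub>C tens (map star ?as)"
      using s tf by (simp add: list_all_length)
    also have "(\<Prod>j<length ?as. \<Prod>i<j. eps \<theta> (?as ! i) (?as ! j)) =
        (\<Prod>j<n. \<Prod>i<j. eps \<theta> (g i) (g j))"
      by (intro prod.cong) auto
    also have "tens (map star ?as) = tf (\<lambda>i. star (g i))"
      by (subst tf_eq_tens[of n]) (use n in \<open>auto simp: comp_def\<close>)
    also have "(\<Prod>j<n. \<Prod>i<j. eps \<theta> (g i) (g j)) *\<^sub>C tf (\<lambda>i. star (g i)) = fstar (tf g)"
      by (rule fstar_hom[symmetric]) (use n tf in auto)
    finally show ?case
      by (simp only: tf_eq_tens[OF n, symmetric])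
  qed (use s in \<open>simp_all add: fstar_add fstar_scale\<close>)
  then show "s = fstar" by blast
qed (simp_all add: fstar_add fstar_scale)

end

section \<open>Product states\<close>

text \<open>The product over all slots, restricted to those that may differ from
  \<open>\<omega> i 1 = 1\<close>.\<close>

definition pform :: "(nat \<Rightarrow> 'a \<Rightarrow> complex) \<Rightarrow> (nat \<Rightarrow> 'a) \<Rightarrow> (nat \<Rightarrow> 'a::unital_cstar_algebra) \<Rightarrow> complex"
  where "pform \<omega> g h = (\<Prod>i | g i \<noteq> 1 \<or> h i \<noteq> 1. \<omega> i (star (g i) * h i))"

definition form :: "(nat \<Rightarrow> 'a \<Rightarrow> complex) \<Rightarrow> 'a::unital_cstar_algebra tensor \<Rightarrow> 'a tensor \<Rightarrow> complex"
  where "form \<omega> x y = tlift (\<lambda>c z. cnj c *\<^sub>C z) (\<lambda>g. tlift (*\<^sub>C) (pform \<omega> g) y) x"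

lemma state_semi_inner:
  assumes "state \<omega>"
  shows "semi_inner (\<lambda>a b. \<omega> (star a * b))"
proof -
  have lin: "\<omega> (x + y) = \<omega> x + \<omega> y" "\<omega> (c *\<^sub>C x) = c * \<omega> x" for x y c
    using assms by (auto simp: state_def cfunctional_iff)
  show ?thesis
    by unfold_locales
      (use assms in \<open>auto simp: lin distrib_left distrib_right star_add star_scaleC mult_scaleC_left
        mult_scaleC_right state_def complex_nonneg_Reals_iff\<close>)
qed

lemma tensor_as_sum: "x = (\<Sum>xs\<in>Poly_Mapping.keys (rep_tensor x).
    Poly_Mapping.lookup (rep_tensor x) xs *\<^sub>C tens xs)"
proof -
  have "tlift (*\<^sub>C) tf x = x"
    by (rule clinear_tensor_eqI[OF tlift_linear[OF vector_space_scaleC multilin_tf] clinear_id])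
      (rule tlift_tf[OF vector_space_scaleC multilin_tf])
  then show ?thesis by (simp add: tlift_def fext_def tens_eq_tf)
qed

lemma fin_slot: "slot_ok u \<Longrightarrow> fin g \<Longrightarrow> fin (\<lambda>i. u i (g i))"
  by (rule fin_map) (auto simp: slot_ok_def)

locale state_sequence =
  fixes \<omega> :: "nat \<Rightarrow> 'a::unital_cstar_algebra \<Rightarrow> complex"
  assumes states: "state (\<omega> i)"
begin

lemma st_one [simp]: "\<omega> i 1 = 1" and st_add: "\<omega> i (a + b) = \<omega> i a + \<omega> i b"
  and st_scale: "\<omega> i (c *\<^sub>C a) = c * \<omega> i a"
  using states[of i] by (auto simp: state_def cfunctional_iff)

lemma st_zero [simp]: "\<omega> i 0 = 0"
  using st_scale[of i 0 0] by simp

lemma pform_eq: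
  assumes "\<And>i. i \<ge> n \<Longrightarrow> g i = 1" "\<And>i. i \<ge> n \<Longrightarrow> h i = 1"
  shows "pform \<omega> g h = (\<Prod>i<n. \<omega> i (star (g i) * h i))"
  unfolding pform_def
  by (rule prod.mono_neutral_left) (use assms in \<open>auto simp flip: not_le\<close>)

lemma pform_upd_right:
  assumes "\<And>i. i \<ge> n \<Longrightarrow> g i = 1" "\<And>i. i \<ge> n \<Longrightarrow> h i = 1" "j < n"
  shows "pform \<omega> g (h(j := a)) =
    \<omega> j (star (g j) * a) * (\<Prod>i\<in>{..<n} - {j}. \<omega> i (star (g i) * h i))"
proof -
  have "pform \<omega> g (h(j := a)) = (\<Prod>i<n. \<omega> i (star (g i) * (h(j := a)) i))"
    by (rule pform_eq) (use assms in auto)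
  also have "\<dots> = \<omega> j (star (g j) * (h(j := a)) j) *
      (\<Prod>i\<in>{..<n} - {j}. \<omega> i (star (g i) * (h(j := a)) i))"
    by (rule prod.remove) (use assms in auto)
  finally show ?thesis by simp
qed

lemma pform_upd_left:
  assumes "\<And>i. i \<ge> n \<Longrightarrow> g i = 1" "\<And>i. i \<ge> n \<Longrightarrow> h i = 1" "j < n"
  shows "pform \<omega> (g(j := a)) h =
    \<omega> j (star a * h j) * (\<Prod>i\<in>{..<n} - {j}. \<omega> i (star (g i) * h i))"
proof -
  have "pform \<omega> (g(j := a)) h = (\<Prod>i<n. \<omega> i (star ((g(j := a)) i) * h i))"
    by (rule pform_eq) (use assms in auto)
  also have "\<dots> = \<omega> j (star ((g(j := a)) j) * h j) *
      (\<Prod>i\<in>{..<n} - {j}. \<omega> i (star ((g(j := a)) i) * h i))"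
    by (rule prod.remove) (use assms in auto)
  finally show ?thesis by simp
qed

lemma fin_common_above:
  assumes "fin g" "fin h"
  obtains n where "\<And>i. i \<ge> n \<Longrightarrow> g i = 1" "\<And>i. i \<ge> n \<Longrightarrow> h i = 1" "j < n"
proof -
  obtain n where "\<And>i. i \<ge> n \<Longrightarrow> g i = 1" "\<And>i. i \<ge> n \<Longrightarrow> h i = 1"
    using fin_common assms by blast
  then show ?thesis by (intro that[of "max n (Suc j)"]) auto
qed

lemma multilin_pform_right:
  assumes g: "fin g"
  shows "multilin (*\<^sub>C) (pform \<omega> g)"
proof (rule multilinI)
  fix h :: "nat \<Rightarrow> 'a" and j a b c assume h: "fin h"
  obtain n where n: "\<And>i. i \<ge> n \<Longrightarrow> g i = 1" "\<And>i. i \<ge> n \<Longrightarrow> h i = 1" "j < n"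
    using fin_common_above[OF g h, of j] by blast
  show "pform \<omega> g (h(j := a + b)) = pform \<omega> g (h(j := a)) + pform \<omega> g (h(j := b))"
    by (simp only: pform_upd_right[OF n] distrib_left distrib_right st_add)
  show "pform \<omega> g (h(j := c *\<^sub>C a)) = c *\<^sub>C pform \<omega> g (h(j := a))"
    by (simp only: pform_upd_right[OF n] scaleC_complex_def mult_scaleC_right st_scale mult.assoc)
qed

lemma multilin_pform_left:
  "multilin (\<lambda>c z. cnj c *\<^sub>C z) (\<lambda>g. tlift (*\<^sub>C) (pform \<omega> g) y)"
proof (rule multilinI)
  fix g :: "nat \<Rightarrow> 'a" and j a b c assume g: "fin g"
  let ?T = "\<lambda>g. tlift (*\<^sub>C) (pform \<omega> g)"
  have addT: "?T g (x + y) = ?T g x + ?T g y" and scT: "?T g (c *\<^sub>C x) = c *\<^sub>C ?T g x"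
    if "fin g" for g c x y
    using tlift_linear[OF vector_space_scaleC multilin_pform_right[OF that]]
    by (auto simp: clinear_iff)
  have tT: "?T g (tf h) = pform \<omega> g h" if "fin g" "fin h" for g h
    by (rule tlift_tf[OF vector_space_scaleC multilin_pform_right]) (use that in auto)
  have "?T (g(j := a + b)) y = ?T (g(j := a)) y + ?T (g(j := b)) y \<and>
      ?T (g(j := c *\<^sub>C a)) y = cnj c *\<^sub>C ?T (g(j := a)) y"
  proof (induction y rule: tensor_induct)
    case (tf h)
    obtain n where n: "\<And>i. i \<ge> n \<Longrightarrow> g i = 1" "\<And>i. i \<ge> n \<Longrightarrow> h i = 1" "j < n"
      using fin_common_above[OF g tf, of j] by blast
    have *: "?T (g(j := a)) (tf h) =
        \<omega> j (star a * h j) * (\<Prod>i\<in>{..<n} - {j}. \<omega> i (star (g i) * h i))" for a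
      by (simp only: tT g tf fin_upd pform_upd_left[OF n])
    show ?case unfolding *
      by (simp add: scaleC_complex_def star_add star_scaleC distrib_right st_add mult_scaleC_left
          st_scale)
  next
    case (add x y)
    then show ?case using addT g by (simp add: scaleC_add_right)
  next
    case (scale d x)
    then show ?case using scT g by (simp add: scaleC_add_right scaleC_scaleC mult.commute)
  qed
  then show "?T (g(j := a + b)) y = ?T (g(j := a)) y + ?T (g(j := b)) y"
    and "?T (g(j := c *\<^sub>C a)) y = cnj c *\<^sub>C ?T (g(j := a)) y"
    by auto
qed

lemma form_left: "fin g \<Longrightarrow> form \<omega> (tf g) y = tlift (*\<^sub>C) (pform \<omega> g) y"
  unfolding form_def by (rule tlift_tf[OF vector_space_cnj_scaleC multilin_pform_left])

lemma form_tf: "fin g \<Longrightarrow> fin h \<Longrightarrow> form \<omega> (tf g) (tf h) = pform \<omega> g h"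
  unfolding form_left by (rule tlift_tf[OF vector_space_scaleC multilin_pform_right])

lemma form_add_left: "form \<omega> (x + y) z = form \<omega> x z + form \<omega> y z"
  and form_scale_left: "form \<omega> (c *\<^sub>C x) z = cnj c * form \<omega> x z"
  using tlift_linear[OF vector_space_cnj_scaleC multilin_pform_left[of z]]
  unfolding linear_scaleC_iff[OF vector_space_cnj_scaleC] form_def[symmetric]
  by (simp_all add: scaleC_complex_def)

lemma clinear_form: "clinear (form \<omega> x)"
proof (induction x rule: tensor_induct)
  case (tf g)
  have "form \<omega> (tf g) = tlift (*\<^sub>C) (pform \<omega> g)" using form_left[OF tf] by blast
  then show ?case
    using tlift_linear[OF vector_space_scaleC multilin_pform_right[OF tf]] by simp
qed (unfold clinear_iff, simp_all add: form_add_left form_scale_left scaleC_complex_def algebra_simps)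

lemma form_add_right: "form \<omega> x (y + z) = form \<omega> x y + form \<omega> x z"
  and form_scale_right: "form \<omega> x (c *\<^sub>C y) = c * form \<omega> x y"
  using clinear_form[of x] unfolding clinear_iff by (simp_all add: scaleC_complex_def)

lemma form_sum_left: "form \<omega> (sum f I) y = (\<Sum>i\<in>I. form \<omega> (f i) y)"
  using form_scale_left[of 0 0 y]
  by (induction I rule: infinite_finite_induct) (auto simp: form_add_left)

lemma form_sum_right: "form \<omega> x (sum f I) = (\<Sum>i\<in>I. form \<omega> x (f i))"
  by (rule clinear_sum[OF clinear_form])

text \<open>One slot is added at a time: multiplying a positive kernel by the Gram matrix of slot
  \<open>n\<close> keeps it positive. The empty product leaves the square of the modulus of
  \<open>sum c K\<close>.\<close>

lemma kernel_nonneg: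
  assumes "finite K"
  shows "(\<Sum>k\<in>K. \<Sum>l\<in>K. cnj (c k) * c l * (\<Prod>i<n. \<omega> i (star (g k i) * g l i))) \<in> \<real>\<^sub>\<ge>\<^sub>0"
proof (induction n arbitrary: c)
  case 0
  have "(\<Sum>k\<in>K. \<Sum>l\<in>K. cnj (c k) * c l) = cnj (sum c K) * sum c K"
    by (simp add: sum_product)
  also have "\<dots> = complex_of_real ((cmod (sum c K))\<^sup>2)"
    by (simp add: complex_norm_square mult.commute del: of_real_power)
  finally show ?case by simp
next
  case (Suc n)
  interpret semi_inner "\<lambda>a b. \<omega> n (star a * b)" by (rule state_semi_inner[OF states])
  have "(\<Sum>k\<in>K. \<Sum>l\<in>K. cnj (c k) * c l *
      ((\<Prod>i<n. \<omega> i (star (g k i) * g l i)) * \<omega> n (star (g k n) * g l n))) \<in> \<real>\<^sub>\<ge>\<^sub>0"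
    by (rule schur_product[OF assms Suc.IH])
  then show ?case by simp
qed

lemma form_nonneg: "form \<omega> x x \<in> \<real>\<^sub>\<ge>\<^sub>0"
proof -
  define K where "K = Poly_Mapping.keys (rep_tensor x)"
  define c where "c = Poly_Mapping.lookup (rep_tensor x)"
  \<comment> \<open>Any common bound on the lengths will do; the sum avoids a maximum over a
    possibly empty set.\<close>
  define n where "n = (\<Sum>xs\<in>K. length xs)"
  have K: "finite K" by (simp add: K_def)
  have x: "x = (\<Sum>xs\<in>K. c xs *\<^sub>C tens xs)"
    unfolding K_def c_def by (rule tensor_as_sum)
  have one: "nth_default 1 xs i = (1 :: 'a)" if "xs \<in> K" "n \<le> i" for xs i
  proof -
    have "length xs \<le> n" unfolding n_def by (rule member_le_sum) (use that K in auto)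
    then show ?thesis using that by (simp add: nth_default_def)
  qed
  have "form \<omega> (tens xs) (tens ys) = (\<Prod>i<n. \<omega> i (star (nth_default 1 xs i) * nth_default 1 ys i))"
    if "xs \<in> K" "ys \<in> K" for xs ys
    unfolding tens_eq_tf form_tf[OF fin_nth_default fin_nth_default]
    by (rule pform_eq) (use that one in auto)
  then have "form \<omega> x x = (\<Sum>k\<in>K. \<Sum>l\<in>K. cnj (c k) * c l *
      (\<Prod>i<n. \<omega> i (star (nth_default 1 k i) * nth_default 1 l i)))"
    by (subst (1 2) x, unfold form_sum_left, unfold form_scale_left form_sum_right form_scale_right)
      (simp add: sum_distrib_left mult_ac)
  then show ?thesis using kernel_nonneg[OF K, where c = c and n = n and g = "nth_default 1"] by simp
qed

sublocale semi_inner "form \<omega>"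
  by unfold_locales
    (simp_all add: form_add_left form_add_right form_scale_left form_scale_right form_nonneg)

lemma form_one_tf:
  assumes "\<And>i. i \<ge> n \<Longrightarrow> g i = 1"
  shows "form \<omega> tunit (tf g) = (\<Prod>i<n. \<omega> i (g i))"
proof -
  have "fin g" using assms by (auto simp: fin_def)
  then show ?thesis
    unfolding tunit_eq_tf by (simp add: form_tf) (subst pform_eq[of n], use assms in auto)
qed

text \<open>Applied with \<open>u j\<close> and \<open>u' j\<close> the left multiplications by \<open>a\<close> and by a square root of
  \<open>r\<^sup>2 - a\<^sup>* a\<close>.\<close>

lemma slotop_bound:
  assumes u: "slot_ok u" "slot_ok u'" and r: "0 \<le> r"
    and inv: "\<And>i a b. i \<noteq> j \<Longrightarrow> \<omega> i (star (u i a) * u i b) = \<omega> i (star a * b)"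
    and eq: "\<And>i. i \<noteq> j \<Longrightarrow> u' i = u i"
    and sum: "\<And>a b. \<omega> j (star (u j a) * u j b) + \<omega> j (star (u' j a) * u' j b) =
      complex_of_real (r\<^sup>2) * \<omega> j (star a * b)"
  shows "nrm (slotop u x) \<le> r * nrm x"
proof -
  note lin = clinear_add[OF clinear_slotop[OF u(1)]] clinear_scale[OF clinear_slotop[OF u(1)]]
    clinear_add[OF clinear_slotop[OF u(2)]] clinear_scale[OF clinear_slotop[OF u(2)]]
  \<comment> \<open>Outside slot \<open>j\<close> both operators preserve the slot forms, and in
    slot \<open>j\<close> they complement each other to \<open>r\<^sup>2\<close>. The identity is
    proved for two arguments since it then passes to sums; its diagonal bounds the first operator,
    the second summand being nonnegative.\<close>
  have "form \<omega> (slotop u x) (slotop u y) + form \<omega> (slotop u' x) (slotop u' y) =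
      complex_of_real (r\<^sup>2) * form \<omega> x y" for x y
  proof (induction x rule: tensor_induct)
    case (tf g)
    note g = tf
    show ?case
    proof (induction y rule: tensor_induct)
      case (tf h)
      have fin: "fin (\<lambda>i. u i (g i))" "fin (\<lambda>i. u i (h i))" "fin (\<lambda>i. u' i (g i))" "fin (\<lambda>i. u' i (h i))"
        by (rule fin_slot[OF u(1) g], rule fin_slot[OF u(1) tf], rule fin_slot[OF u(2) g],
            rule fin_slot[OF u(2) tf])
      obtain n where n: "\<And>i. i \<ge> n \<Longrightarrow> g i = 1" "\<And>i. i \<ge> n \<Longrightarrow> h i = 1" "j < n"
        using fin_common_above[OF g tf, of j] by blast
      obtain m m' where m: "\<And>i. i \<ge> m \<Longrightarrow> u i 1 = 1" "\<And>i. i \<ge> m' \<Longrightarrow> u' i 1 = 1"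
        using u by (auto simp: slot_ok_def)
      define N where "N = max n (max m m')"
      have j: "j < N" using n by (simp add: N_def)
      let ?P = "\<Prod>i\<in>{..<N} - {j}. \<omega> i (star (g i) * h i)"
      have "pform \<omega> (\<lambda>i. u i (g i)) (\<lambda>i. u i (h i)) =
          (\<Prod>i<N. \<omega> i (star (u i (g i)) * u i (h i)))"
        by (rule pform_eq) (use n m in \<open>auto simp: N_def\<close>)
      also have "\<dots> = \<omega> j (star (u j (g j)) * u j (h j)) *
          (\<Prod>i\<in>{..<N} - {j}. \<omega> i (star (u i (g i)) * u i (h i)))"
        by (rule prod.remove) (use j in auto)
      also have "(\<Prod>i\<in>{..<N} - {j}. \<omega> i (star (u i (g i)) * u i (h i))) = ?P"
        by (rule prod.cong) (auto simp: inv)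
      finally have 1: "pform \<omega> (\<lambda>i. u i (g i)) (\<lambda>i. u i (h i)) =
          \<omega> j (star (u j (g j)) * u j (h j)) * ?P" .
      have "pform \<omega> (\<lambda>i. u' i (g i)) (\<lambda>i. u' i (h i)) =
          (\<Prod>i<N. \<omega> i (star (u' i (g i)) * u' i (h i)))"
        by (rule pform_eq) (use n m in \<open>auto simp: N_def\<close>)
      also have "\<dots> = \<omega> j (star (u' j (g j)) * u' j (h j)) *
          (\<Prod>i\<in>{..<N} - {j}. \<omega> i (star (u' i (g i)) * u' i (h i)))"
        by (rule prod.remove) (use j in auto)
      also have "(\<Prod>i\<in>{..<N} - {j}. \<omega> i (star (u' i (g i)) * u' i (h i))) = ?P"
        by (rule prod.cong) (auto simp: inv eq)
      finally have 2: "pform \<omega> (\<lambda>i. u' i (g i)) (\<lambda>i. u' i (h i)) =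
          \<omega> j (star (u' j (g j)) * u' j (h j)) * ?P" .
      have "pform \<omega> g h = (\<Prod>i<N. \<omega> i (star (g i) * h i))"
        by (rule pform_eq) (use n in \<open>auto simp: N_def\<close>)
      also have "\<dots> = \<omega> j (star (g j) * h j) * ?P"
        by (rule prod.remove) (use j in auto)
      finally have 3: "pform \<omega> g h = \<omega> j (star (g j) * h j) * ?P" .
      show ?case
        using u g tf fin
        by (simp only: slotop_tf form_tf 1 2 3 distrib_right[symmetric] sum mult.assoc[symmetric])
    next
      case (add x y)
      then show ?case by (simp add: lin form_add_right algebra_simps del: of_real_power)
    next
      case (scale c x)
      then show ?case
        by (simp add: lin form_scale_right mult.left_commute flip: distrib_left del: of_real_power)
    qed
  next
    case (add x y)
    then show ?case by (simp add: lin form_add_left algebra_simps del: of_real_power)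
  next
    case (scale c x)
    then show ?case
      by (simp add: lin form_scale_left mult.left_commute flip: distrib_left del: of_real_power)
  qed
  from this[of x x] have "(nrm (slotop u x))\<^sup>2 + (nrm (slotop u' x))\<^sup>2 = r\<^sup>2 * (nrm x)\<^sup>2"
    unfolding B_self of_real_add[symmetric] of_real_mult[symmetric] of_real_eq_iff .
  then have "(nrm (slotop u x))\<^sup>2 \<le> (r * nrm x)\<^sup>2"
    unfolding power_mult_distrib by (metis le_add_same_cancel1 zero_le_power2)
  then show ?thesis by (rule power2_le_imp_le) (simp add: r)
qed

end

section \<open>Even product states and boundedness of left multiplication\<close>

context graded
begin

definition even_seq :: "(nat \<Rightarrow> 'a \<Rightarrow> complex) \<Rightarrow> bool" where
  "even_seq \<omega> \<longleftrightarrow> (\<forall>i. even_state \<theta> (\<omega> i))"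

abbreviation fnrm where "fnrm \<omega> \<equiv> semi_inner.nrm (form \<omega>)"

lemma even_seq_states: "even_seq \<omega> \<Longrightarrow> state_sequence \<omega>"
  by unfold_locales (simp add: even_seq_def even_state_def)

lemma even_seq_theta: "even_seq \<omega> \<Longrightarrow> \<omega> i (\<theta> a) = \<omega> i a"
  unfolding even_seq_def even_state_def by (metis comp_apply)

lemma even_seq_theta_form: "even_seq \<omega> \<Longrightarrow> \<omega> i (star (\<theta> a) * \<theta> b) = \<omega> i (star a * b)"
  by (simp add: even_seq_theta flip: th_mult th_star)

lemma even_seq_odd: assumes "even_seq \<omega>" "odd a" shows "\<omega> i a = 0"
proof -
  interpret state_sequence \<omega> using assms by (rule_tac even_seq_states)
  have "\<omega> i a = \<omega> i ((-1) *\<^sub>C a)"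
    using even_seq_theta[OF assms(1), of i a] assms(2) by (simp add: odd_elem_def scaleC_minus_left)
  then show ?thesis unfolding st_scale by simp
qed

text \<open>If no slot factor vanishes, evenness forces \<open>g i\<close> and \<open>h i\<close> to
  have equal parity. Then the sign of the product coincides with that of the involution, and each
  pair of slots contributes a square.\<close>

lemma form_fstar:
  assumes "even_seq \<omega>"
  shows "form \<omega> tunit (fmul (fstar y) z) = form \<omega> y z"
proof -
  interpret state_sequence \<omega> by (rule even_seq_states[OF assms])
  show ?thesis
  proof (induction y rule: hom_tensor_induct)
    case (tf g)
    note g = tf
    show ?case
    proof (induction z rule: hom_tensor_induct)
      case (tf h)
      obtain n where n: "\<And>i. i \<ge> n \<Longrightarrow> g i = 1" "\<And>i. i \<ge> n \<Longrightarrow> h i = 1"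
        using fin_common g(1) tf(1) by blast
      let ?s = "\<Prod>j<n. \<Prod>i<j. eps \<theta> (g i) (g j)"
      let ?t = "\<Prod>i<n. \<Prod>j<i. eps \<theta> (star (g i)) (h j)"
      let ?w = "\<Prod>i<n. \<omega> i (star (g i) * h i)"
      have "fmul (fstar (tf g)) (tf h) = (?s * ?t) *\<^sub>C tf (\<lambda>i. star (g i) * h i)"
        using g tf n
        by (simp add: fstar_hom[of g n] fmul_scale_left fmul_hom[of h _ n] hom_star scaleC_scaleC)
      then have "form \<omega> tunit (fmul (fstar (tf g)) (tf h)) = ?s * ?t * ?w"
        using form_one_tf[of n "\<lambda>i. star (g i) * h i"] n by (simp add: form_scale_right)
      also have "\<dots> = ?w"
      proof (cases "?w = 0")
        case False
        then have "\<omega> i (star (g i) * h i) \<noteq> 0" if "i < n" for i using that by auto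
        then have "odd (g i) \<longleftrightarrow> odd (h i)" if i: "i < n" for i
          using even_seq_odd[OF assms, of "star (g i) * h i" i] odd_mult[of "star (g i)" "h i"] i
            g tf by (metis hom_star odd_star st_zero)
        then have "?t = (\<Prod>i<n. \<Prod>j<i. eps \<theta> (g j) (g i))"
          by (intro prod.cong refl) (auto simp: eps_def odd_star)
        then have "?s * ?t = (\<Prod>j<n. \<Prod>i<j. eps \<theta> (g i) (g j) * eps \<theta> (g i) (g j))"
          by (simp add: prod.distrib)
        also have "\<dots> = 1" by (intro prod.neutral ballI) (auto simp: eps_def)
        finally show ?thesis by simp
      qed simp
      also have "?w = form \<omega> (tf g) (tf h)"
        using g tf n by (simp add: form_tf pform_eq[of n])
      finally show ?case .
    qed (simp_all add: fmul_add_right fmul_scale_right form_add_right form_scale_right)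
  qed (simp_all add: fstar_add fstar_scale fmul_add_left fmul_scale_left form_add_right
      form_scale_right form_add_left form_scale_left)
qed

text \<open>The constant is independent of the states, which keeps the supremum in the minimal norm
  finite. Even and odd part are bounded separately; on the slots below \<open>j\<close> the odd part
  acts by \<theta>, which is isometric for even states.\<close>

lemma lmul_bounded: "\<exists>C\<ge>0. \<forall>\<omega> x. even_seq \<omega> \<longrightarrow> fnrm \<omega> (lmul j a x) \<le> C * fnrm \<omega> x"
proof -
  \<comment> \<open>Adding \<open>1\<close> supplies the strict inequality that
    \<open>cstar_complement\<close> requires.\<close>
  define r where "r = norm (ev a) + 1"
  define t where "t = norm (od a) + 1"
  have rt: "0 \<le> r" "0 \<le> t" by (simp_all add: r_def t_def)
  obtain b where b: "star (ev a) * ev a + star b * b = complex_of_real (r\<^sup>2) *\<^sub>C 1"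
    using cstar_complement[of "ev a" r] by (auto simp: r_def)
  obtain c where c: "star (od a) * od a + star c * c = complex_of_real (t\<^sup>2) *\<^sub>C 1"
    using cstar_complement[of "od a" t] by (auto simp: t_def)
  have "fnrm \<omega> (lmul j a x) \<le> (r + t) * fnrm \<omega> x" if \<omega>: "even_seq \<omega>" for \<omega> x
  proof -
    interpret state_sequence \<omega> by (rule even_seq_states[OF \<omega>])
    have sum: "\<omega> j (star (a * x) * (a * y)) + \<omega> j (star (b * x) * (b * y)) =
        complex_of_real (r\<^sup>2) * \<omega> j (star x * y)"
      if "star a * a + star b * b = complex_of_real (r\<^sup>2) *\<^sub>C 1" for a b x y and r :: real
    proof -
      have "star (a * x) * (a * y) + star (b * x) * (b * y) =
          star x * (star a * a + star b * b) * y"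
        by (simp add: star_mult algebra_simps)
      also have "\<dots> = complex_of_real (r\<^sup>2) *\<^sub>C (star x * y)"
        unfolding that by (simp add: mult_scaleC_left mult_scaleC_right)
      finally show ?thesis by (metis st_add st_scale)
    qed
    have "nrm (slotop (\<lambda>i. if i = j then (\<lambda>b. ev a * b) else (\<lambda>b. b)) x) \<le> r * nrm x"
      by (rule slotop_bound[where j = j and u' = "\<lambda>i. if i = j then (\<lambda>x. b * x) else (\<lambda>b. b)"])
        (use rt sum[OF b] in \<open>auto intro: slot_ok_upd\<close>)
    moreover have "nrm (slotop (\<lambda>i. if i < j then \<theta> else if i = j then (\<lambda>b. od a * b) else (\<lambda>b. b)) x)
        \<le> t * nrm x"
      by (rule slotop_bound[where j = j
            and u' = "\<lambda>i. if i < j then \<theta> else if i = j then (\<lambda>x. c * x) else (\<lambda>b. b)"])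
        (use rt sum[OF c] even_seq_theta_form[OF \<omega>] in \<open>auto intro: slot_ok_theta_upd\<close>)
    ultimately show ?thesis
      unfolding lmul_def by (intro order_trans[OF nrm_triangle]) (simp add: distrib_right)
  qed
  then show ?thesis using rt by (intro exI[of _ "r + t"]) auto
qed

lemma fmul_bounded: "\<exists>C\<ge>0. \<forall>\<omega> y. even_seq \<omega> \<longrightarrow> fnrm \<omega> (fmul x y) \<le> C * fnrm \<omega> y"
proof (induction x rule: emb_induct)
  case (emb j a)
  then show ?case using lmul_bounded by (simp add: fmul_emb)
next
  case (add x y)
  then obtain C D where CD: "0 \<le> C" "0 \<le> D" "\<And>\<omega> z. even_seq \<omega> \<Longrightarrow> fnrm \<omega> (fmul x z) \<le> C * fnrm \<omega> z"
    "\<And>\<omega> z. even_seq \<omega> \<Longrightarrow> fnrm \<omega> (fmul y z) \<le> D * fnrm \<omega> z"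
    by blast
  have "fnrm \<omega> (fmul (x + y) z) \<le> (C + D) * fnrm \<omega> z" if "even_seq \<omega>" for \<omega> z
  proof -
    interpret state_sequence \<omega> by (rule even_seq_states[OF that])
    show ?thesis
      using nrm_triangle[of "fmul x z" "fmul y z"] CD(3,4)[OF that, of z]
      by (simp add: fmul_add_left distrib_right)
  qed
  then show ?case using CD by (intro exI[of _ "C + D"]) auto
next
  case (scale c x)
  then obtain C where C: "0 \<le> C" "\<And>\<omega> z. even_seq \<omega> \<Longrightarrow> fnrm \<omega> (fmul x z) \<le> C * fnrm \<omega> z"
    by blast
  have "fnrm \<omega> (fmul (c *\<^sub>C x) z) \<le> (cmod c * C) * fnrm \<omega> z" if "even_seq \<omega>" for \<omega> z
  proof -
    interpret state_sequence \<omega> by (rule even_seq_states[OF that])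
    show ?thesis
      using mult_left_mono[OF C(2)[OF that, of z], of "cmod c"]
      by (simp add: fmul_scale_left nrm_scale mult.assoc)
  qed
  then show ?case using C by (intro exI[of _ "cmod c * C"]) auto
next
  case (mult x y)
  then obtain C D where CD: "0 \<le> C" "0 \<le> D" "\<And>\<omega> z. even_seq \<omega> \<Longrightarrow> fnrm \<omega> (fmul x z) \<le> C * fnrm \<omega> z"
    "\<And>\<omega> z. even_seq \<omega> \<Longrightarrow> fnrm \<omega> (fmul y z) \<le> D * fnrm \<omega> z"
    by blast
  have "fnrm \<omega> (fmul (fmul x y) z) \<le> (C * D) * fnrm \<omega> z" if "even_seq \<omega>" for \<omega> z
    using CD(3)[OF that, of "fmul y z"] mult_left_mono[OF CD(4)[OF that, of z] CD(1)]
    by (simp add: fmul_assoc mult.assoc)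
  then show ?case using CD by (intro exI[of _ "C * D"]) auto
qed

end

section \<open>The minimal norm\<close>

context graded
begin

lemma span_nfold_closed:
  "x \<in> nfold n \<Longrightarrow> y \<in> nfold n \<Longrightarrow> x + y \<in> nfold n" "x \<in> nfold n \<Longrightarrow> c *\<^sub>C x \<in> nfold n"
  "x \<in> nfold n \<Longrightarrow> y \<in> nfold n \<Longrightarrow> x - y \<in> nfold n" "0 \<in> nfold n"
  by (simp_all add: nfold_def complex_vector.span_add complex_vector.span_scale
      complex_vector.span_diff complex_vector.span_zero)

lemma tf_nfold: "(\<And>i. i \<ge> n \<Longrightarrow> g i = 1) \<Longrightarrow> tf g \<in> nfold n"
  unfolding nfold_def by (rule complex_vector.span_base, rule image_eqI, erule tf_eq_tens) auto

lemma nfold_hom_induct [consumes 1, case_names tf add scale]: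
  assumes "x \<in> nfold n"
    and tf: "\<And>g. fin g \<Longrightarrow> (\<And>i. i \<ge> n \<Longrightarrow> g i = 1) \<Longrightarrow> (\<And>i. hom (g i)) \<Longrightarrow> P (tf g)"
    and add: "\<And>x y. P x \<Longrightarrow> P y \<Longrightarrow> P (x + y)"
    and scale: "\<And>c x. P x \<Longrightarrow> P (c *\<^sub>C x)"
  shows "P x"
proof -
  have *: "P (tf g)" if "\<And>i. i \<ge> n \<Longrightarrow> g i = 1" "\<And>i. i \<ge> m \<Longrightarrow> hom (g i)" "m \<le> n" for m g
    using that
  proof (induction m arbitrary: g)
    case 0
    then show ?case using tf[of g] by (auto simp: fin_def)
  next
    case (Suc m)
    have fin: "fin g" using Suc.prems by (auto simp: fin_def)
    have "P (tf (g(m := c)))" if c: "hom c" for c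
    proof (rule Suc.IH)
      show "(g(m := c)) i = 1" if "i \<ge> n" for i using that Suc.prems by auto
      show "hom ((g(m := c)) i)" if "i \<ge> m" for i
        using Suc.prems(2)[of i] that c by (cases "i = m") auto
    qed (use Suc.prems in simp)
    then have "P (tf (g(m := ev (g m))) + tf (g(m := od (g m))))"
      by (intro add) (simp_all add: hom_ev hom_od)
    then have "P (tf (g(m := ev (g m) + od (g m))))" by (simp only: tf_upd_add[OF fin])
    then show ?case by (simp add: ev_od)
  qed
  show ?thesis
    using assms(1) unfolding nfold_def
  proof (induction rule: complex_vector.span_induct_alt)
    case base
    have "P (0 *\<^sub>C tf (\<lambda>_. 1))" by (intro scale *[of _ n]) auto
    then show ?case by simp
  next
    case (step c x y)
    then obtain xs where xs: "x = tens xs" "length xs = n" by auto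
    have "P (tens xs)"
      unfolding tens_eq_tf by (rule *[of _ n]) (use xs in \<open>auto simp: nth_default_def\<close>)
    then show ?case using step xs by (auto intro: add scale)
  qed
qed

lemma nfold_mono: "m \<le> n \<Longrightarrow> (x :: 'a tensor) \<in> nfold m \<Longrightarrow> x \<in> nfold n"
proof -
  assume mn: "m \<le> n" and "x \<in> nfold m"
  from this(2) show ?thesis
    by (induction x rule: nfold_hom_induct) (use mn in \<open>auto intro: tf_nfold span_nfold_closed\<close>)
qed

lemma nfold_exhaust: "\<exists>n. (x :: 'a tensor) \<in> nfold n"
proof (induction x rule: tensor_induct)
  case (tf g)
  then obtain n where "\<forall>i\<ge>n. g i = 1" by (auto simp: fin_def)
  then show ?case by (intro exI[of _ n] tf_nfold) auto
next
  case (add x y)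
  then obtain m n where "x \<in> nfold m" "y \<in> nfold n" by blast
  then have "x \<in> nfold (max m n)" "y \<in> nfold (max m n)"
    using nfold_mono[of m "max m n" x] nfold_mono[of n "max m n" y] by simp_all
  then show ?case using span_nfold_closed(1) by blast
qed (use span_nfold_closed(2) in blast)

lemma fmul_nfold: "x \<in> nfold n \<Longrightarrow> y \<in> nfold n \<Longrightarrow> fmul x y \<in> nfold n"
proof (induction x rule: nfold_hom_induct)
  case (tf g)
  from tf(4) show ?case
  proof (induction y rule: nfold_hom_induct)
    case (tf h)
    then show ?case
      using \<open>\<And>i. hom (g i)\<close> \<open>\<And>i. i \<ge> n \<Longrightarrow> g i = 1\<close>
      by (simp add: fmul_hom[of h g n] span_nfold_closed(2) tf_nfold)
  qed (simp_all add: fmul_add_right fmul_scale_right span_nfold_closed)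
qed (simp_all add: fmul_add_left fmul_scale_left span_nfold_closed)

lemma fstar_nfold: "x \<in> nfold n \<Longrightarrow> fstar x \<in> nfold n"
proof (induction x rule: nfold_hom_induct)
  case (tf g)
  then show ?case by (simp add: fstar_hom[of g n] span_nfold_closed(2) tf_nfold)
qed (simp_all add: fstar_add fstar_scale span_nfold_closed)

text \<open>The slots from \<open>n\<close> on are filled with \<open>\<omega> 0\<close>, which is
  an even state because \<open>1 \<le> n\<close>. Elements of \<open>nfold n\<close> are
  \<open>1\<close> there and do not see the choice.\<close>

lemma product_state_form:
  assumes "product_state \<theta> n \<phi>" "1 \<le> n"
  obtains \<omega> where "even_seq \<omega>" "\<And>x. x \<in> nfold n \<Longrightarrow> \<phi> x = form \<omega> tunit x"
proof -
  obtain \<omega> where \<omega>: "\<forall>i<n. even_state \<theta> (\<omega> i)"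
    "\<forall>as. length as = n \<longrightarrow> \<phi> (tens as) = (\<Prod>i<n. \<omega> i (as ! i))"
    and \<phi>: "cfunctional \<phi>"
    using assms(1) by (auto simp: product_state_def)
  define \<omega>' where "\<omega>' i = (if i < n then \<omega> i else \<omega> 0)" for i
  have even_seq: "even_seq \<omega>'" using \<omega>(1) assms(2) by (auto simp: even_seq_def \<omega>'_def)
  interpret state_sequence \<omega>' by (rule even_seq_states[OF even_seq])
  have "\<phi> x = form \<omega>' tunit x" if "x \<in> nfold n" for x
    using that
  proof (induction x rule: nfold_hom_induct)
    case (tf g)
    have "\<phi> (tf g) = (\<Prod>i<n. \<omega> i (map g [0..<n] ! i))"
      using \<omega>(2) tf by (simp add: tf_eq_tens[of n] del: nth_map)
    also have "\<dots> = (\<Prod>i<n. \<omega>' i (g i))" by (intro prod.cong) (auto simp: \<omega>'_def)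
    also have "\<dots> = form \<omega>' tunit (tf g)" using tf by (simp add: form_one_tf[of n])
    finally show ?case .
  qed (use \<phi> in \<open>auto simp: cfunctional_iff form_add_right form_scale_right\<close>)
  then show ?thesis using even_seq that by blast
qed

lemma form_product_state:
  assumes "even_seq \<omega>"
  shows "product_state \<theta> n (form \<omega> tunit)"
proof -
  interpret state_sequence \<omega> by (rule even_seq_states[OF assms])
  have "form \<omega> tunit (tens as) = (\<Prod>i<n. \<omega> i (as ! i))" if "length as = n" for as
    unfolding tens_eq_tf using that
    by (subst form_one_tf[of n]) (auto simp: nth_default_def intro!: prod.cong)
  moreover have "cfunctional (form \<omega> tunit)"
    by (simp add: cfunctional_iff form_add_right form_scale_right)
  ultimately show ?thesis
    unfolding product_state_def using assms by (auto simp: even_seq_def)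
qed

lemma gns_seminorm_eq:
  assumes "even_seq \<omega>" "\<And>x. x \<in> nfold n \<Longrightarrow> \<phi> x = form \<omega> tunit x" "y \<in> nfold n"
  shows "gns_seminorm \<theta> \<phi> y = fnrm \<omega> y"
proof -
  interpret state_sequence \<omega> by (rule even_seq_states[OF assms(1)])
  show ?thesis
    using assms by (simp add: gns_seminorm_def nrm_def fermi_mult_eq fermi_star_eq fmul_nfold
        fstar_nfold form_fstar)
qed

text \<open>A common bound for the GNS operators of \<open>x\<close>, tested on the dense image of
  \<open>nfold n\<close> so that no completion enters.\<close>

definition nbound :: "nat \<Rightarrow> 'a tensor \<Rightarrow> real \<Rightarrow> bool" where
  "nbound n x C \<longleftrightarrow> 0 \<le> C \<and>
     (\<forall>\<omega> y. even_seq \<omega> \<longrightarrow> y \<in> nfold n \<longrightarrow> fnrm \<omega> (fmul x y) \<le> C * fnrm \<omega> y)"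

context
  fixes n :: nat and \<phi> \<omega>
  assumes \<omega>: "even_seq \<omega>" and \<phi>: "\<And>x. x \<in> nfold n \<Longrightarrow> \<phi> x = form \<omega> tunit x"
begin

interpretation state_sequence \<omega> by (rule even_seq_states[OF \<omega>])

lemma gns_seminormed: "seminormed (nfold n) (gns_seminorm \<theta> \<phi>)"
proof
  fix x y :: "'a tensor" assume "x \<in> nfold n" "y \<in> nfold n"
  then show "gns_seminorm \<theta> \<phi> (x - y) \<le> gns_seminorm \<theta> \<phi> x + gns_seminorm \<theta> \<phi> y"
    using nrm_triangle[of x "- y"]
    by (simp add: gns_seminorm_eq[OF \<omega> \<phi>] span_nfold_closed nrm_minus)
qed (simp_all add: span_nfold_closed gns_seminorm_eq[OF \<omega> \<phi>])

interpretation seminormed "nfold n" "gns_seminorm \<theta> \<phi>" by (rule gns_seminormed)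

lemma gns_opnorm_le:
  assumes x: "x \<in> nfold n" and C: "0 \<le> C"
    "\<And>y. y \<in> nfold n \<Longrightarrow> nrm (fmul x y) \<le> C * nrm y"
  shows "gns_opnorm \<theta> n \<phi> x \<le> ennreal C"
  unfolding gns_opnorm_def
proof (rule SUP_least, clarify)
  fix h assume h: "h \<in> gns_space \<theta> n \<phi>" "completion_norm (gns_seminorm \<theta> \<phi>) h \<le> 1"
  let ?p = "gns_seminorm \<theta> \<phi>"
  obtain s where s: "cauchy_seq (nfold n) ?p s" "h = completion_class (nfold n) ?p s"
    using h(1) by (auto simp: gns_space_def completion_def)
  have f: "\<And>y. y \<in> nfold n \<Longrightarrow> fmul x y \<in> nfold n"
    "\<And>y z. y \<in> nfold n \<Longrightarrow> z \<in> nfold n \<Longrightarrow> fmul x (y - z) = fmul x y - fmul x z"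
    "\<And>y. y \<in> nfold n \<Longrightarrow> ?p (fmul x y) \<le> C * ?p y"
    using C x by (auto simp: fmul_nfold clinear_diff[OF clinear_fmul] gns_seminorm_eq[OF \<omega> \<phi>])
  have fs: "cauchy_seq (nfold n) ?p (fmul x \<circ> s)" by (rule cauchy_seq_map[OF f s(1)])
  obtain r where r: "(\<lambda>k. ?p (s k)) \<longlonglongrightarrow> r"
    using cauchy_norm_convergent[OF s(1)] by (auto simp: convergent_def)
  obtain r' where r': "(\<lambda>k. ?p ((fmul x \<circ> s) k)) \<longlonglongrightarrow> r'"
    using cauchy_norm_convergent[OF fs] by (auto simp: convergent_def)
  have "completion_norm ?p h = r" unfolding s(2) by (rule completion_norm_class[OF s(1) r])
  then have "r \<le> 1" using h(2) by simp
  have "r' \<le> C * r"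
    by (rule LIMSEQ_le[OF r' tendsto_mult_left[OF r]])
      (use f(3) cauchy_seq_mem[OF s(1)] in auto)
  also have "\<dots> \<le> C" using \<open>r \<le> 1\<close> C(1) by (simp add: mult_left_le)
  finally have "r' \<le> C" .
  have "gns_rep \<theta> n \<phi> x h = completion_class (nfold n) ?p (fmul x \<circ> s)"
    unfolding gns_rep_def fermi_mult_eq s(2) by (rule completion_map_class[OF f s(1)])
  then have "completion_norm ?p (gns_rep \<theta> n \<phi> x h) = r'"
    by (simp only: completion_norm_class[OF fs r'])
  then show "ennreal (completion_norm ?p (gns_rep \<theta> n \<phi> x h)) \<le> ennreal C"
    using \<open>r' \<le> C\<close> by (simp add: ennreal_leI)
qed

lemma gns_opnorm_bound:
  assumes x: "x \<in> nfold n" and D: "gns_opnorm \<theta> n \<phi> x \<le> ennreal D" "0 \<le> D" and y: "y \<in> nfold n"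
  shows "nrm (fmul x y) \<le> D * nrm y"
proof -
  let ?p = "gns_seminorm \<theta> \<phi>"
  obtain C where C: "0 \<le> C" "\<And>y. nrm (fmul x y) \<le> C * nrm y"
    using fmul_bounded[of x] \<omega> by blast
  show ?thesis
  proof (cases "nrm y = 0")
    \<comment> \<open>A null vector cannot be normalised; the a priori bound shows that its image is
      null as well.\<close>
    case True
    then show ?thesis using C(2)[of y] by simp
  next
    case False
    define b where "b = nrm y"
    have b: "0 < b" using False by (simp add: b_def less_le)
    define z where "z = complex_of_real (1 / b) *\<^sub>C y"
    have z: "z \<in> nfold n" using y by (simp add: z_def span_nfold_closed)
    have nz: "nrm z = 1" using b by (simp add: z_def nrm_scale norm_divide b_def)
    have nxz: "nrm (fmul x z) = nrm (fmul x y) / b"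
      using b by (simp add: z_def nrm_scale fmul_scale_right norm_divide)
    have f: "\<And>y. y \<in> nfold n \<Longrightarrow> fmul x y \<in> nfold n"
      "\<And>y z. y \<in> nfold n \<Longrightarrow> z \<in> nfold n \<Longrightarrow> fmul x (y - z) = fmul x y - fmul x z"
      "\<And>y. y \<in> nfold n \<Longrightarrow> ?p (fmul x y) \<le> C * ?p y"
      using C x by (auto simp: fmul_nfold clinear_diff[OF clinear_fmul] gns_seminorm_eq[OF \<omega> \<phi>])
    let ?h = "completion_class (nfold n) ?p (\<lambda>_. z)"
    have cz: "cauchy_seq (nfold n) ?p (\<lambda>_. z)" by (rule cauchy_seq_const[OF z])
    have cxz: "cauchy_seq (nfold n) ?p (\<lambda>_. fmul x z)"
      by (rule cauchy_seq_const) (use x z fmul_nfold in auto)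
    have "completion_norm ?p ?h = 1"
      by (rule completion_norm_class[OF cz]) (simp add: gns_seminorm_eq[OF \<omega> \<phi> z] nz)
    moreover have "?h \<in> gns_space \<theta> n \<phi>" using cz by (auto simp: gns_space_def completion_def)
    ultimately have "ennreal (completion_norm ?p (gns_rep \<theta> n \<phi> x ?h)) \<le> gns_opnorm \<theta> n \<phi> x"
      unfolding gns_opnorm_def by (intro SUP_upper) simp
    moreover have "gns_rep \<theta> n \<phi> x ?h = completion_class (nfold n) ?p (fmul x \<circ> (\<lambda>_. z))"
      unfolding gns_rep_def fermi_mult_eq by (rule completion_map_class[OF f cz])
    moreover have "completion_norm ?p (completion_class (nfold n) ?p (\<lambda>_. fmul x z)) = nrm (fmul x z)"
      by (rule completion_norm_class[OF cxz])
        (simp add: gns_seminorm_eq[OF \<omega> \<phi>] fmul_nfold x z)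
    ultimately have "ennreal (nrm (fmul x z)) \<le> ennreal D"
      using D(1) by (simp add: comp_def)
    then have "nrm (fmul x y) / b \<le> D" using D(2) nxz by simp
    then show ?thesis using b by (simp add: field_simps b_def)
  qed
qed

end

lemma opnorm_le_of_nbound:
  assumes "1 \<le> n" "x \<in> nfold n" "nbound n x C"
  shows "(SUP \<phi>\<in>{\<phi>. product_state \<theta> n \<phi>}. gns_opnorm \<theta> n \<phi> x) \<le> ennreal C"
proof (rule SUP_least, clarify)
  fix \<phi> assume "product_state \<theta> n \<phi>"
  then obtain \<omega> where \<omega>: "even_seq \<omega>" "\<And>x. x \<in> nfold n \<Longrightarrow> \<phi> x = form \<omega> tunit x"
    using product_state_form assms(1) by blast
  show "gns_opnorm \<theta> n \<phi> x \<le> ennreal C"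
    by (rule gns_opnorm_le[OF \<omega> assms(2)]) (use assms(3) \<omega>(1) in \<open>auto simp: nbound_def\<close>)
qed

lemma min_norm_le:
  assumes "1 \<le> n" "x \<in> nfold n" "nbound n x C"
  shows "min_norm \<theta> n x \<le> C"
proof -
  have "0 \<le> C" using assms(3) by (simp add: nbound_def)
  then show ?thesis
    unfolding min_norm_def using enn2real_mono[OF opnorm_le_of_nbound[OF assms]] by simp
qed

lemma nbound_exists: obtains C where "\<And>n. nbound n x C"
  using fmul_bounded[of x] unfolding nbound_def by blast

lemma nbound_min_norm:
  assumes n: "1 \<le> n" and x: "x \<in> nfold n"
  shows "nbound n x (min_norm \<theta> n x)"
  unfolding nbound_def
proof (intro conjI allI impI)
  show nn: "0 \<le> min_norm \<theta> n x" by (simp add: min_norm_def)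
  fix \<omega> and y :: "'a tensor" assume \<omega>: "even_seq \<omega>" and y: "y \<in> nfold n"
  let ?S = "SUP \<phi>\<in>{\<phi>. product_state \<theta> n \<phi>}. gns_opnorm \<theta> n \<phi> x"
  \<comment> \<open>Since \<open>enn2real\<close> sends infinity to \<open>0\<close>, the supremum
    has to be shown finite before it can be identified with \<open>min_norm\<close>.\<close>
  obtain C where "nbound n x C" using nbound_exists by blast
  then have "?S \<le> ennreal C" by (rule opnorm_le_of_nbound[OF n x])
  then have "?S < top" using ennreal_less_top le_less_trans by blast
  then have "?S = ennreal (min_norm \<theta> n x)" by (simp add: min_norm_def)
  moreover have "gns_opnorm \<theta> n (form \<omega> tunit) x \<le> ?S"
    by (rule SUP_upper) (simp add: form_product_state \<omega>)
  ultimately show "fnrm \<omega> (fmul x y) \<le> min_norm \<theta> n x * fnrm \<omega> y"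
    by (intro gns_opnorm_bound[OF \<omega> _ x _ nn y, where \<phi> = "form \<omega> tunit"]) auto
qed

lemma nbound_antimono: "nbound n x C \<Longrightarrow> m \<le> n \<Longrightarrow> nbound m x C"
  by (auto simp: nbound_def intro: nfold_mono)

text \<open>Larger \<open>n\<close> admit more test vectors, so the norms increase once
  \<open>x\<close> lies in \<open>nfold n\<close>, and the uniform bound on left multiplication
  bounds them. The shift by \<open>m\<close> discards the meaningless values before that.\<close>

lemma min_norm_tendsto:
  assumes x: "x \<in> nfold m" and m: "1 \<le> m"
  shows "(\<lambda>n. min_norm \<theta> n x) \<longlonglongrightarrow> fermi_norm \<theta> x"
    and "\<And>n. n \<ge> m \<Longrightarrow> min_norm \<theta> n x \<le> fermi_norm \<theta> x"
proof -
  have xn: "x \<in> nfold n" if "n \<ge> m" for n using that x by (rule nfold_mono)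
  obtain C where C: "\<And>n. nbound n x C" using nbound_exists by blast
  define f where "f n = min_norm \<theta> (n + m) x" for n
  have f: "incseq f"
    unfolding f_def
    by (rule incseq_SucI, rule min_norm_le)
      (use m xn in \<open>auto intro!: nbound_antimono[OF nbound_min_norm]\<close>)
  moreover have "f n \<le> C" for n
    unfolding f_def by (rule min_norm_le) (use m xn C in auto)
  ultimately obtain L where L: "f \<longlonglongrightarrow> L" "\<forall>i. f i \<le> L"
    using incseq_convergent[of f C] by blast
  then have "(\<lambda>n. min_norm \<theta> n x) \<longlonglongrightarrow> L" unfolding f_def by (rule_tac LIMSEQ_offset)
  moreover from this have "fermi_norm \<theta> x = L" unfolding fermi_norm_def by (rule limI)
  ultimately show "(\<lambda>n. min_norm \<theta> n x) \<longlonglongrightarrow> fermi_norm \<theta> x" by simp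
  show "min_norm \<theta> n x \<le> fermi_norm \<theta> x" if "n \<ge> m" for n
    using L(2)[rule_format, of "n - m"] that \<open>fermi_norm \<theta> x = L\<close> by (simp add: f_def)
qed

text \<open>Together with the next lemma: \<open>fermi_norm \<theta> x\<close> is the least common bound for left
  multiplication by \<open>x\<close> with respect to all infinite products of even states.\<close>

lemma fermi_norm_bound:
  assumes "even_seq \<omega>"
  shows "fnrm \<omega> (fmul x y) \<le> fermi_norm \<theta> x * fnrm \<omega> y"
proof -
  interpret state_sequence \<omega> by (rule even_seq_states[OF assms])
  obtain n m where "x \<in> nfold n" "y \<in> nfold m" using nfold_exhaust by metis
  then have xy: "x \<in> nfold (n + m + 1)" "y \<in> nfold (n + m + 1)"
    using nfold_mono[of n _ x] nfold_mono[of m _ y] by simp_all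
  have "fnrm \<omega> (fmul x y) \<le> min_norm \<theta> (n + m + 1) x * fnrm \<omega> y"
    using nbound_min_norm[OF _ xy(1)] assms xy(2) by (simp add: nbound_def)
  also have "\<dots> \<le> fermi_norm \<theta> x * fnrm \<omega> y"
    using min_norm_tendsto(2)[OF xy(1)] by (intro mult_right_mono) auto
  finally show ?thesis .
qed

lemma fermi_norm_le:
  assumes "0 \<le> C" "\<And>\<omega> y. even_seq \<omega> \<Longrightarrow> fnrm \<omega> (fmul x y) \<le> C * fnrm \<omega> y"
  shows "fermi_norm \<theta> x \<le> C"
proof -
  obtain n where "x \<in> nfold n" using nfold_exhaust by metis
  then have x: "x \<in> nfold (n + 1)" using nfold_mono[of n _ x] by simp
  have "min_norm \<theta> k x \<le> C" if "k \<ge> n + 1" for k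
    by (rule min_norm_le) (use that assms nfold_mono[OF that x] in \<open>auto simp: nbound_def\<close>)
  then show ?thesis
    by (intro LIMSEQ_le_const2[OF min_norm_tendsto(1)[OF x]]) auto
qed

lemma fermi_norm_nonneg: "0 \<le> fermi_norm \<theta> x"
proof -
  obtain n where "x \<in> nfold n" using nfold_exhaust by metis
  then have x: "x \<in> nfold (n + 1)" using nfold_mono[of n _ x] by simp
  have "0 \<le> min_norm \<theta> (n + 1) x" by (simp add: min_norm_def)
  also have "\<dots> \<le> fermi_norm \<theta> x" by (rule min_norm_tendsto(2)[OF x]) auto
  finally show ?thesis .
qed

lemma fermi_seminormed: "seminormed UNIV (fermi_norm \<theta>)"
proof
  have "fermi_norm \<theta> 0 \<le> 0"
  proof (rule fermi_norm_le)
    fix \<omega> and y :: "'a tensor" assume "even_seq \<omega>"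
    then interpret state_sequence \<omega> by (rule even_seq_states)
    show "fnrm \<omega> (fmul 0 y) \<le> 0 * fnrm \<omega> y"
      using clinear_zero[OF clinear_fmul_left] by simp
  qed simp
  then show "fermi_norm \<theta> 0 = 0" using fermi_norm_nonneg[of 0] by simp
  fix x y :: "'a tensor"
  show "fermi_norm \<theta> (x - y) \<le> fermi_norm \<theta> x + fermi_norm \<theta> y"
  proof (rule fermi_norm_le)
    fix \<omega> and z :: "'a tensor" assume \<omega>: "even_seq \<omega>"
    then interpret state_sequence \<omega> by (rule even_seq_states)
    have "nrm (fmul (x - y) z) = nrm (fmul x z + - fmul y z)"
      using clinear_diff[OF clinear_fmul_left] by simp
    also have "\<dots> \<le> nrm (fmul x z) + nrm (fmul y z)"
      using nrm_triangle[of "fmul x z" "- fmul y z"] by (simp only: nrm_minus)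
    also have "\<dots> \<le> (fermi_norm \<theta> x + fermi_norm \<theta> y) * nrm z"
      using fermi_norm_bound[OF \<omega>, of x z] fermi_norm_bound[OF \<omega>, of y z]
      by (simp add: distrib_right)
    finally show "nrm (fmul (x - y) z) \<le> (fermi_norm \<theta> x + fermi_norm \<theta> y) * nrm z" .
  qed (simp add: fermi_norm_nonneg)
qed auto

end

section \<open>Block swaps\<close>

lemma clinear_combine:
  "clinear f \<Longrightarrow> clinear g \<Longrightarrow> clinear (\<lambda>x. f x + g x)"
  "clinear f \<Longrightarrow> clinear g \<Longrightarrow> clinear (\<lambda>x. f x - g x)"
  "clinear f \<Longrightarrow> clinear (\<lambda>x. c *\<^sub>C f x)"
  by (simp_all add: clinear_iff scaleC_add_right scaleC_scaleC mult.commute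
      complex_vector.scale_right_diff_distrib)

definition swp :: "nat \<Rightarrow> nat \<Rightarrow> nat" where
  "swp M i = (if i < M then i + M else if i < 2 * M then i - M else i)"

lemma swp_swp [simp]: "swp M (swp M i) = i"
  by (auto simp: swp_def)

lemma swp_ge: "i \<ge> 2 * M \<Longrightarrow> swp M i = i"
  by (auto simp: swp_def)

lemma bij_swp: "bij (swp M)"
  by (rule involuntory_imp_bij) simp

lemma bij_betw_swp: "2 * M \<le> n \<Longrightarrow> bij_betw (swp M) {..<n} {..<n}"
  by (rule bij_betw_byWitness[where f' = "swp M"]) (auto simp: swp_def)

lemma prod_swp: "2 * M \<le> n \<Longrightarrow> (\<Prod>i<n. F (swp M i)) = (\<Prod>i<n. F i)"
  by (rule prod.reindex_bij_betw[OF bij_betw_swp])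

definition swp_perm :: "nat \<Rightarrow> nat perm" where
  "swp_perm M = Perm (swp M)"

lemma apply_swp_perm: "Perm.apply (swp_perm M) = swp M"
  unfolding swp_perm_def
proof (rule Perm_inverse, simp add: bij_swp)
  have "{a. swp M a \<noteq> a} \<subseteq> {..<2 * M}" by (auto simp: swp_def)
  then show "finite {a. swp M a \<noteq> a}" by (rule finite_subset) simp
qed

lemma fin_swp: "fin g \<Longrightarrow> fin (\<lambda>i. g (swp M i))"
  by (rule fin_comp) (auto intro: exI[of _ "2 * M"] simp: swp_ge)

lemma multilin_swp: "multilin (*\<^sub>C) (\<lambda>g. tf (\<lambda>i. g (swp M i)))"
proof (rule multilinI)
  fix g :: "nat \<Rightarrow> 'a" and i a b c assume g: "fin g"
  have upd: "(\<lambda>j. (g(i := a)) (swp M j)) = (\<lambda>j. g (swp M j))(swp M i := a)" for a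
    by (auto simp: fun_eq_iff)
  show "tf (\<lambda>j. (g(i := a + b)) (swp M j)) =
      tf (\<lambda>j. (g(i := a)) (swp M j)) + tf (\<lambda>j. (g(i := b)) (swp M j))"
    unfolding upd by (rule tf_upd_add[OF fin_swp[OF g]])
  show "tf (\<lambda>j. (g(i := c *\<^sub>C a)) (swp M j)) = c *\<^sub>C tf (\<lambda>j. (g(i := a)) (swp M j))"
    unfolding upd by (rule tf_upd_scale[OF fin_swp[OF g]])
qed

text \<open>This permutes slots without any sign and is in general not multiplicative for the Fermi
  product; \<open>fswap\<close> supplies the correction.\<close>

definition swp_op :: "nat \<Rightarrow> 'a::unital_cstar_algebra tensor \<Rightarrow> 'a tensor" where
  "swp_op M = tlift (*\<^sub>C) (\<lambda>g. tf (\<lambda>i. g (swp M i)))"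

lemma clinear_swp_op: "clinear (swp_op M)"
  unfolding swp_op_def by (rule tlift_linear[OF vector_space_scaleC multilin_swp])

lemma swp_op_tf: "fin g \<Longrightarrow> swp_op M (tf g) = tf (\<lambda>i. g (swp M i))"
  unfolding swp_op_def by (rule tlift_tf[OF vector_space_scaleC multilin_swp])

context graded
begin

section \<open>The block swap as an automorphism of the Fermi algebra\<close>

text \<open>Homogeneous tensors are eigenvectors, with the parity sign of the first \<open>n\<close>
  slots as eigenvalue. Sign corrections thus become linear operators on all tensors.\<close>

definition theta_below :: "nat \<Rightarrow> 'a tensor \<Rightarrow> 'a tensor" where
  "theta_below n = slotop (\<lambda>i. if i < n then \<theta> else (\<lambda>b. b))"

lemma slot_ok_theta_below: "slot_ok (\<lambda>i. if i < n then \<theta> else (\<lambda>b. b))"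
  by (rule slot_okI[of _ n]) (simp_all add: th_linear clinear_id)

lemma clinear_theta_below: "clinear (theta_below n)"
  unfolding theta_below_def by (rule clinear_slotop[OF slot_ok_theta_below])

definition psign :: "'a \<Rightarrow> complex" where "psign a = (if odd a then - 1 else 1)"

lemma theta_below_hom:
  assumes "fin g" "\<And>i. hom (g i)"
  shows "theta_below n (tf g) = (\<Prod>i<n. psign (g i)) *\<^sub>C tf g"
proof -
  have "(\<lambda>i. (if i < n then \<theta> else (\<lambda>b. b)) (g i)) = (\<lambda>i. if i < n then psign (g i) *\<^sub>C g i else g i)"
    using assms(2) homD by (auto simp: fun_eq_iff psign_def scaleC_minus_left)
  then show ?thesis
    unfolding theta_below_def slotop_tf[OF slot_ok_theta_below assms(1)]
    by (simp only: tf_scale_many[OF assms(1)])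
qed

text \<open>With \<open>p\<close>, \<open>q\<close> the parities of the two blocks and \<open>r = p q\<close>, the factor
  \<open>(1 + p + p r - r) / 2\<close> is the sign \<open>-1\<close> precisely if both blocks are odd.\<close>

definition fswap :: "nat \<Rightarrow> 'a tensor \<Rightarrow> 'a tensor" where
  "fswap M x = swp_op M ((1/2) *\<^sub>C (x + theta_below M x + theta_below M (theta_below (2 * M) x)
     - theta_below (2 * M) x))"

lemma clinear_fswap: "clinear (fswap M)"
proof -
  have "clinear (\<lambda>x. theta_below M (theta_below (2 * M) x))"
    by (rule clinear_compose[OF clinear_theta_below clinear_theta_below])
  then have "clinear (\<lambda>x. (1/2) *\<^sub>C (x + theta_below M x + theta_below M (theta_below (2 * M) x)
     - theta_below (2 * M) x))"
    by (intro clinear_combine clinear_id clinear_theta_below)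
  from clinear_compose[OF clinear_swp_op this] show ?thesis
    unfolding fswap_def .
qed

lemmas fswap_add = clinear_add[OF clinear_fswap]
lemmas fswap_scale = clinear_scale[OF clinear_fswap]
lemmas fswap_diff = clinear_diff[OF clinear_fswap]

text \<open>The swap keeps the order within each block and inverts exactly the pairs with one slot
  in either block. With \<open>k\<close> and \<open>l\<close> odd factors in the blocks the
  reordering sign is \<open>(-1)^(k l)\<close>.\<close>

definition block_sign :: "nat \<Rightarrow> (nat \<Rightarrow> 'a) \<Rightarrow> complex" where
  "block_sign M g = (if (\<Prod>i<M. psign (g i)) = - 1 \<and> (\<Prod>i\<in>{M..<2*M}. psign (g i)) = - 1 then - 1 else 1)"

lemma prod_psign: "(\<Prod>i\<in>A. psign (g i)) = 1 \<or> (\<Prod>i\<in>A. psign (g i)) = - 1"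
  by (induction A rule: infinite_finite_induct) (auto simp: psign_def)

lemma fswap_hom:
  assumes "fin g" "\<And>i. hom (g i)"
  shows "fswap M (tf g) = block_sign M g *\<^sub>C tf (\<lambda>i. g (swp M i))"
proof -
  define p where "p = (\<Prod>i<M. psign (g i))"
  define q where "q = (\<Prod>i\<in>{M..<2*M}. psign (g i))"
  have r: "(\<Prod>i<2*M. psign (g i)) = p * q"
    unfolding p_def q_def
    by (subst prod.union_disjoint[symmetric]) (auto intro!: prod.cong)
  have "(1/2) * (1 + p + p * (p * q) - p * q) = block_sign M g"
    using prod_psign[of g "{..<M}"] prod_psign[of g "{M..<2*M}"]
    by (auto simp: block_sign_def p_def[symmetric] q_def[symmetric])
  moreover have "(1/2) *\<^sub>C (tf g + p *\<^sub>C tf g + (p * (p * q)) *\<^sub>C tf g - (p * q) *\<^sub>C tf g) =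
      ((1/2) * (1 + p + p * (p * q) - p * q)) *\<^sub>C tf g"
    by (simp only: scaleC_scaleC[symmetric] complex_vector.scale_left_diff_distrib scaleC_add_left
        scaleC_one)
  ultimately have "(1/2) *\<^sub>C (tf g + theta_below M (tf g) + theta_below M (theta_below (2 * M) (tf g))
     - theta_below (2 * M) (tf g)) = block_sign M g *\<^sub>C tf g"
    by (simp only: theta_below_hom[OF assms] clinear_scale[OF clinear_theta_below] r
        p_def[symmetric] scaleC_scaleC mult.commute[of "p * q" p])
  then show ?thesis
    unfolding fswap_def by (simp only: clinear_scale[OF clinear_swp_op] swp_op_tf[OF assms(1)])
qed

lemma block_sign_square [simp]: "block_sign M g * block_sign M g = 1"
  by (simp add: block_sign_def)

lemma block_sign_swp: "block_sign M (\<lambda>i. g (swp M i)) = block_sign M g"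
proof -
  have "(\<Prod>i<M. psign (g (swp M i))) = (\<Prod>i\<in>{M..<2*M}. psign (g i))"
    by (rule prod.reindex_bij_betw, rule bij_betw_byWitness[where f' = "swp M"])
      (auto simp: swp_def)
  moreover have "(\<Prod>i\<in>{M..<2*M}. psign (g (swp M i))) = (\<Prod>i<M. psign (g i))"
    by (rule prod.reindex_bij_betw, rule bij_betw_byWitness[where f' = "swp M"])
      (auto simp: swp_def)
  ultimately show ?thesis by (simp add: block_sign_def conj_commute)
qed

lemma fswap_fswap [simp]: "fswap M (fswap M x) = x"
proof (induction x rule: hom_tensor_induct)
  case (tf g)
  then show ?case
    by (simp add: fswap_hom fswap_scale fin_swp block_sign_swp scaleC_scaleC)
qed (simp_all add: fswap_add fswap_scale)

text \<open>In \<open>star_form\<close> the involution acts slot by slot, by the same map in every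
  slot, so it commutes with \<open>swp_op\<close>. The block sign is real and depends on parities
  only, which \<open>star\<close> preserves.\<close>

lemma fswap_fstar: "fswap M (fstar x) = fstar (fswap M x)"
proof (induction x rule: hom_tensor_induct)
  case (tf g)
  then obtain n where n: "\<And>i. i \<ge> n \<Longrightarrow> g i = 1" by (auto simp: fin_def)
  have fin: "fin (\<lambda>i. star (g i))"
    using tf(1) by (rule fin_map[where u = "\<lambda>_. star"]) auto
  have "swp_op M (fstar (tf g)) = fstar (swp_op M (tf g))"
    using tf(1)
    by (simp add: fstar_tf swp_op_tf fin_swp star_form_def clinear_add[OF clinear_swp_op]
        clinear_scale[OF clinear_swp_op] fin_star_rot)
  moreover have "fswap M (fstar (tf g)) = block_sign M g *\<^sub>C swp_op M (fstar (tf g))"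
    using tf n by (simp add: fstar_hom[of g n] fswap_scale fswap_hom fin hom_star block_sign_def psign_def
        odd_star clinear_scale[OF clinear_swp_op] swp_op_tf scaleC_scaleC mult.commute)
  moreover have "fstar (fswap M (tf g)) = block_sign M g *\<^sub>C fstar (swp_op M (tf g))"
    using tf by (simp add: fswap_hom fstar_scale swp_op_tf block_sign_def)
  ultimately show ?case by simp
qed (simp_all add: fstar_add fstar_scale fswap_add fswap_scale)

lemma eps_odd: "eps \<theta> a b = (if odd a then psign b else 1)"
  by (simp add: eps_def psign_def)

lemma lmul_sign:
  assumes "fin h" "\<And>i. hom (h i)" "hom a"
  shows "lmul j a (tf h) = (if odd a then \<Prod>i<j. psign (h i) else 1) *\<^sub>C tf (h(j := a * h j))"
  using lmul_hom[of h j a] assms by (simp add: eps_odd)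

text \<open>An odd \<open>a\<close> in slot \<open>j\<close> of a block flips the parity of that
  block and thereby changes the block sign by the parity sign of the other block. This is the very
  factor by which the slots passed before and after the swap differ.\<close>

lemma swap_sign:
  assumes a: "hom a" "hom (h j)" "a * h j \<noteq> 0"
  shows "(if odd a then \<Prod>i<j. psign (h i) else 1) * block_sign M (h(j := a * h j)) =
    block_sign M h * (if odd a then \<Prod>i<swp M j. psign (h (swp M i)) else 1)"
proof -
  define h' where "h' = h(j := a * h j)"
  let ?P = "\<lambda>A. \<Prod>i\<in>A. psign (h i)" and ?P' = "\<lambda>A. \<Prod>i\<in>A. psign (h' i)"
  have sgj: "psign (h' j) = (if odd a then - psign (h j) else psign (h j))"
    using odd_mult[OF a] by (simp add: h'_def psign_def)
  have out: "?P' A = ?P A" if "j \<notin> A" for A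
    by (rule prod.cong) (use that in \<open>auto simp: h'_def\<close>)
  have inn: "?P' A = (if odd a then - ?P A else ?P A)" if "j \<in> A" "finite A" for A
    using that out[of "A - {j}"] sgj by (simp add: prod.remove[of A j])
  show ?thesis
  proof (cases "odd a")
    case False
    have "?P' A = ?P A" if "finite A" for A
      using inn[of A] out[of A] False that by (cases "j \<in> A") auto
    then have "block_sign M h' = block_sign M h" by (simp add: block_sign_def)
    then show ?thesis using False by (simp add: h'_def)
  next
    case True
    have img: "(\<Prod>i<swp M j. psign (h (swp M i))) = ?P (swp M ` {..<swp M j})"
      by (subst prod.reindex) (auto intro: inj_on_subset[OF bij_is_inj[OF bij_swp]])
    have mem: "x \<in> swp M ` A \<longleftrightarrow> swp M x \<in> A" for x A
      by (metis image_iff swp_swp)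
    define p where "p = ?P {..<M}"
    define q where "q = ?P {M..<2*M}"
    have pq: "p = 1 \<or> p = - 1" "q = 1 \<or> q = - 1" unfolding p_def q_def by (rule prod_psign)+
    consider "j < M" | "M \<le> j" "j < 2 * M" | "2 * M \<le> j" by linarith
    then show ?thesis
    proof cases
      case 1
      \<comment> \<open>In front of slot \<open>j + M\<close> the swapped tensor holds the whole
        former second block and the former slots below \<open>j\<close>.\<close>
      have "swp M ` {..<swp M j} = {M..<2*M} \<union> {..<j}"
        using 1 by (auto simp: set_eq_iff mem, auto simp: swp_def split: if_splits)
      then have "(\<Prod>i<swp M j. psign (h (swp M i))) = q * ?P {..<j}"
        unfolding img q_def using 1 by (simp only:, subst prod.union_disjoint) auto
      moreover have "block_sign M h' = (if - p = - 1 \<and> q = - 1 then - 1 else 1)"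
        using 1 True by (simp add: block_sign_def inn out p_def q_def)
      moreover have "block_sign M h = (if p = - 1 \<and> q = - 1 then - 1 else 1)"
        by (simp add: block_sign_def p_def q_def)
      ultimately show ?thesis using True pq by (auto simp: h'_def[symmetric])
    next
      case 2
      \<comment> \<open>Now \<open>a\<close> lands in slot \<open>j - M\<close>, so it no longer
        passes the former first block.\<close>
      have "swp M ` {..<swp M j} = {M..<j}"
        using 2 by (auto simp: set_eq_iff mem, auto simp: swp_def split: if_splits)
      moreover have "?P {..<j} = p * ?P {M..<j}"
        unfolding p_def using 2 by (subst prod.union_disjoint[symmetric]) (auto intro!: prod.cong)
      moreover have "block_sign M h' = (if p = - 1 \<and> - q = - 1 then - 1 else 1)"
        using 2 True by (simp add: block_sign_def inn out p_def q_def)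
      moreover have "block_sign M h = (if p = - 1 \<and> q = - 1 then - 1 else 1)"
        by (simp add: block_sign_def p_def q_def)
      ultimately show ?thesis using True pq by (auto simp: h'_def[symmetric] img)
    next
      case 3
      have "(\<Prod>i<swp M j. psign (h (swp M i))) = ?P {..<j}"
        using 3 by (simp add: swp_ge prod_swp[of M j "\<lambda>i. psign (h i)"])
      moreover have "block_sign M h' = block_sign M h"
        using 3 by (simp add: block_sign_def out)
      ultimately show ?thesis using True by (simp add: h'_def[symmetric])
    qed
  qed
qed

text \<open>This is multiplicativity for a one-slot left factor, from which
  \<open>emb_induct\<close> yields the general case in \<open>fswap_fmul\<close>.\<close>

lemma fswap_lmul: "fswap M (lmul j a x) = lmul (swp M j) a (fswap M x)"
proof -
  have hom_case: "fswap M (lmul j a x) = lmul (swp M j) a (fswap M x)" if a: "hom a" for a x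
  proof (induction x rule: hom_tensor_induct)
    case (tf h)
    let ?h = "h(j := a * h j)"
    let ?k = "\<lambda>i. h (swp M i)"
    have upd: "(\<lambda>i. ?h (swp M i)) = ?k(swp M j := a * ?k (swp M j))"
      by (auto simp: fun_eq_iff)
    have homh: "hom (?h i)" for i using tf a by (cases "i = j") (auto simp: hom_mult)
    have l: "fswap M (lmul j a (tf h)) =
        ((if odd a then \<Prod>i<j. psign (h i) else 1) * block_sign M ?h) *\<^sub>C tf (\<lambda>i. ?h (swp M i))"
      using fswap_hom[of ?h M] homh tf
      by (simp only: lmul_sign[OF tf a] fswap_scale fin_upd scaleC_scaleC)
    have r: "lmul (swp M j) a (fswap M (tf h)) =
        (block_sign M h * (if odd a then \<Prod>i<swp M j. psign (?k i) else 1)) *\<^sub>C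
          tf (?k(swp M j := a * ?k (swp M j)))"
      by (simp only: fswap_hom[OF tf] clinear_scale[OF clinear_lmul]
          lmul_sign[OF fin_swp[OF tf(1)] tf(2) a] scaleC_scaleC)
    show ?case
    proof (cases "a * h j = 0")
      case True
      then have "tf (?k(swp M j := a * ?k (swp M j))) = 0"
        by (intro tf_eq_zero[of _ "swp M j"]) (simp_all add: fin_swp tf)
      then show ?thesis unfolding l r upd by (simp only: scaleC_zero_right)
    next
      case False
      then show ?thesis unfolding l r upd using swap_sign[of a h j M, OF a tf(2) False] by (simp only:)
    qed
  qed (simp_all add: clinear_add[OF clinear_lmul] clinear_scale[OF clinear_lmul] fswap_add
      fswap_scale)
  have "lmul j a x = lmul j (ev a) x + lmul j (od a) x" for j x
    by (simp only: lmul_add[symmetric] ev_od)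
  then show ?thesis by (simp add: fswap_add hom_case hom_ev hom_od)
qed

lemma fswap_tunit: "fswap M tunit = tunit"
  by (simp add: tunit_eq_tf fswap_hom block_sign_def psign_def)

lemma fswap_emb: "fswap M (emb j a) = emb (swp M j) a"
proof -
  have "fswap M (emb j a) = fswap M (lmul j a tunit)"
    by (simp flip: fmul_emb)
  also have "\<dots> = lmul (swp M j) a tunit" by (simp add: fswap_lmul fswap_tunit)
  finally show ?thesis by (simp flip: fmul_emb)
qed

lemma fswap_fmul: "fswap M (fmul x y) = fmul (fswap M x) (fswap M y)"
proof -
  have "\<forall>y. fswap M (fmul x y) = fmul (fswap M x) (fswap M y)"
    by (induction x rule: emb_induct)
      (simp_all add: fmul_emb fswap_emb fswap_lmul fmul_add_left fmul_scale_left fswap_add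
        fswap_scale fmul_assoc)
  then show ?thesis by blast
qed

text \<open>The elements \<open>emb j a\<close> generate the algebra, so an automorphism is
  determined by its values on them and the definite description has no other solution.\<close>

lemma perm_alg_swp: "perm_alg \<theta> (swp_perm M) = fswap M"
  unfolding perm_alg_def apply_swp_perm
proof (rule the_equality)
  show "fermi_automorphism \<theta> (fswap M) \<and> (\<forall>j a. fswap M (emb j a) = emb (swp M j) a)"
    by (auto simp: fermi_automorphism_def fermi_mult_eq fermi_star_eq clinear_fswap fswap_fmul
        fswap_fstar fswap_emb intro: involuntory_imp_bij)
  fix f assume f: "fermi_automorphism \<theta> f \<and> (\<forall>j a. f (emb j a) = emb (swp M j) a)"
  then have lin: "clinear f" and mult: "\<And>x y. f (fmul x y) = fmul (f x) (f y)"
    by (auto simp: fermi_automorphism_def fermi_mult_eq)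
  have "f x = fswap M x" for x
    by (induction x rule: emb_induct)
      (use f in \<open>simp_all add: fswap_emb fswap_add fswap_scale fswap_fmul clinear_add[OF lin]
        clinear_scale[OF lin] mult\<close>)
  then show "f = fswap M" by blast
qed

lemma even_seq_swp: "even_seq \<omega> \<Longrightarrow> even_seq (\<lambda>i. \<omega> (swp M i))"
  by (simp add: even_seq_def)

lemma pform_nonzero_odd:
  assumes "even_seq \<omega>" "\<And>i. hom (g i)" "\<And>i. hom (h i)" "\<omega> i (star (g i) * h i) \<noteq> 0"
  shows "odd (g i) \<longleftrightarrow> odd (h i)"
proof -
  interpret state_sequence \<omega> by (rule even_seq_states[OF assms(1)])
  show ?thesis
    using even_seq_odd[OF assms(1), of "star (g i) * h i" i] odd_mult[of "star (g i)" "h i"] assms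
    by (metis hom_star odd_star st_zero)
qed

text \<open>A nonzero product of slot factors forces equal parities of \<open>g i\<close> and
  \<open>h i\<close>, hence equal block signs, whose product is \<open>1\<close>. What remains is a
  reindexing of the product.\<close>

lemma form_fswap:
  assumes "even_seq \<omega>"
  shows "form \<omega> (fswap M x) (fswap M y) = form (\<lambda>i. \<omega> (swp M i)) x y"
proof -
  interpret state_sequence \<omega> by (rule even_seq_states[OF assms])
  interpret s: state_sequence "\<lambda>i. \<omega> (swp M i)" by (rule even_seq_states[OF even_seq_swp[OF assms]])
  show ?thesis
  proof (induction x rule: hom_tensor_induct)
    case (tf g)
    note g = tf
    show ?case
    proof (induction y rule: hom_tensor_induct)
      case (tf h)
      obtain m where m: "\<And>i. i \<ge> m \<Longrightarrow> g i = 1" "\<And>i. i \<ge> m \<Longrightarrow> h i = 1"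
        using fin_common g(1) tf(1) by blast
      define n where "n = max m (2 * M)"
      have n: "\<And>i. i \<ge> n \<Longrightarrow> g i = 1" "\<And>i. i \<ge> n \<Longrightarrow> h i = 1" "2 * M \<le> n"
        using m by (auto simp: n_def)
      define w where "w i = \<omega> (swp M i) (star (g i) * h i)" for i
      have "form \<omega> (fswap M (tf g)) (fswap M (tf h)) =
          block_sign M g * (block_sign M h * form \<omega> (tf (\<lambda>i. g (swp M i))) (tf (\<lambda>i. h (swp M i))))"
      proof -
        have "cnj (block_sign M g) = block_sign M g" by (simp add: block_sign_def)
        then show ?thesis
          by (simp add: fswap_hom[OF g] fswap_hom[OF tf] form_scale_left form_scale_right)
      qed
      also have "form \<omega> (tf (\<lambda>i. g (swp M i))) (tf (\<lambda>i. h (swp M i))) =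
          (\<Prod>i<n. \<omega> i (star (g (swp M i)) * h (swp M i)))"
        unfolding form_tf[OF fin_swp[OF g(1)] fin_swp[OF tf(1)]]
        by (rule pform_eq) (use n in \<open>auto simp: swp_ge\<close>)
      also have "\<dots> = (\<Prod>i<n. w (swp M i))" by (simp add: w_def)
      also have "\<dots> = (\<Prod>i<n. w i)" by (rule prod_swp[OF n(3)])
      also have "block_sign M g * (block_sign M h * (\<Prod>i<n. w i)) = (\<Prod>i<n. w i)"
      proof (cases "(\<Prod>i<n. w i) = 0")
        case False
        then have nz: "w i \<noteq> 0" if "i < n" for i using that by auto
        have "odd (g i) \<longleftrightarrow> odd (h i)" if "i < n" for i
          by (rule pform_nonzero_odd[of "\<lambda>i. \<omega> (swp M i)"])
            (use even_seq_swp[OF assms] g(2) tf(2) nz[OF that] in \<open>simp_all add: w_def\<close>)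
        then have "odd (g i) \<longleftrightarrow> odd (h i)" for i using n(1,2)[of i] by (cases "i < n") auto
        then have "block_sign M g = block_sign M h" by (simp add: block_sign_def psign_def)
        then show ?thesis by (simp flip: mult.assoc)
      qed simp
      also have "(\<Prod>i<n. w i) = form (\<lambda>i. \<omega> (swp M i)) (tf g) (tf h)"
        unfolding s.form_tf[OF g(1) tf(1)] w_def by (rule s.pform_eq[symmetric]) (use n in auto)
      finally show ?case .
    qed (simp_all add: fswap_add fswap_scale form_add_right form_scale_right s.form_add_right
        s.form_scale_right)
  qed (simp_all add: fswap_add fswap_scale form_add_left form_scale_left s.form_add_left
      s.form_scale_left)
qed

text \<open>The swap permutes the even product states among themselves and carries the test vectors
  along isometrically.\<close>

lemma fermi_norm_fswap: "fermi_norm \<theta> (fswap M x) \<le> fermi_norm \<theta> x"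
proof (rule fermi_norm_le[OF fermi_norm_nonneg])
  fix \<omega> and y :: "'a tensor" assume \<omega>: "even_seq \<omega>"
  interpret state_sequence \<omega> by (rule even_seq_states[OF \<omega>])
  interpret s: state_sequence "\<lambda>i. \<omega> (swp M i)" by (rule even_seq_states[OF even_seq_swp[OF \<omega>]])
  have iso: "nrm (fswap M z) = s.nrm z" for z
    by (simp add: nrm_def s.nrm_def form_fswap[OF \<omega>])
  have "nrm (fmul (fswap M x) y) = nrm (fswap M (fmul x (fswap M y)))"
    by (simp add: fswap_fmul)
  also have "\<dots> \<le> fermi_norm \<theta> x * s.nrm (fswap M y)"
    unfolding iso by (rule fermi_norm_bound[OF even_seq_swp[OF \<omega>]])
  also have "s.nrm (fswap M y) = nrm y" by (simp flip: iso)
  finally show "nrm (fmul (fswap M x) y) \<le> fermi_norm \<theta> x * nrm y" .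
qed

section \<open>Weak ergodicity\<close>

text \<open>Slots from \<open>M\<close> on contribute only factors \<open>\<omega> i 1 = 1\<close>,
  so the states there may be exchanged without affecting vectors of the first block.\<close>

lemma form_local:
  assumes "even_seq \<omega>" "even_seq \<omega>'" "\<And>i. i < M \<Longrightarrow> \<omega> i = \<omega>' i" "x \<in> nfold M" "y \<in> nfold M"
  shows "form \<omega> x y = form \<omega>' x y"
proof -
  interpret state_sequence \<omega> by (rule even_seq_states[OF assms(1)])
  interpret s: state_sequence \<omega>' by (rule even_seq_states[OF assms(2)])
  from assms(4) show ?thesis
  proof (induction x rule: nfold_hom_induct)
    case (tf g)
    note g = tf
    from assms(5) show ?case
    proof (induction y rule: nfold_hom_induct)
      case (tf h)
      then show ?case using g assms(3)
        by (simp add: form_tf s.form_tf pform_eq[of M] s.pform_eq[of M])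
    qed (simp_all add: form_add_right form_scale_right s.form_add_right s.form_scale_right)
  qed (simp_all add: form_add_left form_scale_left s.form_add_left s.form_scale_left)
qed

lemma prod_lessThan_add: "(\<Prod>i<M + N. F i) = (\<Prod>i<M. F i) * (\<Prod>i<N. F (i + M :: nat))"
  for F :: "nat \<Rightarrow> complex"
  by (induction N) (simp_all add: ac_simps)

text \<open>Integrating out the second block turns the swapped copy of \<open>y\<close> into a scalar.\<close>

lemma form_fswap_scalar:
  assumes \<omega>: "even_seq \<omega>" and \<omega>0: "even_state \<theta> \<omega>0" "\<And>i. i \<ge> M \<Longrightarrow> \<omega> i = \<omega>0"
    and "w \<in> nfold M" "y \<in> nfold M" "z \<in> nfold M"
  shows "form \<omega> w (fmul (fswap M y) z) = form (\<lambda>_. \<omega>0) tunit y * form \<omega> w z"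
proof -
  have es0: "even_seq (\<lambda>_. \<omega>0)" using \<omega>0 by (simp add: even_seq_def)
  interpret state_sequence \<omega> by (rule even_seq_states[OF \<omega>])
  interpret s: state_sequence "\<lambda>_. \<omega>0" by (rule even_seq_states[OF es0])
  from assms(5) show ?thesis
  proof (induction y rule: nfold_hom_induct)
    case (tf g)
    note g = tf
    let ?g = "\<lambda>i. g (swp M i)"
    have fg: "fswap M (tf g) = tf ?g"
    proof -
      have "block_sign M g = 1" using g(2) by (simp add: block_sign_def psign_def)
      then show ?thesis by (simp add: fswap_hom[OF g(1,3)])
    qed
    from assms(6) show ?case
    proof (induction z rule: nfold_hom_induct)
      case (tf h)
      note h = tf
      from assms(4) show ?case
      proof (induction w rule: nfold_hom_induct)
        case (tf k)
        let ?s = "\<Prod>i<M + M. \<Prod>j<i. eps \<theta> (?g i) (h j)"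
        let ?A = "\<Prod>i<M. \<omega> i (star (k i) * h i)" and ?B = "\<Prod>i<M. \<omega>0 (g i)"
        have fin: "fin (\<lambda>i. ?g i * h i)" by (intro fin_mult fin_swp g h)
        have "fmul (tf ?g) (tf h) = ?s *\<^sub>C tf (\<lambda>i. ?g i * h i)"
          by (rule fmul_hom) (use g h in \<open>auto simp: swp_ge\<close>)
        then have "form \<omega> (tf k) (fmul (tf ?g) (tf h)) = ?s * pform \<omega> k (\<lambda>i. ?g i * h i)"
          by (simp add: form_scale_right form_tf tf fin)
        also have "pform \<omega> k (\<lambda>i. ?g i * h i) = (\<Prod>i<M + M. \<omega> i (star (k i) * (?g i * h i)))"
          by (rule pform_eq) (use g h tf in \<open>auto simp: swp_ge\<close>)
        also have "\<dots> = ?A * ?B"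
          \<comment> \<open>Below \<open>M\<close> the swapped \<open>g\<close> is \<open>1\<close>;
            in the second block \<open>k\<close> and \<open>h\<close> are \<open>1\<close> and every
            state is \<open>\<omega>0\<close>. So the product factorizes.\<close>
          unfolding prod_lessThan_add
          by (intro arg_cong2[of _ _ _ _ "(*)"] prod.cong)
            (use g h tf \<omega>0(2) in \<open>auto simp: swp_def\<close>)
        \<comment> \<open>If \<open>?B\<close> is nonzero no \<open>g i\<close> is odd, since
          \<open>\<omega>0\<close> vanishes on odd elements, and then there is no sign.\<close>
        also have "?s * (?A * ?B) = ?A * ?B"
        proof (cases "?B = 0")
          case False
          then have "\<not> odd (g i)" if "i < M" for i using that even_seq_odd[OF es0] by auto
          then have "\<not> odd (g i)" for i using g(2) by (cases "i < M") auto
          then have "?s = 1" by (intro prod.neutral ballI) (simp add: eps_odd)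
          then show ?thesis by simp
        qed simp
        also have "?A = form \<omega> (tf k) (tf h)"
          using h tf by (simp add: form_tf pform_eq[of M])
        also have "?B = form (\<lambda>_. \<omega>0) tunit (tf g)"
          using g by (simp add: s.form_one_tf[of M])
        finally show ?case by (simp add: fg mult.commute)
      qed (simp_all add: form_add_left form_scale_left algebra_simps)
    qed (simp_all add: fmul_add_right fmul_scale_right form_add_right form_scale_right algebra_simps)
  qed (simp_all add: fswap_add fswap_scale fmul_add_left fmul_scale_left form_add_right
      form_scale_right s.form_add_right s.form_scale_right algebra_simps)
qed

text \<open>Tested against vectors of the first block, the swapped copy of \<open>y\<close> and the
  scalar \<open>c\<close> act alike. So \<open>y - c 1\<close> inherits the bound of
  \<open>y - fswap M y\<close>, with \<open>M\<close> depending on the vector acted on.\<close>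

lemma fermi_norm_sub_scalar:
  assumes \<omega>0: "even_state \<theta> \<omega>0" and y: "y \<in> nfold n"
    and e: "\<And>M. M \<ge> n \<Longrightarrow> fermi_norm \<theta> (y - fswap M y) \<le> e"
  shows "fermi_norm \<theta> (y - form (\<lambda>_. \<omega>0) tunit y *\<^sub>C tunit) \<le> e"
proof (rule fermi_norm_le)
  show e0: "0 \<le> e" using e[of n] fermi_norm_nonneg[of "y - fswap n y"] by simp
  fix \<omega> and z :: "'a tensor" assume \<omega>: "even_seq \<omega>"
  define c where "c = form (\<lambda>_. \<omega>0) tunit y"
  obtain m where m: "z \<in> nfold m" using nfold_exhaust by blast
  \<comment> \<open>The first block must contain both \<open>y\<close> and \<open>z\<close>.\<close>
  define M where "M = max n m"
  have yM: "y \<in> nfold M" and zM: "z \<in> nfold M" and nM: "n \<le> M"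
    using y m nfold_mono[of n M y] nfold_mono[of m M z] by (auto simp: M_def)
  \<comment> \<open>The given states are kept where \<open>y\<close> and \<open>z\<close> live; the
    second block receives the constant state that turns the swapped copy into a scalar.\<close>
  define \<omega>' where "\<omega>' i = (if i < M then \<omega> i else \<omega>0)" for i
  have \<omega>': "even_seq \<omega>'" using \<omega> \<omega>0 by (simp add: even_seq_def \<omega>'_def)
  interpret state_sequence \<omega> by (rule even_seq_states[OF \<omega>])
  interpret s: state_sequence \<omega>' by (rule even_seq_states[OF \<omega>'])
  have nrm_eq: "nrm x = s.nrm x" if "x \<in> nfold M" for x
    unfolding nrm_def s.nrm_def using form_local[OF \<omega> \<omega>' _ that that] by (simp add: \<omega>'_def)
  define v where "v = fmul (y - c *\<^sub>C tunit) z"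
  have v: "v = fmul y z - c *\<^sub>C z"
    unfolding v_def using clinear_diff[OF clinear_fmul_left] by (simp add: fmul_scale_left)
  have vM: "v \<in> nfold M" unfolding v by (intro span_nfold_closed fmul_nfold yM zM)
  \<comment> \<open>The vector \<open>fmul (fswap M y) z\<close> differs from
    \<open>c *\<^sub>C z\<close> in general, but their inner products with \<open>nfold M\<close>
    agree. As \<open>v\<close> lies in \<open>nfold M\<close>, duality within that space determines
    its norm.\<close>
  have "s.nrm v \<le> e * s.nrm z"
  proof (rule s.nrm_le_if_dual[OF _ vM])
    fix w :: "'a tensor" assume w: "w \<in> nfold M"
    have "form \<omega>' w v = form \<omega>' w (fmul y z) - c * form \<omega>' w z"
      unfolding v by (simp add: s.diff_right s.scale_right)
    also have "c * form \<omega>' w z = form \<omega>' w (fmul (fswap M y) z)"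
      unfolding c_def
      by (rule form_fswap_scalar[symmetric, OF \<omega>' \<omega>0 _ w yM zM]) (simp add: \<omega>'_def)
    also have "form \<omega>' w (fmul y z) - form \<omega>' w (fmul (fswap M y) z) =
        form \<omega>' w (fmul (y - fswap M y) z)"
      using clinear_diff[OF clinear_fmul_left] by (simp add: s.diff_right)
    finally have "cmod (form \<omega>' w v) \<le> s.nrm w * s.nrm (fmul (y - fswap M y) z)"
      using s.cauchy_schwarz by simp
    also have "\<dots> \<le> s.nrm w * (e * s.nrm z)"
      using fermi_norm_bound[OF \<omega>', of "y - fswap M y" z] mult_right_mono[OF e[OF nM] s.nrm_nonneg[of z]]
      by (intro mult_left_mono) auto
    finally show "cmod (form \<omega>' w v) \<le> e * s.nrm z * s.nrm w" by (simp add: mult_ac)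
  qed (simp add: e0)
  then show "nrm (fmul (y - form (\<lambda>_. \<omega>0) tunit y *\<^sub>C tunit) z) \<le> e * nrm z"
    using nrm_eq[OF vM] nrm_eq[OF zM] by (simp add: v_def c_def)
qed

text \<open>Cauchy-Schwarz with the unit vector \<open>tunit\<close>. It transfers the Cauchy
  property from the approximants to their scalars.\<close>

lemma form_tunit_le:
  assumes "even_seq \<omega>"
  shows "cmod (form \<omega> tunit y) \<le> fermi_norm \<theta> y"
proof -
  interpret state_sequence \<omega> by (rule even_seq_states[OF assms])
  have "form \<omega> tunit tunit = 1" unfolding tunit_eq_tf by (simp add: form_tf pform_def)
  then have one: "nrm tunit = 1" by (simp add: nrm_def)
  have "cmod (form \<omega> tunit y) \<le> nrm tunit * nrm y" by (rule cauchy_schwarz)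
  also have "\<dots> \<le> fermi_norm \<theta> y" using fermi_norm_bound[OF assms, of y tunit] by (simp add: one)
  finally show ?thesis .
qed

lemma fermi_norm_scalar: "fermi_norm \<theta> (c *\<^sub>C tunit) \<le> cmod c"
proof (rule fermi_norm_le)
  fix \<omega> and y :: "'a tensor" assume "even_seq \<omega>"
  then interpret state_sequence \<omega> by (rule even_seq_states)
  show "nrm (fmul (c *\<^sub>C tunit) y) \<le> cmod c * nrm y" by (simp add: fmul_scale_left nrm_scale)
qed simp

lemma weak_ergodicity:
  assumes x: "x \<in> fermi_product \<theta>" and inv: "\<And>\<sigma> :: nat perm. perm_action \<theta> \<sigma> x = x"
  shows "\<exists>c. x = fermi_embed \<theta> (c *\<^sub>C tunit)"
proof -
  let ?p = "fermi_norm \<theta>"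
  interpret seminormed UNIV ?p by (rule fermi_seminormed)
  obtain s where s: "cauchy_seq UNIV ?p s" and xs: "x = completion_class UNIV ?p s"
    using x by (auto simp: fermi_product_def completion_def)
  have embedI: "x = fermi_embed \<theta> y" if "(\<lambda>k. ?p (s k - y)) \<longlonglongrightarrow> 0" for y
    unfolding xs fermi_embed_def by (rule class_eqI[OF cauchy_seq_const s that]) simp
  show ?thesis
  proof (cases "\<exists>\<omega>0. even_state \<theta> \<omega>0")
    case False
    have "?p y = 0" for y
    proof -
      have "?p y \<le> 0" by (rule fermi_norm_le) (use False in \<open>auto simp: even_seq_def\<close>)
      then show ?thesis using fermi_norm_nonneg[of y] by simp
    qed
    then show ?thesis using embedI[of "0 *\<^sub>C tunit"] by (intro exI[of _ 0]) simp
  next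
    case True
    then obtain \<omega>0 where \<omega>0: "even_state \<theta> \<omega>0" by blast
    then have even_seq: "even_seq (\<lambda>_. \<omega>0)" by (simp add: even_seq_def)
    interpret st: state_sequence "\<lambda>_. \<omega>0" by (rule even_seq_states[OF even_seq])
    define c where "c k = form (\<lambda>_. \<omega>0) tunit (s k)" for k
    have fixed: "(\<lambda>k. ?p (s k - fswap M (s k))) \<longlonglongrightarrow> 0" for M
    proof -
      have f: "\<And>x. x \<in> UNIV \<Longrightarrow> fswap M x \<in> UNIV"
        "\<And>x y. x \<in> UNIV \<Longrightarrow> y \<in> UNIV \<Longrightarrow> fswap M (x - y) = fswap M x - fswap M y"
        "\<And>x. x \<in> UNIV \<Longrightarrow> ?p (fswap M x) \<le> 1 * ?p x"
        using fermi_norm_fswap by (auto simp: fswap_diff)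
      have "perm_action \<theta> (swp_perm M) x = completion_class UNIV ?p (fswap M \<circ> s)"
        unfolding perm_action_def perm_alg_swp xs by (rule completion_map_class[OF f s])
      then have "s \<in> completion_class UNIV ?p (fswap M \<circ> s)"
        using inv[of "swp_perm M"] xs class_refl[OF s] by simp
      then show ?thesis by (simp add: completion_class_def)
    qed
    have near: "\<exists>K. \<forall>k\<ge>K. ?p (s k - c k *\<^sub>C tunit) \<le> 3 * e" if e: "0 < e" for e
    proof -
      obtain K where K: "\<And>k l. k \<ge> K \<Longrightarrow> l \<ge> K \<Longrightarrow> ?p (s k - s l) < e"
        using cauchy_seqD[OF s e] by blast
      have "?p (s k - c k *\<^sub>C tunit) \<le> 3 * e" if k: "k \<ge> K" for k
      proof -
        obtain n where n: "s k \<in> nfold n" using nfold_exhaust by blast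
        show ?thesis
          unfolding c_def
        proof (rule fermi_norm_sub_scalar[OF \<omega>0 n])
          fix M
          \<comment> \<open>The rate in \<open>fixed\<close> depends on \<open>M\<close>, whereas
            \<open>k\<close> has to serve every \<open>M\<close>. Near-invariance is therefore used
            at an index \<open>l\<close> chosen after \<open>M\<close>, and moving from
            \<open>k\<close> to \<open>l\<close> and back costs two more errors
            \<open>e\<close>.\<close>
          have "eventually (\<lambda>l. ?p (s l - fswap M (s l)) < e) sequentially"
            using order_tendstoD(2)[OF fixed e] .
          then obtain L where L: "\<forall>l\<ge>L. ?p (s l - fswap M (s l)) < e"
            unfolding eventually_sequentially by blast
          define l where "l = max K L"
          have l: "l \<ge> K" "?p (s l - fswap M (s l)) < e" using L by (simp_all add: l_def)
          have "?p (s k - fswap M (s k)) \<le> ?p (s k - s l) + ?p (s l - fswap M (s k))"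
            by (rule p_tri) auto
          also have "?p (s l - fswap M (s k)) \<le>
              ?p (s l - fswap M (s l)) + ?p (fswap M (s l) - fswap M (s k))"
            by (rule p_tri) auto
          also have "?p (fswap M (s l) - fswap M (s k)) \<le> ?p (s l - s k)"
            unfolding fswap_diff[symmetric] by (rule fermi_norm_fswap)
          finally show "?p (s k - fswap M (s k)) \<le> 3 * e"
            using K[OF k l(1)] K[OF l(1) k] l(2) by linarith
        qed
      qed
      then show ?thesis by blast
    qed
    have "Cauchy c"
    proof (rule metric_CauchyI)
      fix e :: real assume "0 < e"
      then obtain K where K: "\<And>k l. k \<ge> K \<Longrightarrow> l \<ge> K \<Longrightarrow> ?p (s k - s l) < e"
        using cauchy_seqD[OF s] by blast
      have "dist (c k) (c l) < e" if "k \<ge> K" "l \<ge> K" for k l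
      proof -
        have "dist (c k) (c l) = cmod (form (\<lambda>_. \<omega>0) tunit (s k - s l))"
          by (simp add: dist_norm c_def st.diff_right)
        also have "\<dots> \<le> ?p (s k - s l)" by (rule form_tunit_le[OF even_seq])
        finally show ?thesis using K[OF that] by linarith
      qed
      then show "\<exists>M. \<forall>m\<ge>M. \<forall>n\<ge>M. dist (c m) (c n) < e" by blast
    qed
    then obtain d where d: "c \<longlonglongrightarrow> d" using Cauchy_convergent convergent_def by blast
    have "(\<lambda>k. ?p (s k - d *\<^sub>C tunit)) \<longlonglongrightarrow> 0"
    proof (rule squeeze_zero)
      have "(\<lambda>k. ?p (s k - c k *\<^sub>C tunit)) \<longlonglongrightarrow> 0"
      proof (rule LIMSEQ_I)
        fix r :: real assume r: "0 < r"
        \<comment> \<open>A quarter of \<open>r\<close> leaves room for the strict inequality after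
          tripling.\<close>
        then obtain K where "\<forall>k\<ge>K. ?p (s k - c k *\<^sub>C tunit) \<le> 3 * (r / 4)"
          using near[of "r / 4"] by auto
        then show "\<exists>K. \<forall>k\<ge>K. norm (?p (s k - c k *\<^sub>C tunit) - 0) < r"
          using r fermi_norm_nonneg by (intro exI[of _ K]) fastforce
      qed
      moreover have "(\<lambda>k. cmod (c k - d)) \<longlonglongrightarrow> 0"
        using d by (simp add: LIM_zero_iff tendsto_norm_zero)
      ultimately show "(\<lambda>k. ?p (s k - c k *\<^sub>C tunit) + cmod (c k - d)) \<longlonglongrightarrow> 0"
        by (rule tendsto_add_zero)
      fix k
      show "0 \<le> ?p (s k - d *\<^sub>C tunit)" by (rule fermi_norm_nonneg)
      have "?p (s k - d *\<^sub>C tunit) \<le>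
          ?p (s k - c k *\<^sub>C tunit) + ?p (c k *\<^sub>C tunit - d *\<^sub>C tunit)"
        by (rule p_tri) auto
      also have "?p (c k *\<^sub>C tunit - d *\<^sub>C tunit) \<le> cmod (c k - d)"
        using fermi_norm_scalar[of "c k - d"]
        by (simp add: complex_vector.scale_left_diff_distrib)
      finally show "?p (s k - d *\<^sub>C tunit) \<le> ?p (s k - c k *\<^sub>C tunit) + cmod (c k - d)"
        by simp
    qed
    then show ?thesis using embedI by blast
  qed
qed

end

theorem proposition3p6:
  fixes \<theta> :: "'a::unital_cstar_algebra \<Rightarrow> 'a"
    and x :: "(nat \<Rightarrow> 'a tensor) set"
  assumes "grading \<theta>"
    and "x \<in> fermi_product \<theta>"
    and "\<forall>\<sigma> :: nat perm. perm_action \<theta> \<sigma> x = x"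
  shows "\<exists>c :: complex. x = fermi_embed \<theta> (c *\<^sub>C tunit)"
proof -
  interpret graded \<theta> by unfold_locales (fact assms(1))
  show ?thesis using weak_ergodicity assms(2,3) by blast
qed

end
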